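(* For any $\Pi^0_3$ subset $R$ of $M$ there is a computable real number $\xi$ such that for all $r\in M$, $r\in R$ if and only if $\xi$ is normal to base $r$. Furthermore, $\xi$ is computable uniformly in the $\Pi^0_3$ formula that defines $R$ (i.e., there is a computable procedure which, given the $\Pi^0_3$ formula, produces an index computing $\xi$).
   Context: A base is an integer $r\geq 2$. Two bases are multiplicatively dependent if one is a rational power of the other (equivalently $r^p=s^q$ for some positive integers $p,q$); this is an equivalence relation, and $M$ denotes the set of minimal elements of its equivalence classes. For a real $x$, $\{x\}$ is its fractional part. For $\vec\xi=(\xi_1,\dots,\xi_N)$ in $[0,1]$, $D(\vec\xi)=\sup_{0\leq u<v\leq 1}\bigl|\#\{n:1\leq n\leq N,\ u\leq \xi_n<v\}/N-(v-u)\bigr|$. A real $\xi$ is normal to base $r$ iff $\lim_{N\to\infty}D(\{r^j\xi\}:0\leq j<N)=0$. A subset of $\mathbb{N}$ is $\Pi^0_3$ if it is definable in the natural numbers by an arithmetic formula of the form $\forall x\exists y\forall z\,\theta$ with $\theta$ having only bounded quantifiers. *)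

theory Defs
  imports Complex_Main "HOL-Library.Nat_Bijection"
begin

section \<open>Bases, discrepancy and normality\<close>

definition base :: "nat \<Rightarrow> bool" where
  "base r \<longleftrightarrow> r \<ge> 2"

definition mult_dependent :: "nat \<Rightarrow> nat \<Rightarrow> bool" where
  "mult_dependent r s \<longleftrightarrow>
     (\<exists>q\<in>\<rat>. real r = real s powr q) \<or> (\<exists>q\<in>\<rat>. real s = real r powr q)"

lemma mult_dependent_iff_power:
  assumes "base r" "base s"
  shows "mult_dependent r s \<longleftrightarrow> (\<exists>p q. 0 < p \<and> 0 < q \<and> r ^ p = s ^ q)"
proof
  have *: "\<exists>p q. 0 < p \<and> 0 < q \<and> r ^ p = s ^ q"
    if rs: "base r" "base s" and x: "x \<in> \<rat>" "real r = real s powr x" for r s x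
  proof -
    have r: "real r > 1" and s: "real s > 1" using rs by (auto simp: base_def)
    have "x > 0"
    proof (rule ccontr)
      assume "\<not> x > 0"
      then have "real s powr x \<le> real s powr 0" using s by (intro powr_mono) auto
      then show False using r s x(2) by simp
    qed
    from x(1) obtain i :: int and j :: nat where j: "j \<noteq> 0" and ij: "x = of_int i / of_nat j"
      by (auto elim: Rats_cases' simp: Rats_eq_int_div_nat)
    have "i > 0" using \<open>x > 0\<close> j unfolding ij by (simp add: zero_less_divide_iff)
    have "real (r ^ j) = real r powr real j"
      using r by (simp add: powr_realpow)
    also have "\<dots> = (real s powr x) powr real j"
      by (simp only: x(2))
    also have "\<dots> = real s powr real (nat i)"
      using j \<open>i > 0\<close> by (simp add: powr_powr ij)
    also have "\<dots> = real (s ^ nat i)" using s by (simp add: powr_realpow)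
    finally have "r ^ j = s ^ nat i" by linarith
    then show ?thesis using j \<open>i > 0\<close> by (intro exI[of _ j] exI[of _ "nat i"]) auto
  qed
  assume "mult_dependent r s"
  then show "\<exists>p q. 0 < p \<and> 0 < q \<and> r ^ p = s ^ q"
    unfolding mult_dependent_def using *[OF assms] *[OF assms(2,1)] by metis
next
  assume "\<exists>p q. 0 < p \<and> 0 < q \<and> r ^ p = s ^ q"
  then obtain p q where pq: "0 < p" "0 < q" "r ^ p = s ^ q" by blast
  have r: "real r > 0" and s: "real s > 0" using assms by (auto simp: base_def)
  have "real r = (real r powr real p) powr (1 / real p)"
    using pq(1) r by (simp add: powr_powr)
  also have "real r powr real p = real s powr real q"
    using pq(3) r s by (simp add: powr_realpow flip: of_nat_power)
  finally have "real r = real s powr (real q / real p)" by (simp add: powr_powr)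
  then show "mult_dependent r s" unfolding mult_dependent_def by (auto intro: Rats_divide)
qed

definition minimal_bases :: "nat set" where
  "minimal_bases = {r. base r \<and> (\<forall>s. base s \<and> mult_dependent r s \<longrightarrow> r \<le> s)}"

text \<open>The finite sequence is a list, so its terms are numbered from 0 instead of 1. The supremum
  is that of a nonempty bounded set of reals. For the empty list the quotient is 0/0 = 0, which
  is immaterial to the limit below.\<close>

definition discrepancy :: "real list \<Rightarrow> real" where
  "discrepancy xs =
     (SUP (u, v) \<in> {(u, v). 0 \<le> u \<and> u < v \<and> v \<le> 1}.
        \<bar>real (card {n. n < length xs \<and> u \<le> xs ! n \<and> xs ! n < v}) / real (length xs) - (v - u)\<bar>)"

definition normal_to_base :: "real \<Rightarrow> nat \<Rightarrow> bool" where
  "normal_to_base \<xi> r \<longleftrightarrow>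
     (\<lambda>N. discrepancy (map (\<lambda>j. frac (real r ^ j * \<xi>)) [0..<N])) \<longlonglongrightarrow> 0"

section \<open>Arithmetic formulas\<close>

text \<open>Variables are de Bruijn indices: index 0 refers to the innermost enclosing quantifier.
  The bounding term of a bounded quantifier lies outside the scope of that quantifier.\<close>

datatype tm = TVar nat | TZero | TSuc tm | TAdd tm tm | TMul tm tm

datatype fm =
    Eq tm tm | Less tm tm
  | Neg fm | And fm fm | Or fm fm
  | BForall tm fm | BExists tm fm
  | Forall fm | Exists fm

primrec tm_val :: "(nat \<Rightarrow> nat) \<Rightarrow> tm \<Rightarrow> nat" where
  "tm_val e (TVar i) = e i"
| "tm_val e TZero = 0"
| "tm_val e (TSuc t) = Suc (tm_val e t)"
| "tm_val e (TAdd s t) = tm_val e s + tm_val e t"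
| "tm_val e (TMul s t) = tm_val e s * tm_val e t"

primrec sat :: "(nat \<Rightarrow> nat) \<Rightarrow> fm \<Rightarrow> bool" where
  "sat e (Eq s t) \<longleftrightarrow> tm_val e s = tm_val e t"
| "sat e (Less s t) \<longleftrightarrow> tm_val e s < tm_val e t"
| "sat e (Neg \<phi>) \<longleftrightarrow> \<not> sat e \<phi>"
| "sat e (And \<phi> \<psi>) \<longleftrightarrow> sat e \<phi> \<and> sat e \<psi>"
| "sat e (Or \<phi> \<psi>) \<longleftrightarrow> sat e \<phi> \<or> sat e \<psi>"
| "sat e (BForall t \<phi>) \<longleftrightarrow> (\<forall>x < tm_val e t. sat (case_nat x e) \<phi>)"
| "sat e (BExists t \<phi>) \<longleftrightarrow> (\<exists>x < tm_val e t. sat (case_nat x e) \<phi>)"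
| "sat e (Forall \<phi>) \<longleftrightarrow> (\<forall>x. sat (case_nat x e) \<phi>)"
| "sat e (Exists \<phi>) \<longleftrightarrow> (\<exists>x. sat (case_nat x e) \<phi>)"

primrec tm_vars :: "tm \<Rightarrow> nat set" where
  "tm_vars (TVar i) = {i}"
| "tm_vars TZero = {}"
| "tm_vars (TSuc t) = tm_vars t"
| "tm_vars (TAdd s t) = tm_vars s \<union> tm_vars t"
| "tm_vars (TMul s t) = tm_vars s \<union> tm_vars t"

primrec free_vars :: "fm \<Rightarrow> nat set" where
  "free_vars (Eq s t) = tm_vars s \<union> tm_vars t"
| "free_vars (Less s t) = tm_vars s \<union> tm_vars t"
| "free_vars (Neg \<phi>) = free_vars \<phi>"
| "free_vars (And \<phi> \<psi>) = free_vars \<phi> \<union> free_vars \<psi>"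
| "free_vars (Or \<phi> \<psi>) = free_vars \<phi> \<union> free_vars \<psi>"
| "free_vars (BForall t \<phi>) = tm_vars t \<union> {i. Suc i \<in> free_vars \<phi>}"
| "free_vars (BExists t \<phi>) = tm_vars t \<union> {i. Suc i \<in> free_vars \<phi>}"
| "free_vars (Forall \<phi>) = {i. Suc i \<in> free_vars \<phi>}"
| "free_vars (Exists \<phi>) = {i. Suc i \<in> free_vars \<phi>}"

primrec bounded_fm :: "fm \<Rightarrow> bool" where
  "bounded_fm (Eq s t) \<longleftrightarrow> True"
| "bounded_fm (Less s t) \<longleftrightarrow> True"
| "bounded_fm (Neg \<phi>) \<longleftrightarrow> bounded_fm \<phi>"
| "bounded_fm (And \<phi> \<psi>) \<longleftrightarrow> bounded_fm \<phi> \<and> bounded_fm \<psi>"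
| "bounded_fm (Or \<phi> \<psi>) \<longleftrightarrow> bounded_fm \<phi> \<and> bounded_fm \<psi>"
| "bounded_fm (BForall t \<phi>) \<longleftrightarrow> bounded_fm \<phi>"
| "bounded_fm (BExists t \<phi>) \<longleftrightarrow> bounded_fm \<phi>"
| "bounded_fm (Forall \<phi>) \<longleftrightarrow> False"
| "bounded_fm (Exists \<phi>) \<longleftrightarrow> False"

definition pi3_formula :: "fm \<Rightarrow> bool" where
  "pi3_formula \<phi> \<longleftrightarrow>
     free_vars \<phi> \<subseteq> {0} \<and> (\<exists>\<theta>. bounded_fm \<theta> \<and> \<phi> = Forall (Exists (Forall \<theta>)))"

text \<open>Used only for formulas with no free variable other than 0, for which the values that the
  environment gives to the other variables are irrelevant.\<close>

definition defined_set :: "fm \<Rightarrow> nat set" where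
  "defined_set \<phi> = {n. sat (\<lambda>_. n) \<phi>}"

definition pi3_set :: "nat set \<Rightarrow> bool" where
  "pi3_set R \<longleftrightarrow> (\<exists>\<phi>. pi3_formula \<phi> \<and> R = defined_set \<phi>)"

primrec tm_code :: "tm \<Rightarrow> nat" where
  "tm_code (TVar i) = prod_encode (0, i)"
| "tm_code TZero = prod_encode (1, 0)"
| "tm_code (TSuc t) = prod_encode (2, tm_code t)"
| "tm_code (TAdd s t) = prod_encode (3, prod_encode (tm_code s, tm_code t))"
| "tm_code (TMul s t) = prod_encode (4, prod_encode (tm_code s, tm_code t))"

primrec fm_code :: "fm \<Rightarrow> nat" where
  "fm_code (Eq s t) = prod_encode (0, prod_encode (tm_code s, tm_code t))"
| "fm_code (Less s t) = prod_encode (1, prod_encode (tm_code s, tm_code t))"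
| "fm_code (Neg \<phi>) = prod_encode (2, fm_code \<phi>)"
| "fm_code (And \<phi> \<psi>) = prod_encode (3, prod_encode (fm_code \<phi>, fm_code \<psi>))"
| "fm_code (Or \<phi> \<psi>) = prod_encode (4, prod_encode (fm_code \<phi>, fm_code \<psi>))"
| "fm_code (BForall t \<phi>) = prod_encode (5, prod_encode (tm_code t, fm_code \<phi>))"
| "fm_code (BExists t \<phi>) = prod_encode (6, prod_encode (tm_code t, fm_code \<phi>))"
| "fm_code (Forall \<phi>) = prod_encode (7, fm_code \<phi>)"
| "fm_code (Exists \<phi>) = prod_encode (8, fm_code \<phi>)"

lemma tm_code_inject: "tm_code s = tm_code t \<longleftrightarrow> s = t"
  by (induction s arbitrary: t; case_tac t; simp)

lemma fm_code_inject: "fm_code \<phi> = fm_code \<psi> \<longleftrightarrow> \<phi> = \<psi>"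
  by (induction \<phi> arbitrary: \<psi>; case_tac \<psi>; simp add: tm_code_inject)

section \<open>Partial recursive functions\<close>

text \<open>Programs for the partial recursive functions. Arities are not tracked: a program denotes,
  for each \<open>k\<close>, a partial recursive function of \<open>k\<close> arguments, undefined if \<open>k\<close> does not fit.
  Primitive recursion and minimisation act on the first argument.\<close>

datatype recf =
    Zero | Succ | Proj nat
  | Comp recf "recf list"
  | PrimRec recf recf
  | Mu recf

inductive evals :: "recf \<Rightarrow> nat list \<Rightarrow> nat \<Rightarrow> bool" where
  Zero: "evals Zero xs 0"
| Succ: "evals Succ [x] (Suc x)"
| Proj: "i < length xs \<Longrightarrow> evals (Proj i) xs (xs ! i)"
| Comp: "length ys = length gs \<Longrightarrow> (\<And>i. i < length gs \<Longrightarrow> evals (gs ! i) xs (ys ! i)) \<Longrightarrow>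
    evals f ys z \<Longrightarrow> evals (Comp f gs) xs z"
| PrimRec_0: "evals f xs y \<Longrightarrow> evals (PrimRec f g) (0 # xs) y"
| PrimRec_Suc: "evals (PrimRec f g) (n # xs) y \<Longrightarrow> evals g (n # y # xs) z \<Longrightarrow>
    evals (PrimRec f g) (Suc n # xs) z"
| Mu: "evals f (n # xs) 0 \<Longrightarrow> (\<And>k. k < n \<Longrightarrow> \<exists>y>0. evals f (k # xs) y) \<Longrightarrow>
    evals (Mu f) xs n"

primrec recf_code :: "recf \<Rightarrow> nat" where
  "recf_code Zero = prod_encode (0, 0)"
| "recf_code Succ = prod_encode (1, 0)"
| "recf_code (Proj i) = prod_encode (2, i)"
| "recf_code (Comp f gs) = prod_encode (3, prod_encode (recf_code f, list_encode (map recf_code gs)))"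
| "recf_code (PrimRec f g) = prod_encode (4, prod_encode (recf_code f, recf_code g))"
| "recf_code (Mu f) = prod_encode (5, recf_code f)"

inductive_cases evals_ZeroE: "evals Zero xs y"
inductive_cases evals_SuccE: "evals Succ xs y"
inductive_cases evals_ProjE: "evals (Proj i) xs y"
inductive_cases evals_CompE: "evals (Comp f gs) xs y"
inductive_cases evals_PrimRec_0E: "evals (PrimRec f g) (0 # xs) y"
inductive_cases evals_PrimRec_SucE: "evals (PrimRec f g) (Suc n # xs) y"
inductive_cases evals_MuE: "evals (Mu f) xs n"

lemma evals_deterministic: "evals p xs y \<Longrightarrow> evals p xs z \<Longrightarrow> y = z"
proof (induction p xs y arbitrary: z rule: evals.induct)
  case (Comp ys gs xs f z z')
  from Comp.prems obtain ys' where ys': "length ys' = length gs"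
    "\<And>i. i < length gs \<Longrightarrow> evals (gs ! i) xs (ys' ! i)" "evals f ys' z'"
    by (rule evals_CompE) blast
  have "ys = ys'"
    using Comp.IH(1) ys' Comp.hyps(1) by (intro nth_equalityI) auto
  then show ?case using Comp.IH(2) ys'(3) by simp
next
  case (PrimRec_Suc f g n xs y z z')
  from PrimRec_Suc.prems obtain y' where
    "evals (PrimRec f g) (n # xs) y'" "evals g (n # y' # xs) z'"
    by (rule evals_PrimRec_SucE)
  then show ?case using PrimRec_Suc.IH by blast
next
  case (Mu f n xs m)
  have m: "evals f (m # xs) 0" "\<And>k. k < m \<Longrightarrow> \<exists>y>0. evals f (k # xs) y"
    by (rule evals_MuE[OF Mu.prems], assumption)+
  show ?case
  proof (rule linorder_cases[of n m])
    assume "n < m"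
    then obtain y where "y > 0" "evals f (n # xs) y" using m(2) by blast
    then show ?thesis using Mu.IH(1)[of y] by simp
  next
    assume "m < n"
    then obtain y where "y > 0" "\<forall>z. evals f (m # xs) z \<longrightarrow> y = z" using Mu.IH(2) by blast
    then show ?thesis using m(1) by blast
  qed
next
  case (PrimRec_0 f xs y g)
  from PrimRec_0.prems show ?case
    by (rule evals_PrimRec_0E) (rule PrimRec_0.IH)
qed (auto elim!: evals_ZeroE evals_SuccE evals_ProjE)

lemma recf_code_inject: "recf_code p = recf_code q \<longleftrightarrow> p = q"
proof (induction p arbitrary: q)
  case (Comp f gs)
  have "map recf_code gs = map recf_code hs \<longleftrightarrow> gs = hs" for hs
    using Comp.IH(2) by (auto simp: list_eq_iff_nth_eq)
  then show ?case
    using Comp.IH(1) by (cases q) (simp_all add: list_encode_eq)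
qed (case_tac q; simp)+

definition total_computable :: "(nat \<Rightarrow> nat) \<Rightarrow> bool" where
  "total_computable F \<longleftrightarrow> (\<exists>p. \<forall>n. evals p [n] (F n))"

section \<open>Computable reals\<close>

definition rat_decode :: "nat \<Rightarrow> rat" where
  "rat_decode m = (case prod_decode m of (a, d) \<Rightarrow> of_int (int_decode a) / of_nat (Suc d))"

definition program_computes_real :: "recf \<Rightarrow> real \<Rightarrow> bool" where
  "program_computes_real p \<xi> \<longleftrightarrow>
     (\<forall>n. \<exists>m. evals p [n] m \<and> \<bar>\<xi> - of_rat (rat_decode m)\<bar> \<le> 1 / 2 ^ n)"

definition computable_real :: "real \<Rightarrow> bool" where
  "computable_real \<xi> \<longleftrightarrow> (\<exists>p. program_computes_real p \<xi>)"

definition index_computes_real :: "nat \<Rightarrow> real \<Rightarrow> bool" where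
  "index_computes_real e \<xi> \<longleftrightarrow> (\<exists>p. e = recf_code p \<and> program_computes_real p \<xi>)"

end

theory Submission
  imports Defs "HOL-Analysis.Analysis"
begin

text \<open>The number is the limit of nested intervals \<open>[C/Q, (C+1)/Q]\<close>. A step is admissible at level \<open>t\<close> in
  mode \<open>r\<close> if \<open>Q' \<le> Q powr (1 + 1/t)\<close>, if the base-\<open>s\<close> digits fixed by the step are equidistributed
  up to \<open>1/t\<close> for all \<open>s \<le> t\<close> in \<open>M\<close> other than \<open>r\<close>, and if \<open>r = 0\<close> or more than half of the
  base-\<open>r\<close> digits are 0. For each \<open>t\<close> and \<open>r\<close>, such steps exist for all large \<open>Q\<close>: the new interval is
  found near \<open>c + \<rho> * (\<Sum>k\<in>A. b ^ -k)\<close> with random \<open>A \<subseteq> {1..W}\<close>, where \<open>b = r\<^sup>3\<close> (or 5/2 if \<open>r = 0\<close>).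
  The Fourier transform of this random sum is a product of cosines. Its average along powers of \<open>s\<close> is
  small because \<open>log b s\<close> is irrational, and so Weyl's criterion holds for some \<open>A\<close>.

  Let \<open>stage Q = k\<close> if \<open>2 ^ k! \<le> Q < 2 ^ (k+1)!\<close>, and read \<open>k\<close> as a code of \<open>(r, x, Y, Z)\<close>. Then \<open>k\<close> is
  active if \<open>Z\<close> is the least bound up to which counterexamples \<open>z\<close> to \<open>\<theta>(r, x, y, z)\<close> exist for all
  \<open>y \<le> Y\<close>. While \<open>log\<^sub>2 Q < k! * (1 + 1/(x+1))\<close>, an active stage requests mode \<open>r\<close>. If \<open>r\<close> is in the
  defined set, each \<open>x\<close> causes finitely many requests, so the share of mode \<open>r\<close> in the digits seen so far
  tends to 0 and the limit is normal to base \<open>r\<close>. Otherwise a single \<open>x\<close> causes infinitely many requests,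
  each of which makes a fixed share of the digits biased. The construction always takes the highest level at
  which a step exists, so levels tend to infinity although no bound for "large \<open>Q\<close>" is computed.\<close>

text \<open>One choice of digits has to be generic for all bases but one. A sum of random terms
  \<open>r ^ (-3 * k)\<close> does this: it leaves two of every three base-\<open>r\<close> digits
  equal to 0, and a share near 2/3 beats the tested 3/5 as well as the normal share of at most 1/2.
  For \<open>s\<close> multiplicatively independent of \<open>r\<close>, factors of the cosine
  product at widely separated scales are nearly independent with mean at most 3/4, while
  \<open>log b (s ^ i)\<close> moves by an irrational rotation. With no base excluded,
  \<open>b\<close> must be independent of every integer, hence 5/2.

  Factorials serve both directions. A zone from \<open>k!\<close> to
  \<open>k! * (1 + 1/(x+1))\<close> of \<open>log 2 Q\<close> is a fixed share of all that precedes
  its end, yet all earlier zones together are of order \<open>(k-1)!\<close>, negligible against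
  \<open>k!\<close>.

  The size of \<open>Q\<close> beyond which steps exist depends on mode and level, and infinitely
  many modes may be requested. Granting mode \<open>r\<close> only at levels of at least
  \<open>r\<close> leaves finitely many thresholds to pass for each level.\<close>

section \<open>Cosine products along a geometric progression\<close>

text \<open>If \<open>i\<close> and \<open>i0\<close> fall into one cell,
  \<open>(i - i0) * \<alpha>\<close> is within \<open>1/q\<close> of an integer, and replacing
  \<open>\<alpha>\<close> by \<open>p/q\<close> costs less than another \<open>1/q\<close>. So
  \<open>(i - i0) * p\<close> is less than 2 away from a multiple of \<open>q\<close>, which leaves
  three residues, and \<open>p\<close> is invertible modulo \<open>q\<close>.\<close>

lemma rotation_cell_card:
  fixes p q :: int and \<alpha> \<kappa> :: real
  assumes "q > 0" "coprime p q" "\<bar>\<alpha> - p / q\<bar> < 1 / q\<^sup>2"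
  shows "card {i. i < nat q \<and> \<lfloor>q * frac (\<kappa> + real i * \<alpha>)\<rfloor> = j} \<le> 3"
proof (cases "{i. i < nat q \<and> \<lfloor>q * frac (\<kappa> + real i * \<alpha>)\<rfloor> = j} = {}")
  case False
  let ?A = "{i. i < nat q \<and> \<lfloor>q * frac (\<kappa> + real i * \<alpha>)\<rfloor> = j}"
  from False obtain i0 where i0: "i0 \<in> ?A" by blast
  let ?f = "\<lambda>i. ((int i - int i0) * p) mod q"
  have mem: "?f i \<in> {0, 1 mod q, (-1) mod q}" if i: "i \<in> ?A" for i
  proof -
    define x where "x i = frac (\<kappa> + real i * \<alpha>)" for i
    define z where "z = \<lfloor>\<kappa> + real i * \<alpha>\<rfloor> - \<lfloor>\<kappa> + real i0 * \<alpha>\<rfloor>"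
    have "\<bar>q * x i - q * x i0\<bar> < 1"
      using i i0 unfolding x_def by simp linarith
    moreover have "x i - x i0 = (real i - real i0) * \<alpha> - z"
      by (simp add: x_def z_def frac_def algebra_simps)
    ultimately have 1: "\<bar>q * ((real i - real i0) * \<alpha> - z)\<bar> < 1"
      by (metis right_diff_distrib)
    have lt: "\<bar>real i - real i0\<bar> < q" using i i0 by auto
    have "\<bar>q * ((real i - real i0) * (\<alpha> - p / q))\<bar> = \<bar>real i - real i0\<bar> * (q * \<bar>\<alpha> - p / q\<bar>)"
      using assms(1) by (simp add: abs_mult)
    also have "\<dots> \<le> \<bar>real i - real i0\<bar> * (1 / q)"
      using assms(1,3) by (intro mult_left_mono) (auto simp: field_simps power2_eq_square)
    also have "\<dots> < 1" using lt assms(1) by (simp add: field_simps)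
    finally have "\<bar>q * ((real i - real i0) * (\<alpha> - p / q))\<bar> < 1" .
    moreover have "q * ((real i - real i0) * (\<alpha> - p / q)) = q * ((real i - real i0) * \<alpha>) - (real i - real i0) * p"
      using assms(1) by (simp add: field_simps)
    ultimately have "\<bar>q * ((real i - real i0) * \<alpha>) - (real i - real i0) * p\<bar> < 1"
      by simp
    with 1 have "\<bar>(real i - real i0) * p - q * z\<bar> < 2" by (simp add: right_diff_distrib)
    then have "real_of_int \<bar>(int i - int i0) * p - q * z\<bar> < 2" by simp
    then have "\<bar>(int i - int i0) * p - q * z\<bar> < 2" by linarith
    then consider "(int i - int i0) * p = 0 + q * z" | "(int i - int i0) * p = 1 + q * z" | "(int i - int i0) * p = -1 + q * z"
      by linarith
    then show ?thesis by cases (simp_all only: mod_mult_self2, auto)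
  qed
  have inj: "inj_on ?f ?A"
  proof (rule inj_onI)
    fix i i' assume ii: "i \<in> ?A" "i' \<in> ?A" "?f i = ?f i'"
    then have "q dvd (int i - int i0) * p - (int i' - int i0) * p" by (simp add: mod_eq_dvd_iff)
    then have "q dvd (int i - int i') * p" by (simp add: algebra_simps)
    then have "q dvd (int i - int i')" using assms(2) coprime_commute coprime_dvd_mult_left_iff by blast
    moreover have "\<bar>int i - int i'\<bar> < q" using ii by auto
    ultimately have "int i - int i' = 0" using dvd_imp_le_int[of "int i - int i'" q] assms(1) by linarith
    then show "i = i'" by simp
  qed
  have "card ?A = card (?f ` ?A)" using inj by (simp add: card_image)
  also have "\<dots> \<le> card {0, 1 mod q, (-1) mod q}" by (rule card_mono) (use mem in auto)
  also have "\<dots> \<le> 3" by (simp add: card_insert_if)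
  finally show ?thesis .
next
  case True
  then show ?thesis by (simp only: card.empty)
qed

section \<open>Products of cosines with lacunary frequencies\<close>

text \<open>Integration by parts, writing \<open>cos (\<omega> * b powr v)\<close> as the derivative
  of \<open>sin (\<omega> * b powr v)\<close> divided by \<open>\<omega> * ln b * b powr v\<close>.
  As \<open>b powr (-v) \<le> 1\<close>, the boundary terms give \<open>2 / c\<close> and the
  remaining integral \<open>(\<Lambda> + ln b) / c\<close>, where
  \<open>c = \<omega> * ln b\<close>.\<close>

lemma oscillatory_integral_bound:
  fixes f f' :: "real \<Rightarrow> real"
  assumes b: "b > 1" and w: "\<omega> > 0"
    and der: "\<And>v. (f has_real_derivative f' v) (at v)"
    and bnd: "\<And>v. 0 \<le> v \<Longrightarrow> v \<le> 1 \<Longrightarrow> \<bar>f v\<bar> \<le> 1" "\<And>v. 0 \<le> v \<Longrightarrow> v \<le> 1 \<Longrightarrow> \<bar>f' v\<bar> \<le> \<Lambda>"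
  shows "\<bar>integral {0..1} (\<lambda>v. f v * cos (\<omega> * b powr v))\<bar> \<le> (2 + \<Lambda> + ln b) / (\<omega> * ln b)"
proof -
  define c where "c = \<omega> * ln b"
  have c: "c > 0" using b w by (simp add: c_def)
  define F where "F v = f v * b powr (-v) * sin (\<omega> * b powr v) / c" for v
  define h' where "h' v = (f' v - f v * ln b) * b powr (-v) / c * sin (\<omega> * b powr v)" for v
  have "(F has_real_derivative (h' v + f v * cos (\<omega> * b powr v))) (at v)" for v
  proof -
    have e: "f v * (\<omega> * ln b) * b powr (-v) * b powr v / c = f v"
      using c b w by (simp add: c_def powr_minus field_simps)
    have p1: "((\<lambda>v. b powr (-v)) has_real_derivative - (ln b * b powr (-v))) (at v)"
      using b by (auto intro!: derivative_eq_intros)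
    have p2: "((\<lambda>v. sin (\<omega> * b powr v)) has_real_derivative cos (\<omega> * b powr v) * (\<omega> * (ln b * b powr v))) (at v)"
      using b by (auto intro!: derivative_eq_intros)
    have "(F has_real_derivative ((f' v * b powr (-v) + - (ln b * b powr (-v)) * f v) * sin (\<omega> * b powr v)
        + cos (\<omega> * b powr v) * (\<omega> * (ln b * b powr v)) * (f v * b powr (-v))) / c) (at v)"
      unfolding F_def by (intro DERIV_cdivide DERIV_mult der p1 p2)
    moreover have "((f' v * b powr (-v) + - (ln b * b powr (-v)) * f v) * sin (\<omega> * b powr v)
        + cos (\<omega> * b powr v) * (\<omega> * (ln b * b powr v)) * (f v * b powr (-v))) / c
       = h' v + (f v * (\<omega> * ln b) * b powr (-v) * b powr v / c) * cos (\<omega> * b powr v)"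
      using c by (simp add: h'_def field_simps)
    ultimately show ?thesis unfolding e by simp
  qed
  then have tot: "((\<lambda>v. h' v + f v * cos (\<omega> * b powr v)) has_integral (F 1 - F 0)) {0..1}"
    by (intro fundamental_theorem_of_calculus)
       (auto intro: has_field_derivative_at_within simp flip: has_real_derivative_iff_has_vector_derivative)
  have "continuous_on {0..1} f"
    using der by (meson DERIV_continuous_on has_field_derivative_at_within)
  then have ci: "(\<lambda>v. f v * cos (\<omega> * b powr v)) integrable_on {0..1}"
    using b by (intro integrable_continuous_interval continuous_intros) auto
  have h: "(h' has_integral (F 1 - F 0 - integral {0..1} (\<lambda>v. f v * cos (\<omega> * b powr v)))) {0..1}"
    using has_integral_diff[OF tot integrable_integral[OF ci]] by simp
  have pw: "b powr (-v) \<le> 1" if "0 \<le> v" for v using b that powr_mono[of "-v" 0 b] by simp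
  have "norm (F 1 - F 0 - integral {0..1} (\<lambda>v. f v * cos (\<omega> * b powr v))) \<le> ((\<Lambda> + ln b) / c) * measure lborel {0..1::real}"
  proof (rule has_integral_bound_real[OF _ finite.emptyI h])
    have "\<bar>f' 0\<bar> \<le> \<Lambda>" using bnd by auto
    then show "0 \<le> (\<Lambda> + ln b) / c" using c b by (intro divide_nonneg_pos add_nonneg_nonneg) auto
    fix v :: real assume v: "v \<in> {0..1} - {}"
    then have v: "0 \<le> v" "v \<le> 1" by auto
    have "\<bar>h' v\<bar> = \<bar>f' v - f v * ln b\<bar> * b powr (-v) * \<bar>sin (\<omega> * b powr v)\<bar> / c"
      using c by (simp add: h'_def abs_mult)
    also have "\<dots> \<le> (\<Lambda> + ln b) * 1 * 1 / c"
    proof (intro divide_right_mono mult_mono)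
      have "\<bar>f v * ln b\<bar> \<le> 1 * ln b" using bnd(1)[OF v] b by (simp add: abs_mult mult_right_mono del: mult_1)
      then show "\<bar>f' v - f v * ln b\<bar> \<le> \<Lambda> + ln b" using bnd(2)[OF v] by linarith
    qed (use v pw c bnd(2)[OF v] b in \<open>auto intro!: mult_nonneg_nonneg add_nonneg_nonneg order_trans[OF abs_ge_zero]\<close>)
    finally show "norm (h' v) \<le> (\<Lambda> + ln b) / c" by simp
  qed
  moreover have "\<bar>F v\<bar> \<le> 1 / c" if v: "0 \<le> v" "v \<le> 1" for v
  proof -
    have "\<bar>F v\<bar> = \<bar>f v\<bar> * b powr (-v) * \<bar>sin (\<omega> * b powr v)\<bar> / c"
      using c by (simp add: F_def abs_mult)
    also have "\<dots> \<le> 1 * 1 * 1 / c"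
      using v bnd(1)[OF v] pw c by (intro divide_right_mono mult_mono) auto
    finally show ?thesis by simp
  qed
  from this[of 1] this[of 0] have "\<bar>F 1\<bar> \<le> 1 / c" "\<bar>F 0\<bar> \<le> 1 / c" by auto
  moreover have "\<bar>u\<bar> \<le> d + e + e" if "norm (x - y - u) \<le> d * measure lborel {0..1::real}" "\<bar>x\<bar> \<le> e" "\<bar>y\<bar> \<le> e" for u x y d e :: real
    using that by simp
  ultimately have "\<bar>integral {0..1} (\<lambda>v. f v * cos (\<omega> * b powr v))\<bar> \<le> (\<Lambda> + ln b) / c + 1 / c + 1 / c"
    by blast
  also have "\<dots> = (2 + \<Lambda> + ln b) / c" by (simp add: add_divide_distrib)
  finally show ?thesis by (simp add: c_def)
qed

text \<open>\<open>\<bar>cos y\<bar> \<le> (3 + cos (2 * y)) / 4\<close>, so these products bound those of cosines. \<open>v\<close> is the logarithm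
  of the argument, so that multiplication by \<open>s\<close> becomes a rotation.\<close>

definition riesz :: "real \<Rightarrow> real \<Rightarrow> nat \<Rightarrow> real \<Rightarrow> real" where
  "riesz b B D v = (\<Prod>d=1..D. (3 + cos (2 * pi * B ^ d * b powr v)) / 4)"

lemma riesz_Suc: "riesz b B (Suc D) v = riesz b B D v * ((3 + cos (2 * pi * B ^ Suc D * b powr v)) / 4)"
  by (simp add: riesz_def)

lemma riesz_factor:
  fixes x :: real
  shows "0 \<le> (3 + cos x) / 4" and "(3 + cos x) / 4 \<le> 1"
proof -
  have "-1 \<le> cos x" by simp
  then have "0 \<le> 3 + cos x" by linarith
  then show "0 \<le> (3 + cos x) / 4" by simp
  have "cos x \<le> 1" by simp
  then have "3 + cos x \<le> 4" by linarith
  then show "(3 + cos x) / 4 \<le> 1" by simp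
qed

lemma riesz_nonneg: "0 \<le> riesz b B D v"
  unfolding riesz_def by (intro prod_nonneg ballI riesz_factor)

lemma riesz_le_1: "riesz b B D v \<le> 1"
  unfolding riesz_def by (intro prod_le_1 conjI riesz_factor)

text \<open>Each factor is at most 1, so the slopes of the factors simply add up, and they grow
  geometrically in \<open>d\<close>. What matters is the comparison with the next frequency
  \<open>2 * pi * B ^ Suc D\<close>: relative to it the slope is only of order
  \<open>1 / (B - 1)\<close>.\<close>

lemma riesz_deriv:
  assumes b: "b > 1" and B: "B > 1"
  shows "\<exists>g. (\<forall>v. (riesz b B D has_real_derivative g v) (at v)) \<and>
             (\<forall>v. 0 \<le> v \<longrightarrow> v \<le> 1 \<longrightarrow> \<bar>g v\<bar> \<le> 2 * pi * b * ln b * (B ^ Suc D / (B - 1)))"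
proof (induction D)
  case 0
  have "riesz b B 0 = (\<lambda>v. 1)" by (simp add: riesz_def fun_eq_iff)
  then show ?case using b B by (intro exI[of _ "\<lambda>_. 0"]) auto
next
  case (Suc D)
  then obtain g where g: "\<And>v. (riesz b B D has_real_derivative g v) (at v)"
    "\<And>v. 0 \<le> v \<Longrightarrow> v \<le> 1 \<Longrightarrow> \<bar>g v\<bar> \<le> 2 * pi * b * ln b * (B ^ Suc D / (B - 1))" by blast
  define w where "w = 2 * pi * B ^ Suc D"
  have w: "w > 0" using B by (simp add: w_def)
  define h where "h v = g v * ((3 + cos (w * b powr v)) / 4) + (- sin (w * b powr v) * (w * (ln b * b powr v)) / 4) * riesz b B D v" for v
  have "(riesz b B (Suc D) has_real_derivative h v) (at v)" for v
  proof -
    have p2: "((\<lambda>v. (3 + cos (w * b powr v)) / 4) has_real_derivative - sin (w * b powr v) * (w * (ln b * b powr v)) / 4) (at v)"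
      using b by (auto intro!: derivative_eq_intros)
    have e: "riesz b B (Suc D) = (\<lambda>v. riesz b B D v * ((3 + cos (w * b powr v)) / 4))"
      unfolding w_def by (rule ext) (rule riesz_Suc)
    show ?thesis unfolding e h_def by (intro DERIV_mult g p2)
  qed
  moreover have "\<bar>h v\<bar> \<le> 2 * pi * b * ln b * (B ^ Suc (Suc D) / (B - 1))" if v: "0 \<le> v" "v \<le> 1" for v
  proof -
    have "b powr v \<le> b powr 1" using v b by (intro powr_mono) auto
    then have bv: "b powr v \<le> b" using b by simp
    have "\<bar>g v * ((3 + cos (w * b powr v)) / 4)\<bar> = \<bar>g v\<bar> * ((3 + cos (w * b powr v)) / 4)"
      using riesz_factor[of "w * b powr v"] by (simp add: abs_mult)
    also have "\<dots> \<le> \<bar>g v\<bar> * 1" by (intro mult_left_mono riesz_factor) auto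
    finally have 1: "\<bar>g v * ((3 + cos (w * b powr v)) / 4)\<bar> \<le> 2 * pi * b * ln b * (B ^ Suc D / (B - 1))"
      using g(2)[OF v] by simp
    have "\<bar>(- sin (w * b powr v) * (w * (ln b * b powr v)) / 4) * riesz b B D v\<bar>
        = \<bar>sin (w * b powr v)\<bar> * (w * (ln b * b powr v)) / 4 * riesz b B D v"
      using w b riesz_nonneg[of b B D v] by (simp add: abs_mult)
    also have "\<dots> \<le> 1 * (w * (ln b * b)) / 1 * 1"
      using w b bv riesz_nonneg riesz_le_1 by (intro mult_mono frac_le mult_nonneg_nonneg) auto
    finally have 2: "\<bar>(- sin (w * b powr v) * (w * (ln b * b powr v)) / 4) * riesz b B D v\<bar> \<le> 2 * pi * b * ln b * B ^ Suc D"
      by (simp add: w_def mult_ac)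
    have "\<bar>h v\<bar> \<le> 2 * pi * b * ln b * (B ^ Suc D / (B - 1)) + 2 * pi * b * ln b * B ^ Suc D"
      unfolding h_def by (rule order_trans[OF abs_triangle_ineq add_mono[OF 1 2]])
    also have "\<dots> = 2 * pi * b * ln b * (B ^ Suc D / (B - 1) + B ^ Suc D)"
      by (simp only: distrib_left)
    also have "B ^ Suc D / (B - 1) + B ^ Suc D = B ^ Suc (Suc D) / (B - 1)"
      using B by (simp add: field_simps)
    finally show ?thesis .
  qed
  ultimately show ?case by blast
qed

lemma riesz_continuous: "b > 1 \<Longrightarrow> B > 1 \<Longrightarrow> continuous_on S (riesz b B D)"
  using riesz_deriv[of b B D] by (meson DERIV_continuous_on has_field_derivative_at_within)

text \<open>Up to an error of order \<open>1 / (B - 1)\<close> the next cosine is orthogonal to the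
  product so far, so each factor multiplies the integral by about 3/4. The error obeys
  \<open>e' = 3/4 * e + 1/4 * K / (B - 1)\<close>, whose fixed point \<open>K / (B - 1)\<close> does
  not grow with \<open>D\<close>.\<close>

lemma riesz_integral:
  assumes b: "b > 1" and B: "B > 1"
  shows "integral {0..1} (riesz b B D) \<le> (3/4) ^ D + ((2 + ln b) / (2 * pi * ln b) + b) / (B - 1)"
proof (induction D)
  case 0
  have "riesz b B 0 = (\<lambda>v. 1)" by (simp add: riesz_def fun_eq_iff)
  then show ?case using b B by simp
next
  case (Suc D)
  define K where "K = (2 + ln b) / (2 * pi * ln b) + b"
  define w where "w = 2 * pi * B ^ Suc D"
  have w: "w > 0" using B by (simp add: w_def)
  have lb: "ln b > 0" using b by simp
  have K: "K > 0" unfolding K_def using lb b by (intro add_pos_pos divide_pos_pos) auto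
  obtain g where g: "\<And>v. (riesz b B D has_real_derivative g v) (at v)"
    "\<And>v. 0 \<le> v \<Longrightarrow> v \<le> 1 \<Longrightarrow> \<bar>g v\<bar> \<le> 2 * pi * b * ln b * (B ^ Suc D / (B - 1))"
    using riesz_deriv[OF b B, of D] by blast
  have "\<bar>riesz b B D v\<bar> \<le> 1" for v using riesz_le_1[of b B D v] riesz_nonneg[of b B D v] by simp
  from oscillatory_integral_bound[OF b w g(1) this g(2)]
  have "\<bar>integral {0..1} (\<lambda>v. riesz b B D v * cos (w * b powr v))\<bar>
      \<le> (2 + 2 * pi * b * ln b * (B ^ Suc D / (B - 1)) + ln b) / (w * ln b)" by simp
  also have "\<dots> = (2 + ln b) / (2 * pi * ln b) * (1 / B ^ Suc D) + (2 * pi * b * ln b * (B ^ Suc D / (B - 1))) / (2 * pi * B ^ Suc D * ln b)"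
    using B lb by (simp add: w_def field_simps)
  also have "(2 * pi * b * ln b * (B ^ Suc D / (B - 1))) / (2 * pi * B ^ Suc D * ln b) = b / (B - 1)"
    using B lb by (simp add: field_simps)
  also have "(2 + ln b) / (2 * pi * ln b) * (1 / B ^ Suc D) \<le> (2 + ln b) / (2 * pi * ln b) * (1 / (B - 1))"
  proof (intro mult_left_mono divide_left_mono)
    have "B ^ 1 \<le> B ^ Suc D" using B by (intro power_increasing) auto
    then show "B - 1 \<le> B ^ Suc D" by simp
  qed (use B lb in auto)
  also have "(2 + ln b) / (2 * pi * ln b) * (1 / (B - 1)) + b / (B - 1) = K / (B - 1)"
    by (simp add: K_def add_divide_distrib)
  finally have I: "\<bar>integral {0..1} (\<lambda>v. riesz b B D v * cos (w * b powr v))\<bar> \<le> K / (B - 1)" by simp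
  have e: "riesz b B (Suc D) = (\<lambda>v. 3/4 * riesz b B D v + 1/4 * (riesz b B D v * cos (w * b powr v)))"
    unfolding riesz_Suc fun_eq_iff w_def by (simp add: algebra_simps)
  have i1: "riesz b B D integrable_on {0..1}"
    by (intro integrable_continuous_interval riesz_continuous b B)
  have i2: "(\<lambda>v. riesz b B D v * cos (w * b powr v)) integrable_on {0..1}"
    using b by (intro integrable_continuous_interval continuous_intros riesz_continuous B) auto
  have "integral {0..1} (riesz b B (Suc D)) = 3/4 * integral {0..1} (riesz b B D) + 1/4 * integral {0..1} (\<lambda>v. riesz b B D v * cos (w * b powr v))"
    unfolding e using i1 i2 by (subst integral_add) (auto intro: integrable_on_cmult_left)
  also have "\<dots> \<le> 3/4 * ((3/4)^D + K / (B - 1)) + 1/4 * (K / (B - 1))"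
    using Suc I unfolding K_def[symmetric] by (intro add_mono mult_left_mono) auto
  also have "\<dots> = (3/4) ^ Suc D + K / (B - 1)"
  proof -
    have "3/4 * (x + z) + 1/4 * z = 3/4 * x + z" for x z :: real by (simp add: field_simps)
    from this[of "(3/4) ^ D" "K / (B - 1)"] show ?thesis by (simp only: power_Suc)
  qed
  finally show ?case unfolding K_def[symmetric] .
qed

text \<open>A Riemann sum over \<open>q\<close> cells: \<open>riesz\<close> exceeds its mean on a
  cell by at most \<open>\<Lambda> / q\<close>, and no cell receives more than three of the
  \<open>q\<close> orbit points. The factor 3 is harmless because the integral can be made as small
  as desired.\<close>

lemma riesz_rotation_sum:
  fixes p q :: int
  assumes b: "b > 1" and B: "B > 1" and q: "q > 0" "coprime p q" "\<bar>\<alpha> - p / q\<bar> < 1 / q\<^sup>2"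
  shows "(\<Sum>i<nat q. riesz b B D (frac (\<kappa> + real i * \<alpha>)))
    \<le> 3 * q * integral {0..1} (riesz b B D) + 2 * pi * b * ln b * (B ^ Suc D / (B - 1))"
proof -
  define \<Lambda> where "\<Lambda> = 2 * pi * b * ln b * (B ^ Suc D / (B - 1))"
  let ?G = "riesz b B D"
  let ?n = "nat q"
  define x where "x i = frac (\<kappa> + real i * \<alpha>)" for i
  define cell where "cell j = {real j / q..real (Suc j) / q}" for j
  obtain g where g: "\<And>v. (?G has_real_derivative g v) (at v)"
    "\<And>v. 0 \<le> v \<Longrightarrow> v \<le> 1 \<Longrightarrow> \<bar>g v\<bar> \<le> \<Lambda>"
    using riesz_deriv[OF b B, of D] unfolding \<Lambda>_def by blast
  have lip: "?G u \<le> ?G v + \<Lambda> * \<bar>u - v\<bar>" if uv: "0 \<le> u" "u \<le> 1" "0 \<le> v" "v \<le> 1" for u v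
  proof -
    have "norm (?G u - ?G v) \<le> \<Lambda> * norm (u - v)"
      by (rule field_differentiable_bound[of "{0..1}" ?G g]) (use g uv in \<open>auto intro: has_field_derivative_at_within\<close>)
    then show ?thesis by simp
  qed
  have int: "?G integrable_on cell j" for j
    unfolding cell_def by (intro integrable_continuous_interval riesz_continuous b B)
  have cellI: "?G u \<le> q * integral (cell j) ?G + \<Lambda> / q" if j: "j < ?n" and u: "u \<in> cell j" for u j
  proof -
    have j1: "real (Suc j) \<le> q" using j q(1) by linarith
    have "\<Lambda> \<ge> 0" using g(2)[of 0] by auto
    have sub: "0 \<le> v \<and> v \<le> 1 \<and> \<bar>u - v\<bar> \<le> 1 / q" if "v \<in> cell j" for v
    proof -
      have "v \<le> real (Suc j) / q" "real j / q \<le> v" "u \<le> real (Suc j) / q" "real j / q \<le> u"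
        using that u by (auto simp: cell_def)
      moreover have "real (Suc j) / q \<le> 1" using j1 q(1) by simp
      moreover have "0 \<le> real j / q" using q(1) by simp
      moreover have "real (Suc j) / q = real j / q + 1 / q" by (simp add: add_divide_distrib)
      ultimately show ?thesis by linarith
    qed
    have "integral (cell j) (\<lambda>_. ?G u - \<Lambda> / q) \<le> integral (cell j) ?G"
    proof (rule integral_le[OF _ int])
      show "(\<lambda>_. ?G u - \<Lambda> / q) integrable_on cell j" unfolding cell_def by (rule integrable_const_ivl)
      fix v assume v: "v \<in> cell j"
      have "?G u \<le> ?G v + \<Lambda> * \<bar>u - v\<bar>" using sub[OF v] sub[OF u] by (intro lip) auto
      also have "\<Lambda> * \<bar>u - v\<bar> \<le> \<Lambda> * (1 / q)" using sub[OF v] \<open>\<Lambda> \<ge> 0\<close> by (intro mult_left_mono) auto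
      finally show "?G u - \<Lambda> / q \<le> ?G v" by simp
    qed
    moreover have "integral (cell j) (\<lambda>_. ?G u - \<Lambda> / q) = (?G u - \<Lambda> / q) / q"
      using q(1) by (simp add: cell_def divide_right_mono add_divide_distrib)
    ultimately have "(?G u - \<Lambda> / q) / q \<le> integral (cell j) ?G" by simp
    then have "?G u - \<Lambda> / q \<le> integral (cell j) ?G * q" using q(1) by (subst (asm) pos_divide_le_eq) auto
    then show ?thesis by (simp add: mult.commute)
  qed
  define f where "f i = nat \<lfloor>q * x i\<rfloor>" for i
  have fx: "f i < ?n" "x i \<in> cell (f i)" for i
  proof -
    have x: "0 \<le> x i" "x i < 1" by (auto simp: x_def frac_lt_1)
    have 1: "0 \<le> q * x i" "q * x i < q" using x q(1) by auto
    then show "f i < ?n" unfolding f_def using q(1) by (simp add: nat_less_eq_zless floor_less_iff)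
    have "real (f i) = \<lfloor>q * x i\<rfloor>" unfolding f_def using 1 by simp
    then have "real (f i) \<le> q * x i" "q * x i \<le> real (f i) + 1" by linarith+
    then show "x i \<in> cell (f i)" using q(1) by (simp add: cell_def field_simps)
  qed
  have card3: "card {i. i < ?n \<and> f i = j} \<le> 3" for j
  proof -
    have "{i. i < ?n \<and> f i = j} \<subseteq> {i. i < ?n \<and> \<lfloor>q * frac (\<kappa> + real i * \<alpha>)\<rfloor> = int j}"
      using q(1) by (auto simp: f_def x_def)
    then have "card {i. i < ?n \<and> f i = j} \<le> card {i. i < ?n \<and> \<lfloor>q * frac (\<kappa> + real i * \<alpha>)\<rfloor> = int j}"
      by (intro card_mono) auto
    also have "\<dots> \<le> 3" by (rule rotation_cell_card[OF q])
    finally show ?thesis .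
  qed
  have tot: "(\<Sum>j<m. integral (cell j) ?G) = integral {0..real m / q} ?G" for m
  proof (induction m)
    case (Suc m)
    have "integral {0..real m / q} ?G + integral {real m / q..real (Suc m) / q} ?G = integral {0..real (Suc m) / q} ?G"
      using q(1) by (intro Henstock_Kurzweil_Integration.integral_combine integrable_continuous_interval riesz_continuous b B) (auto simp: divide_right_mono)
    then show ?case using Suc by (simp add: cell_def)
  qed simp
  have "(\<Sum>i<?n. ?G (x i)) \<le> (\<Sum>i<?n. q * integral (cell (f i)) ?G + \<Lambda> / q)"
    by (intro sum_mono cellI fx)
  also have "\<dots> = (\<Sum>i<?n. q * integral (cell (f i)) ?G) + \<Lambda>"
    using q(1) by (simp add: sum.distrib)
  also have "(\<Sum>i<?n. q * integral (cell (f i)) ?G) = (\<Sum>j<?n. \<Sum>i\<in>{i\<in>{..<?n}. f i = j}. q * integral (cell (f i)) ?G)"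
    by (rule sum.group[symmetric]) (use fx in auto)
  also have "\<dots> = (\<Sum>j<?n. card {i. i < ?n \<and> f i = j} * (q * integral (cell j) ?G))"
    by (intro sum.cong) auto
  also have "\<dots> \<le> (\<Sum>j<?n. 3 * (q * integral (cell j) ?G))"
  proof (intro sum_mono mult_right_mono)
    show "0 \<le> q * integral (cell j) ?G" for j
      using q(1) by (intro mult_nonneg_nonneg integral_nonneg int riesz_nonneg) auto
    show "real (card {i. i < ?n \<and> f i = j}) \<le> 3" for j using card3[of j] by simp
  qed
  also have "\<dots> = 3 * q * (\<Sum>j<?n. integral (cell j) ?G)" by (simp add: sum_distrib_left mult_ac)
  also have "\<dots> = 3 * q * integral {0..1} ?G" unfolding tot using q(1) by simp
  finally show ?thesis unfolding x_def \<Lambda>_def by simp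
qed

lemma abs_cos_le: "\<bar>cos y\<bar> \<le> (3 + cos (2 * y)) / 4" for y :: real
proof -
  have "0 \<le> (1 - \<bar>cos y\<bar>)\<^sup>2" by simp
  then have "2 * \<bar>cos y\<bar> \<le> 1 + (cos y)\<^sup>2" by (simp add: power2_diff)
  then show ?thesis by (simp add: cos_double_cos)
qed

text \<open>With \<open>u = log b (\<theta> * s ^ i)\<close>, keep only the \<open>D\<close> factors
  \<open>k = \<lfloor>u\<rfloor> - d * L\<close>. Their angles are
  \<open>pi * B ^ d * b powr frac u\<close> with \<open>B = b ^ L\<close>, so their product is
  bounded by a function of \<open>u\<close> modulo 1, and \<open>u\<close> advances by
  \<open>log b s\<close>. \<open>K\<close> covers the first \<open>i\<close>, for which
  \<open>D\<close> such scales need not exist, and one incomplete block of length \<open>q\<close>.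
  It is uniform in \<open>\<theta>\<close>, as the differences of powers of \<open>s\<close> will
  require.\<close>

lemma cos_product_average:
  fixes b s \<epsilon> \<kappa> :: real
  assumes b: "b > 1" and s: "s > 1" and irr: "log b s \<notin> \<rat>" and \<epsilon>: "\<epsilon> > 0" and \<kappa>: "\<kappa> > 0"
  shows "\<exists>K\<ge>0. \<forall>n W \<theta>. \<kappa> \<le> \<theta> \<and> \<theta> * s ^ n \<le> b ^ W \<longrightarrow>
           (\<Sum>i<n. \<Prod>k=1..W. \<bar>cos (pi * (\<theta> * s ^ i / b ^ k))\<bar>) \<le> \<epsilon> * real n + K"
proof -
  define \<alpha> where "\<alpha> = log b s"
  have \<alpha>: "\<alpha> > 0" using b s by (simp add: \<alpha>_def)
  have lb: "ln b > 0" using b by simp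
  \<comment> \<open>The error in \<open>riesz_integral\<close> does not depend on \<open>D\<close>.
    So \<open>D\<close> comes first, then \<open>L\<close> with \<open>B = b ^ L\<close> large, and
    only then \<open>q\<close>, which has to beat the slope \<open>\<Lambda>\<close> determined by
    \<open>D\<close> and \<open>B\<close>.\<close>
  obtain D where D: "(3/4::real) ^ D < \<epsilon> / 12"
    using real_arch_pow_inv[of "\<epsilon> / 12" "3/4"] \<epsilon> by auto
  define C where "C = (2 + ln b) / (2 * pi * ln b) + b"
  have C: "C > 0" unfolding C_def using lb b by (intro add_pos_pos divide_pos_pos) auto
  obtain L where L: "b ^ L > 12 * C / \<epsilon> + b"
    using real_arch_pow[OF b] by blast
  define B where "B = b ^ L"
  have Bb: "B > b" using L C \<epsilon> unfolding B_def by (smt (verit) divide_pos_pos)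
  have B: "B > 1" using Bb b by simp
  have L1: "L \<ge> 1" using Bb b unfolding B_def by (cases L) auto
  have CB: "C / (B - 1) \<le> \<epsilon> / 12"
  proof -
    have "12 * C / \<epsilon> < B - 1" using L b unfolding B_def by simp
    then have "12 * C < \<epsilon> * (B - 1)" using \<epsilon> by (simp add: divide_less_eq mult.commute)
    then show ?thesis using B by (simp add: divide_le_eq)
  qed
  have I: "integral {0..1} (riesz b B D) \<le> \<epsilon> / 6"
    using riesz_integral[OF b B, of D] D CB unfolding C_def[symmetric] by linarith
  define \<Lambda> where "\<Lambda> = 2 * pi * b * ln b * (B ^ Suc D / (B - 1))"
  have "infinite (approx_set \<alpha>)"
    using irr rational_iff_finite_approx_set unfolding \<alpha>_def by blast
  then obtain p q where pq: "(p, q) \<in> approx_set \<alpha>" "q > max 1 \<lceil>2 * \<Lambda> / \<epsilon>\<rceil>"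
    using infinite_approx_set by blast
  then have q: "q > 0" "coprime p q" "\<bar>\<alpha> - p / q\<bar> < 1 / q\<^sup>2"
    by (auto simp: approx_set_def)
  have "2 * \<Lambda> / \<epsilon> \<le> q" using pq(2) by linarith
  then have Lq: "\<Lambda> \<le> \<epsilon> / 2 * q" using \<epsilon> by (simp add: field_simps)
  define r where "r \<kappa>' i = riesz b B D (frac (\<kappa>' + real i * \<alpha>))" for \<kappa>' and i :: nat
  have block: "(\<Sum>i<nat q. r \<kappa>' i) \<le> \<epsilon> * q" for \<kappa>'
  proof -
    have "(\<Sum>i<nat q. r \<kappa>' i) \<le> 3 * q * integral {0..1} (riesz b B D) + \<Lambda>"
      unfolding r_def \<Lambda>_def by (rule riesz_rotation_sum[OF b B q])
    also have "\<dots> \<le> 3 * q * (\<epsilon> / 6) + \<epsilon> / 2 * q"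
      using q(1) I Lq by (intro add_mono mult_left_mono) auto
    finally show ?thesis by simp
  qed
  have long: "(\<Sum>i<n. r \<kappa>' i) \<le> \<epsilon> * real n + q" for n \<kappa>'
  proof (induction n arbitrary: \<kappa>' rule: less_induct)
    case (less n)
    show ?case
    proof (cases "n < nat q")
      case True
      have "(\<Sum>i<n. r \<kappa>' i) \<le> (\<Sum>i<n. 1)" unfolding r_def by (intro sum_mono riesz_le_1)
      also have "\<dots> \<le> q" using True by simp
      also have "\<dots> \<le> \<epsilon> * real n + q" using \<epsilon> by simp
      finally show ?thesis .
    next
      case False
      define m where "m = n - nat q"
      have nm: "n = nat q + m" "m < n" using False q(1) by (auto simp: m_def)
      have "(\<Sum>i<n. r \<kappa>' i) = (\<Sum>i<nat q. r \<kappa>' i) + (\<Sum>i<m. r \<kappa>' (nat q + i))"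
        unfolding nm(1) by (induction m) auto
      also have "(\<Sum>i<m. r \<kappa>' (nat q + i)) = (\<Sum>i<m. r (\<kappa>' + nat q * \<alpha>) i)"
        unfolding r_def by (simp add: algebra_simps)
      also have "(\<Sum>i<nat q. r \<kappa>' i) + (\<Sum>i<m. r (\<kappa>' + nat q * \<alpha>) i) \<le> \<epsilon> * q + (\<epsilon> * real m + q)"
        by (intro add_mono block less nm)
      also have "\<dots> = \<epsilon> * real n + q" unfolding nm(1) using q(1) by (simp add: algebra_simps)
      finally show ?thesis .
    qed
  qed
  \<comment> \<open>From \<open>i0\<close> on,
    \<open>log b (\<theta> * s ^ i) \<ge> D * L + 1\<close>, because
    \<open>log b \<theta> \<ge> log b \<kappa>\<close>.\<close>
  define i0 where "i0 = nat \<lceil>(real (D * L) + 1 - log b \<kappa>) / \<alpha>\<rceil>"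
  have "(\<Sum>i<n. \<Prod>k=1..W. \<bar>cos (pi * (\<theta> * s ^ i / b ^ k))\<bar>) \<le> \<epsilon> * real n + (real i0 + q)"
    if \<theta>: "\<kappa> \<le> \<theta>" "\<theta> * s ^ n \<le> b ^ W" for n W \<theta>
  proof -
    have \<theta>0: "\<theta> > 0" using \<kappa> \<theta> by simp
    have pt: "(\<Prod>k=1..W. \<bar>cos (pi * (\<theta> * s ^ i / b ^ k))\<bar>) \<le> (if i < i0 then 1 else 0) + r (log b \<theta>) i" if i: "i < n" for i
    proof (cases "i < i0")
      case True
      have "(\<Prod>k=1..W. \<bar>cos (pi * (\<theta> * s ^ i / b ^ k))\<bar>) \<le> 1"
        by (intro prod_le_1) auto
      then show ?thesis using True riesz_nonneg[of b B D] by (simp add: r_def add_increasing2)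
    next
      case False
      define u where "u = log b \<theta> + real i * \<alpha>"
      have bu: "b powr u = \<theta> * s ^ i"
        using b s \<theta>0 by (simp add: u_def \<alpha>_def powr_add log_powr_cancel log_nat_power[symmetric])
      have "(real (D * L) + 1 - log b \<kappa>) / \<alpha> \<le> i"
        using False unfolding i0_def by linarith
      then have "real (D * L) + 1 - log b \<kappa> \<le> real i * \<alpha>"
        using \<alpha> by (simp add: divide_le_eq)
      moreover have "log b \<kappa> \<le> log b \<theta>" using \<theta> \<kappa> b by simp
      ultimately have u: "real (D * L) + 1 \<le> u" by (simp add: u_def)
      define k0 where "k0 = nat \<lfloor>u\<rfloor>"
      have "0 \<le> u" using u of_nat_0_le_iff[of "D * L", where 'a = real] by linarith
      then have k0: "real k0 = \<lfloor>u\<rfloor>" unfolding k0_def by simp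
      have k0D: "k0 \<ge> D * L + 1" using u unfolding k0_def by linarith
      have k0W: "k0 \<le> W"
      proof -
        have "b powr u \<le> \<theta> * s ^ n" unfolding bu using \<theta>0 s i by (intro mult_left_mono power_increasing) auto
        also have "\<dots> \<le> b powr real W" using \<theta>(2) b by (simp add: powr_realpow)
        finally have "u \<le> real W" using b by simp
        then show ?thesis unfolding k0_def by linarith
      qed
      let ?f = "\<lambda>d. k0 - d * L"
      have DL: "d * L \<le> D * L" if "d \<in> {1..D}" for d using that by (intro mult_right_mono) auto
      have img: "?f ` {1..D} \<subseteq> {1..W}" 
      proof (rule image_subsetI)
        fix d assume "d \<in> {1..D}"
        then have "d * L \<le> D * L" by (rule DL)
        then have "1 \<le> k0 - d * L" "k0 - d * L \<le> W" using k0D k0W by linarith+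
        then show "k0 - d * L \<in> {1..W}" by simp
      qed
      have inj: "inj_on ?f {1..D}"
      proof (rule inj_onI)
        fix d d' assume dd: "d \<in> {1..D}" "d' \<in> {1..D}" "?f d = ?f d'"
        then have "d * L = d' * L" using DL[of d] DL[of d'] k0D by linarith
        then show "d = d'" using L1 by simp
      qed
      have "(\<Prod>k=1..W. \<bar>cos (pi * (\<theta> * s ^ i / b ^ k))\<bar>)
          = (\<Prod>k\<in>{1..W} - ?f ` {1..D}. \<bar>cos (pi * (\<theta> * s ^ i / b ^ k))\<bar>) * (\<Prod>k\<in>?f ` {1..D}. \<bar>cos (pi * (\<theta> * s ^ i / b ^ k))\<bar>)"
        by (rule prod.subset_diff[OF img]) simp
      also have "\<dots> \<le> 1 * (\<Prod>k\<in>?f ` {1..D}. \<bar>cos (pi * (\<theta> * s ^ i / b ^ k))\<bar>)"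
        by (intro mult_right_mono prod_le_1 prod_nonneg) auto
      also have "\<dots> = (\<Prod>d=1..D. \<bar>cos (pi * (\<theta> * s ^ i / b ^ (k0 - d * L)))\<bar>)"
        by (subst prod.reindex[OF inj]) (simp add: comp_def)
      also have "\<dots> \<le> (\<Prod>d=1..D. (3 + cos (2 * pi * B ^ d * b powr frac u)) / 4)"
      proof (intro prod_mono conjI)
        fix d assume d: "d \<in> {1..D}"
        have Bd: "B ^ d = b ^ (d * L)" unfolding B_def by (simp add: mult.commute flip: power_mult)
        have "frac u = u - real k0" using k0 by (simp add: frac_def)
        then have "b powr frac u = b powr u / b ^ k0" using b by (simp add: powr_diff powr_realpow)
        then have "B ^ d * b powr frac u = b ^ (d * L) * (b powr u / b ^ k0)" by (simp add: Bd)
        moreover have "b ^ k0 = b ^ (k0 - d * L) * b ^ (d * L)"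
        proof -
          have "k0 - d * L + d * L = k0" using DL[OF d] k0D by linarith
          then show ?thesis by (metis power_add)
        qed
        ultimately have "B ^ d * b powr frac u = \<theta> * s ^ i / b ^ (k0 - d * L)"
          using b unfolding bu by simp
        then have e: "2 * pi * B ^ d * b powr frac u = 2 * (pi * (\<theta> * s ^ i / b ^ (k0 - d * L)))" by (simp only: mult.assoc)
        show "\<bar>cos (pi * (\<theta> * s ^ i / b ^ (k0 - d * L)))\<bar> \<le> (3 + cos (2 * pi * B ^ d * b powr frac u)) / 4"
          unfolding e by (rule abs_cos_le)
      qed simp
      finally show ?thesis using False unfolding r_def riesz_def u_def by simp
    qed
    have "(\<Sum>i<n. \<Prod>k=1..W. \<bar>cos (pi * (\<theta> * s ^ i / b ^ k))\<bar>) \<le> (\<Sum>i<n. (if i < i0 then 1 else 0) + r (log b \<theta>) i)"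
      by (intro sum_mono pt) auto
    also have "\<dots> = (\<Sum>i<n. if i < i0 then 1 else 0) + (\<Sum>i<n. r (log b \<theta>) i)" by (simp add: sum.distrib)
    also have "(\<Sum>i<n. if i < i0 then 1 else 0 :: real) = real (card ({..<n} \<inter> {i. i < i0}))"
      by (simp add: sum.If_cases)
    also have "card ({..<n} \<inter> {i. i < i0}) \<le> card {..<i0}" by (intro card_mono) auto
    also have "real (card {..<i0}) + (\<Sum>i<n. r (log b \<theta>) i) \<le> real i0 + (\<epsilon> * real n + q)"
      using long by simp
    finally show ?thesis by simp
  qed
  then show ?thesis using q(1) by (intro exI[of _ "real i0 + q"]) auto
qed

section \<open>Exponential sums of random digit sums\<close>

definition digit_sum :: "real \<Rightarrow> nat set \<Rightarrow> real" where
  "digit_sum b A = (\<Sum>k\<in>A. 1 / b ^ k)"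

lemma one_plus_cis: "1 + cis (2 * y) = 2 * of_real (cos y) * cis y"
proof (rule complex_eqI)
  show "Re (1 + cis (2 * y)) = Re (2 * of_real (cos y) * cis y)"
    by (simp add: cos_double_cos power2_eq_square)
  show "Im (1 + cis (2 * y)) = Im (2 * of_real (cos y) * cis y)"
    by (simp add: sin_double)
qed

text \<open>For independent fair bits this is \<open>2 ^ W\<close> times a characteristic function,
  which factorises over the bits; \<open>1 + cis (2 * y)\<close> has norm
  \<open>2 * \<bar>cos y\<bar>\<close>.\<close>

lemma sum_cis_digit_sum:
  "norm (\<Sum>A\<in>Pow {1..W}. cis (2 * pi * (\<theta> * digit_sum b A))) = 2 ^ W * (\<Prod>k=1..W. \<bar>cos (pi * (\<theta> / b ^ k))\<bar>)"
proof -
  have c: "cis (2 * pi * (\<theta> * digit_sum b A)) = (\<Prod>k\<in>A. cis (2 * (pi * (\<theta> / b ^ k)))) * (\<Prod>k\<in>{1..W} - A. 1)"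
    if "A \<in> Pow {1..W}" for A
  proof -
    have "finite A" using that finite_subset by auto
    then have "cis (2 * pi * (\<theta> * digit_sum b A)) = (\<Prod>k\<in>A. cis (2 * (pi * (\<theta> / b ^ k))))"
    proof (induction A rule: finite_induct)
      case (insert x F)
      then have "digit_sum b (insert x F) = 1 / b ^ x + digit_sum b F" by (simp add: digit_sum_def)
      then have "cis (2 * pi * (\<theta> * digit_sum b (insert x F))) = cis (2 * (pi * (\<theta> / b ^ x)) + 2 * pi * (\<theta> * digit_sum b F))"
        by (simp add: algebra_simps)
      then show ?case using insert by (simp add: cis_mult[symmetric])
    qed (simp add: digit_sum_def)
    then show ?thesis by simp
  qed
  have "(\<Sum>A\<in>Pow {1..W}. cis (2 * pi * (\<theta> * digit_sum b A))) = (\<Prod>k=1..W. cis (2 * (pi * (\<theta> / b ^ k))) + 1)"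
    by (subst prod_add) (auto intro!: sum.cong simp del: prod.neutral_const simp: c)
  also have "norm \<dots> = (\<Prod>k=1..W. 2 * \<bar>cos (pi * (\<theta> / b ^ k))\<bar>)"
    unfolding prod_norm[symmetric] by (subst add.commute, subst one_plus_cis) (simp add: norm_mult)
  finally show ?thesis by (simp add: prod.distrib)
qed

text \<open>For a fixed difference \<open>d\<close> the frequencies \<open>\<mu> * s ^ (i + d) -
  \<mu> * s ^ i = \<mu> * (s ^ d - 1) * s ^ i\<close> again form a progression with ratio
  \<open>s\<close>, to which \<open>cos_product_average\<close> applies. This is why pairs are
  sorted by difference.\<close>

lemma double_sum_by_difference:
  fixes f :: "nat \<Rightarrow> nat \<Rightarrow> real"
  assumes "\<And>i j. f i j = f j i"
  shows "(\<Sum>i<N. \<Sum>j<N. f i j) = (\<Sum>i<N. f i i) + 2 * (\<Sum>d\<in>{1..<N}. \<Sum>i<N - d. f (i + d) i)"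
proof (induction N)
  case (Suc N)
  have "(\<Sum>i<Suc N. \<Sum>j<Suc N. f i j) = (\<Sum>i<N. \<Sum>j<N. f i j) + (\<Sum>i<N. f i N) + (\<Sum>j<N. f N j) + f N N"
    by (simp add: sum.distrib)
  also have "(\<Sum>i<N. f i N) = (\<Sum>j<N. f N j)" by (simp add: assms)
  also have "(\<Sum>j<N. f N j) = (\<Sum>d\<in>{1..<Suc N}. f N (N - d))"
    by (rule sum.reindex_bij_witness[of _ "\<lambda>d. N - d" "\<lambda>j. N - j"]) auto
  finally have 1: "(\<Sum>i<Suc N. \<Sum>j<Suc N. f i j) = (\<Sum>i<N. \<Sum>j<N. f i j) + 2 * (\<Sum>d\<in>{1..<Suc N}. f N (N - d)) + f N N" by simp
  have "(\<Sum>d\<in>{1..<Suc N}. \<Sum>i<Suc N - d. f (i + d) i) = (\<Sum>d\<in>{1..<Suc N}. (\<Sum>i<N - d. f (i + d) i) + f N (N - d))"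
  proof (rule sum.cong)
    fix d assume "d \<in> {1..<Suc N}"
    then have "Suc N - d = Suc (N - d)" by auto
    then show "(\<Sum>i<Suc N - d. f (i + d) i) = (\<Sum>i<N - d. f (i + d) i) + f N (N - d)"
      using \<open>d \<in> _\<close> by simp
  qed simp
  also have "\<dots> = (\<Sum>d\<in>{1..<N}. \<Sum>i<N - d. f (i + d) i) + (\<Sum>d\<in>{1..<Suc N}. f N (N - d))"
    by (cases "N = 0") (simp_all add: sum.distrib atLeastLessThanSuc)
  finally show ?case using 1 Suc by simp
qed simp

text \<open>Second moment over all \<open>A\<close>. Only norms of the averages enter, so the phases
  \<open>\<phi>\<close> drop out. The diagonal gives \<open>N\<close> and each \<open>d\<close> at
  most \<open>\<epsilon> / 4 * N + K\<close>, hence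
  \<open>N + 2 * N * (\<epsilon> / 4 * N + K)\<close> in all, which is at most
  \<open>\<epsilon> * N ^ 2\<close> for large \<open>N\<close>.\<close>

lemma exponential_sum_variance:
  fixes b s \<epsilon> \<kappa> :: real
  assumes b: "b > 1" and s: "s > 1" and irr: "log b s \<notin> \<rat>" and \<epsilon>: "\<epsilon> > 0" and \<kappa>: "\<kappa> > 0"
  shows "\<exists>N0. \<forall>N\<ge>N0. \<forall>W \<mu> \<phi>. \<kappa> \<le> \<mu> \<and> \<mu> * s ^ N \<le> b ^ W \<longrightarrow>
    (\<Sum>A\<in>Pow {1..W}. (norm (\<Sum>i<N. cis (2 * pi * (\<phi> i + \<mu> * s ^ i * digit_sum b A))))\<^sup>2) \<le> \<epsilon> * real N ^ 2 * 2 ^ W"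
proof -
  define P where "P W x = (\<Prod>k=1..W. \<bar>cos (pi * (x / b ^ k))\<bar>)" for W and x :: real
  have Psym: "P W (x - y) = P W (y - x)" for W x y
  proof -
    have "cos (pi * ((x - y) / b ^ k)) = cos (pi * ((y - x) / b ^ k))" for k
    proof -
      have "pi * ((x - y) / b ^ k) = - (pi * ((y - x) / b ^ k))"
        by (metis minus_diff_eq minus_divide_left mult_minus_right)
      then show ?thesis by (simp only: cos_minus)
    qed
    then show ?thesis unfolding P_def by simp
  qed
  have "\<epsilon> / 4 > 0" "\<kappa> * (s - 1) > 0" using \<epsilon> \<kappa> s by auto
  from cos_product_average[OF b s irr this] obtain K where K: "K \<ge> 0"
    "\<And>n W \<theta>. \<kappa> * (s - 1) \<le> \<theta> \<Longrightarrow> \<theta> * s ^ n \<le> b ^ W \<Longrightarrow> (\<Sum>i<n. P W (\<theta> * s ^ i)) \<le> \<epsilon> / 4 * real n + K"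
    unfolding P_def by blast
  define N0 where "N0 = nat \<lceil>(1 + 2 * K) * 2 / \<epsilon>\<rceil>"
  have "(\<Sum>A\<in>Pow {1..W}. (norm (\<Sum>i<N. cis (2 * pi * (\<phi> i + \<mu> * s ^ i * digit_sum b A))))\<^sup>2) \<le> \<epsilon> * real N ^ 2 * 2 ^ W"
    if N: "N \<ge> N0" and \<mu>: "\<kappa> \<le> \<mu>" "\<mu> * s ^ N \<le> b ^ W" for N W \<mu> \<phi>
  proof -
    define E where "E A i = cis (2 * pi * (\<phi> i + \<mu> * s ^ i * digit_sum b A))" for A i
    have sq: "complex_of_real ((norm (\<Sum>i<N. E A i))\<^sup>2) = (\<Sum>i<N. \<Sum>j<N. cis (2 * pi * (\<phi> i - \<phi> j)) * cis (2 * pi * ((\<mu> * s ^ i - \<mu> * s ^ j) * digit_sum b A)))" for A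
      unfolding complex_norm_square cnj_sum sum_product
      by (intro sum.cong refl) (simp add: E_def cis_cnj cis_mult algebra_simps)
    have swap: "(\<Sum>A\<in>R. \<Sum>i<N. \<Sum>j<N. f A i j) = (\<Sum>i<N. \<Sum>j<N. \<Sum>A\<in>R. f A i j)"
      for R :: "nat set set" and f :: "nat set \<Rightarrow> nat \<Rightarrow> nat \<Rightarrow> complex"
    proof -
      have "(\<Sum>A\<in>R. \<Sum>i<N. \<Sum>j<N. f A i j) = (\<Sum>i<N. \<Sum>A\<in>R. \<Sum>j<N. f A i j)" by (rule sum.swap)
      also have "\<dots> = (\<Sum>i<N. \<Sum>j<N. \<Sum>A\<in>R. f A i j)" by (rule sum.cong[OF refl]) (rule sum.swap)
      finally show ?thesis .
    qed
    have tot: "complex_of_real (\<Sum>A\<in>Pow {1..W}. (norm (\<Sum>i<N. E A i))\<^sup>2)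
        = (\<Sum>i<N. \<Sum>j<N. \<Sum>A\<in>Pow {1..W}. cis (2 * pi * (\<phi> i - \<phi> j)) * cis (2 * pi * ((\<mu> * s ^ i - \<mu> * s ^ j) * digit_sum b A)))"
      unfolding of_real_sum sq by (rule swap)
    have "norm (complex_of_real (\<Sum>A\<in>Pow {1..W}. (norm (\<Sum>i<N. E A i))\<^sup>2))
        \<le> (\<Sum>i<N. \<Sum>j<N. norm (\<Sum>A\<in>Pow {1..W}. cis (2 * pi * (\<phi> i - \<phi> j)) * cis (2 * pi * ((\<mu> * s ^ i - \<mu> * s ^ j) * digit_sum b A))))"
      unfolding tot by (intro order_trans[OF norm_sum] sum_mono norm_sum)
    also have "\<dots> = (\<Sum>i<N. \<Sum>j<N. 2 ^ W * P W (\<mu> * s ^ i - \<mu> * s ^ j))"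
      unfolding sum_distrib_left[symmetric] norm_mult norm_cis mult_1 sum_cis_digit_sum P_def ..
    also have "\<dots> = 2 ^ W * (\<Sum>i<N. \<Sum>j<N. P W (\<mu> * s ^ i - \<mu> * s ^ j))"
      by (simp add: sum_distrib_left)
    also have "(\<Sum>i<N. \<Sum>j<N. P W (\<mu> * s ^ i - \<mu> * s ^ j))
        = (\<Sum>i<N. P W (\<mu> * s ^ i - \<mu> * s ^ i)) + 2 * (\<Sum>d\<in>{1..<N}. \<Sum>i<N - d. P W (\<mu> * s ^ (i + d) - \<mu> * s ^ i))"
      by (rule double_sum_by_difference) (rule Psym)
    also have "(\<Sum>i<N. P W (\<mu> * s ^ i - \<mu> * s ^ i)) = real N" by (simp add: P_def)
    also have "(\<Sum>d\<in>{1..<N}. \<Sum>i<N - d. P W (\<mu> * s ^ (i + d) - \<mu> * s ^ i)) \<le> (\<Sum>d\<in>{1..<N}. \<epsilon> / 4 * real N + K)"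
    proof (rule sum_mono)
      fix d assume d: "d \<in> {1..<N}"
      have \<mu>0: "\<mu> > 0" using \<mu> \<kappa> by simp
      have "s ^ 1 \<le> s ^ d" using d s by (intro power_increasing) auto
      then have 1: "\<kappa> * (s - 1) \<le> \<mu> * (s ^ d - 1)" using \<mu> \<kappa> s by (intro mult_mono) auto
      have "\<mu> * (s ^ d - 1) * s ^ (N - d) \<le> \<mu> * s ^ d * s ^ (N - d)" using \<mu>0 s by simp
      also have "\<dots> = \<mu> * s ^ N" using d by (simp flip: power_add)
      finally have 2: "\<mu> * (s ^ d - 1) * s ^ (N - d) \<le> b ^ W" using \<mu> by simp
      have "(\<Sum>i<N - d. P W (\<mu> * s ^ (i + d) - \<mu> * s ^ i)) = (\<Sum>i<N - d. P W (\<mu> * (s ^ d - 1) * s ^ i))"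
        by (intro sum.cong refl arg_cong[of _ _ "P W"]) (simp add: power_add algebra_simps)
      also have "\<dots> \<le> \<epsilon> / 4 * real (N - d) + K" by (rule K(2)[OF 1 2])
      also have "\<dots> \<le> \<epsilon> / 4 * real N + K" using \<epsilon> by simp
      finally show "(\<Sum>i<N - d. P W (\<mu> * s ^ (i + d) - \<mu> * s ^ i)) \<le> \<epsilon> / 4 * real N + K" .
    qed
    also have "\<dots> \<le> real N * (\<epsilon> / 4 * real N + K)"
      using K(1) \<epsilon> by (simp add: mult_right_mono)
    also have "real N + 2 * (real N * (\<epsilon> / 4 * real N + K)) \<le> \<epsilon> * real N ^ 2"
    proof -
      have "(1 + 2 * K) * 2 / \<epsilon> \<le> real N" using N unfolding N0_def by linarith
      then have "1 + 2 * K \<le> \<epsilon> / 2 * real N" using \<epsilon> by (simp add: field_simps)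
      then have "real N * (1 + 2 * K) \<le> real N * (\<epsilon> / 2 * real N)" by (intro mult_left_mono) auto
      then show ?thesis by (simp add: power2_eq_square algebra_simps)
    qed
    finally have "norm (complex_of_real (\<Sum>A\<in>Pow {1..W}. (norm (\<Sum>i<N. E A i))\<^sup>2)) \<le> 2 ^ W * (\<epsilon> * real N ^ 2)"
      by simp
    then show ?thesis unfolding E_def norm_of_real by (simp add: mult_ac)
  qed
  then show ?thesis by blast
qed

text \<open>If each \<open>A\<close> had a large sum for some pair \<open>(s, h)\<close>, averaging
  over \<open>A\<close> would contradict the second moments, added over the finitely many pairs. So
  one \<open>A\<close> serves all bases and frequencies at once. \<open>N0\<close> does not depend
  on the place \<open>(c, \<rho>, P)\<close> of the block.\<close>

lemma exists_digits_small_exponential_sums: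
  fixes b \<eta> \<kappa> :: real and S :: "nat set"
  assumes b: "b > 1" and S: "finite S" "\<And>s. s \<in> S \<Longrightarrow> s \<ge> 2 \<and> log b s \<notin> \<rat>"
    and \<eta>: "\<eta> > 0" and \<kappa>: "\<kappa> > 0"
  obtains N0 where "\<forall>W P N c \<rho>. (\<forall>s\<in>S. N0 \<le> N s \<and> \<kappa> \<le> \<rho> * real s ^ P s \<and> real H * \<rho> * real s ^ (P s + N s) \<le> b ^ W) \<longrightarrow>
    (\<exists>A\<subseteq>{1..W}. \<forall>s\<in>S. \<forall>h\<in>{1..H}.
       norm (\<Sum>i<N s. cis (2 * pi * (real h * (real s ^ (P s + i) * (c + \<rho> * digit_sum b A))))) \<le> \<eta> * real (N s))"
proof -
  define I where "I = S \<times> {1..H}"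
  have fI: "finite I" using S by (simp add: I_def)
  \<comment> \<open>Small enough that \<open>card I\<close> second moments of size
    \<open>\<epsilon>\<close> add up to less than \<open>\<eta>\<^sup>2\<close>.\<close>
  define \<epsilon> where "\<epsilon> = \<eta>\<^sup>2 / (2 * (real (card I) + 1))"
  have \<epsilon>: "\<epsilon> > 0" unfolding \<epsilon>_def using \<eta> by (intro divide_pos_pos) auto
  define Q where "Q s n \<longleftrightarrow> (\<forall>N\<ge>n. \<forall>W \<mu> \<phi>. \<kappa> \<le> \<mu> \<and> \<mu> * real s ^ N \<le> b ^ W \<longrightarrow>
    (\<Sum>A\<in>Pow {1..W}. (norm (\<Sum>i<N. cis (2 * pi * (\<phi> i + \<mu> * real s ^ i * digit_sum b A))))\<^sup>2) \<le> \<epsilon> * real N ^ 2 * 2 ^ W)" for s n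
  have "\<forall>s\<in>S. \<exists>n. Q s n"
    unfolding Q_def using exponential_sum_variance[OF b _ _ \<epsilon> \<kappa>] S(2) by fastforce
  then obtain n0 where "\<forall>s\<in>S. Q s (n0 s)" by (rule bchoice[THEN exE])
  then have n0: "(\<Sum>A\<in>Pow {1..W}. (norm (\<Sum>i<N. cis (2 * pi * (\<phi> i + \<mu> * real s ^ i * digit_sum b A))))\<^sup>2) \<le> \<epsilon> * real N ^ 2 * 2 ^ W"
    if "s \<in> S" "N \<ge> n0 s" "\<kappa> \<le> \<mu>" "\<mu> * real s ^ N \<le> b ^ W" for s N W \<mu> \<phi>
    using that unfolding Q_def by blast
  \<comment> \<open>The sum dominates each \<open>n0 s\<close>; \<open>Suc\<close> keeps
    \<open>N s\<close> positive for the divisions below.\<close>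
  define N0 where "N0 = Suc (\<Sum>s\<in>S. n0 s)"
  have "\<exists>A\<subseteq>{1..W}. \<forall>s\<in>S. \<forall>h\<in>{1..H}.
       norm (\<Sum>i<N s. cis (2 * pi * (real h * (real s ^ (P s + i) * (c + \<rho> * digit_sum b A))))) \<le> \<eta> * real (N s)"
    if N: "\<And>s. s \<in> S \<Longrightarrow> N0 \<le> N s" and lo: "\<And>s. s \<in> S \<Longrightarrow> \<kappa> \<le> \<rho> * real s ^ P s"
      and hi: "\<And>s. s \<in> S \<Longrightarrow> real H * \<rho> * real s ^ (P s + N s) \<le> b ^ W" for W P N c \<rho>
  proof (rule ccontr)
    define T where "T A s h = norm (\<Sum>i<N s. cis (2 * pi * (real h * (real s ^ (P s + i) * (c + \<rho> * digit_sum b A)))))" for A s h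
    assume "\<not> ?thesis"
    then have neg: "\<exists>(s, h)\<in>I. T A s h > \<eta> * real (N s)" if "A \<in> Pow {1..W}" for A
      using that unfolding T_def I_def by (auto simp: not_le)
    have Npos: "real (N s) > 0" if "s \<in> S" for s using N[OF that] unfolding N0_def by auto
    have big: "\<eta>\<^sup>2 \<le> (\<Sum>(s, h)\<in>I. (T A s h / real (N s))\<^sup>2)" if "A \<in> Pow {1..W}" for A
    proof -
      obtain s h where sh: "(s, h) \<in> I" "T A s h > \<eta> * real (N s)" using neg[OF \<open>A \<in> _\<close>] by auto
      then have "s \<in> S" by (simp add: I_def)
      then have "\<eta> \<le> T A s h / real (N s)" using sh(2) Npos[of s] by (simp add: le_divide_eq)
      then have "\<eta>\<^sup>2 \<le> (T A s h / real (N s))\<^sup>2" using \<eta> by (intro power_mono) auto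
      also have "\<dots> \<le> (\<Sum>(s, h)\<in>I. (T A s h / real (N s))\<^sup>2)"
        using member_le_sum[of "(s, h)" I "\<lambda>(s, h). (T A s h / real (N s))\<^sup>2"] fI sh(1) by auto
      finally show ?thesis .
    qed
    have small: "(\<Sum>A\<in>Pow {1..W}. (T A s h / real (N s))\<^sup>2) \<le> \<epsilon> * 2 ^ W" if "(s, h) \<in> I" for s h
    proof -
      have s: "s \<in> S" and h: "h \<in> {1..H}" using that by (auto simp: I_def)
      have "n0 s \<le> (\<Sum>s\<in>S. n0 s)" using S(1) s by (intro member_le_sum) auto
      then have Nn: "N s \<ge> n0 s" using N[OF s] unfolding N0_def by simp
      have pos: "\<rho> * real s ^ P s > 0" using lo[OF s] \<kappa> by simp
      have "1 * (\<rho> * real s ^ P s) \<le> real h * (\<rho> * real s ^ P s)" using h pos by (intro mult_right_mono) auto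
      then have 1: "\<kappa> \<le> real h * (\<rho> * real s ^ P s)" using lo[OF s] by simp
      have "real h * (\<rho> * real s ^ P s) * real s ^ N s \<le> real H * (\<rho> * real s ^ P s) * real s ^ N s"
        using h pos by (intro mult_right_mono) auto
      also have "\<dots> \<le> b ^ W" using hi[OF s] by (simp add: power_add mult_ac)
      finally have 2: "real h * (\<rho> * real s ^ P s) * real s ^ N s \<le> b ^ W" .
      have e: "T A s h = norm (\<Sum>i<N s. cis (2 * pi * (real h * (real s ^ (P s + i) * c) + real h * (\<rho> * real s ^ P s) * real s ^ i * digit_sum b A)))" for A
        unfolding T_def by (intro arg_cong[of _ _ norm] sum.cong refl arg_cong[of _ _ cis]) (simp add: power_add algebra_simps)
      have "(\<Sum>A\<in>Pow {1..W}. (T A s h)\<^sup>2) \<le> \<epsilon> * real (N s) ^ 2 * 2 ^ W"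
        unfolding e by (rule n0[OF s Nn 1 2])
      then have "(\<Sum>A\<in>Pow {1..W}. (T A s h)\<^sup>2) / (real (N s))\<^sup>2 \<le> \<epsilon> * 2 ^ W"
        using Npos[OF s] by (subst pos_divide_le_eq) (auto simp: mult_ac)
      then show ?thesis by (simp add: power_divide sum_divide_distrib)
    qed
    have "\<eta>\<^sup>2 * 2 ^ W = (\<Sum>A\<in>Pow {1..W}. \<eta>\<^sup>2)" by (simp add: card_Pow)
    also have "\<dots> \<le> (\<Sum>A\<in>Pow {1..W}. \<Sum>(s, h)\<in>I. (T A s h / real (N s))\<^sup>2)"
      by (intro sum_mono big)
    also have "\<dots> = (\<Sum>(s, h)\<in>I. \<Sum>A\<in>Pow {1..W}. (T A s h / real (N s))\<^sup>2)"
      by (subst sum.swap) (simp add: case_prod_unfold)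
    also have "\<dots> \<le> (\<Sum>(s, h)\<in>I. \<epsilon> * 2 ^ W)" by (intro sum_mono) (use small in auto)
    also have "\<dots> = real (card I) * \<epsilon> * 2 ^ W" by (simp add: case_prod_unfold)
    finally have "\<eta>\<^sup>2 \<le> real (card I) * \<epsilon>" by simp
    also have "\<dots> < (real (card I) + 1) * (2 * \<epsilon>)" using \<epsilon> by (simp add: algebra_simps add_strict_increasing2)
    also have "\<dots> = \<eta>\<^sup>2" unfolding \<epsilon>_def by (simp add: field_simps)
    finally show False by simp
  qed
  note main = this
  show ?thesis
    by (rule that[of N0], intro allI impI, rule main) auto
qed

section \<open>Weyl's criterion\<close>

text \<open>Written as a square rather than as a weighted cosine sum, so that nonnegativity is
  immediate. Nonnegativity is what permits one-sided counting: dropping points or translates only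
  lowers the sums.\<close>

definition fejer :: "nat \<Rightarrow> real \<Rightarrow> real" where
  "fejer M u = (norm (\<Sum>h<M. cis (2 * pi * (real h * u))))\<^sup>2 / real M"

lemma fejer_nonneg: "fejer M u \<ge> 0"
  by (simp add: fejer_def)

lemma fejer_periodic: "fejer M (u + of_int z) = fejer M u"
proof -
  have "cis (2 * pi * (real h * (u + of_int z))) = cis (2 * pi * (real h * u))" for h
  proof -
    have "cis (2 * pi * (real h * (u + of_int z))) = cis (2 * pi * (real h * u)) * cis (2 * pi * of_int (int h * z))"
      unfolding cis_mult by (rule arg_cong[of _ _ cis]) (simp add: algebra_simps)
    also have "cis (2 * pi * of_int (int h * z)) = 1" by (intro cis_multiple_2pi) auto
    finally show ?thesis by simp
  qed
  then show ?thesis by (simp add: fejer_def)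
qed

lemma norm_one_minus_cis: "norm (1 - cis (2 * y)) = 2 * \<bar>sin y\<bar>"
proof -
  have "(norm (1 - cis (2 * y)))\<^sup>2 = (2 * \<bar>sin y\<bar>)\<^sup>2"
  proof -
    have "(norm (1 - cis (2 * y)))\<^sup>2 = (1 - cos (2 * y))\<^sup>2 + (sin (2 * y))\<^sup>2"
      by (simp add: cmod_power2)
    also have "\<dots> = 1 - 2 * cos (2 * y) + ((sin (2 * y))\<^sup>2 + (cos (2 * y))\<^sup>2)"
      by (simp add: power2_diff)
    also have "\<dots> = 4 * (sin y)\<^sup>2" unfolding sin_cos_squared_add by (simp add: cos_double_sin)
    finally show ?thesis by (simp add: power_mult_distrib)
  qed
  then show ?thesis by (rule power2_eq_imp_eq) auto
qed

lemma fejer_le: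
  assumes M: "M > 0" and u: "sin (pi * u) \<noteq> 0"
  shows "fejer M u \<le> 1 / (real M * (sin (pi * u))\<^sup>2)"
proof -
  let ?z = "cis (2 * (pi * u))"
  have nz: "norm (1 - ?z) = 2 * \<bar>sin (pi * u)\<bar>" by (rule norm_one_minus_cis)
  then have "?z \<noteq> 1" using u by auto
  have "(\<Sum>h<M. cis (2 * pi * (real h * u))) = (\<Sum>h<M. ?z ^ h)"
  proof (intro sum.cong refl)
    fix h
    have "?z ^ h = cis (real h * (2 * (pi * u)))" by (rule Complex.DeMoivre)
    also have "real h * (2 * (pi * u)) = 2 * pi * (real h * u)" by simp
    finally show "cis (2 * pi * (real h * u)) = ?z ^ h" by (rule sym)
  qed
  also have "\<dots> = (1 - ?z ^ M) / (1 - ?z)" using \<open>?z \<noteq> 1\<close> by (simp add: sum_gp_strict)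
  finally have "norm (\<Sum>h<M. cis (2 * pi * (real h * u))) = norm (1 - ?z ^ M) / (2 * \<bar>sin (pi * u)\<bar>)"
    using nz by (simp add: norm_divide)
  also have "\<dots> \<le> 2 / (2 * \<bar>sin (pi * u)\<bar>)"
    by (intro divide_right_mono order_trans[OF norm_triangle_ineq4]) (simp_all add: norm_power)
  finally have "(norm (\<Sum>h<M. cis (2 * pi * (real h * u))))\<^sup>2 \<le> (1 / \<bar>sin (pi * u)\<bar>)\<^sup>2"
    by (intro power_mono) auto
  then have "fejer M u \<le> (1 / \<bar>sin (pi * u)\<bar>)\<^sup>2 / real M"
    unfolding fejer_def by (intro divide_right_mono) auto
  then show ?thesis by (simp add: power_divide mult.commute)
qed

lemma of_real_fejer:
  "complex_of_real (fejer M u) = (\<Sum>h<M. \<Sum>h'<M. cis (2 * pi * ((real h - real h') * u))) / of_nat M"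
proof -
  have "complex_of_real ((norm (\<Sum>h<M. cis (2 * pi * (real h * u))))\<^sup>2) = (\<Sum>h<M. \<Sum>h'<M. cis (2 * pi * ((real h - real h') * u)))"
    unfolding complex_norm_square cnj_sum sum_product
    by (intro sum.cong refl) (simp add: cis_cnj cis_mult algebra_simps)
  then show ?thesis by (simp add: fejer_def)
qed

lemma sum_roots_cis:
  assumes Q: "Q > 0" and d: "d \<noteq> 0" "\<bar>d\<bar> < int Q"
  shows "(\<Sum>k<Q. cis (2 * pi * (of_int d * (real k / real Q)))) = 0"
proof -
  let ?z = "cis (2 * pi * (of_int d / real Q))"
  have "?z \<noteq> 1"
  proof
    assume "?z = 1"
    then have "cos (2 * pi * (of_int d / real Q)) = 1" by (metis cis.sel(1) one_complex.sel(1))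
    then obtain n :: int where "2 * pi * (of_int d / real Q) = of_int n * 2 * pi"
      unfolding cos_one_2pi_int by blast
    then have "(2 * pi) * (of_int d / real Q) = (2 * pi) * of_int n" by (metis mult.assoc mult.commute)
    then have "of_int d / real Q = of_int n" unfolding mult_cancel_left by simp
    then have "of_int d = of_int n * real Q" using Q by (simp add: field_simps)
    then have "d = n * int Q" by (metis of_int_eq_iff of_int_mult of_int_of_nat_eq)
    then show False using d by (auto simp: abs_mult)
  qed
  have "(\<Sum>k<Q. cis (2 * pi * (of_int d * (real k / real Q)))) = (\<Sum>k<Q. ?z ^ k)"
    unfolding Complex.DeMoivre by (simp add: mult_ac)
  also have "\<dots> = (1 - ?z ^ Q) / (1 - ?z)" using \<open>?z \<noteq> 1\<close> by (simp add: sum_gp_strict)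
  also have "?z ^ Q = cis (2 * pi * of_int d)" using Q by (simp add: Complex.DeMoivre)
  also have "\<dots> = 1" by (intro cis_multiple_2pi) auto
  finally show ?thesis by simp
qed

text \<open>A finite average replaces the integral over a period. It is exact because all
  frequencies \<open>h - h'\<close> are smaller than \<open>Q\<close> in absolute value, so that
  only those with \<open>h = h'\<close> survive.\<close>

lemma sum_fejer_grid:
  assumes M: "M > 0" "M \<le> Q"
  shows "(\<Sum>k<Q. fejer M (u - real k / real Q)) = real Q"
proof -
  have Q: "Q > 0" using M by simp
  have in0: "(\<Sum>k<Q. cis (2 * pi * ((real h - real h') * (u - real k / real Q)))) = (if h = h' then of_nat Q else 0)"
    if "h < M" "h' < M" for h h'
  proof (cases "h = h'")
    case False
    have "(\<Sum>k<Q. cis (2 * pi * ((real h - real h') * (u - real k / real Q))))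
        = (\<Sum>k<Q. cis (2 * pi * ((real h - real h') * u)) * cis (2 * pi * (of_int (int h' - int h) * (real k / real Q))))"
    proof -
      have "2 * pi * ((a - a') * (u - t)) = 2 * pi * ((a - a') * u) + 2 * pi * ((a' - a) * t)" for a a' t :: real
        by (simp add: algebra_simps)
      then show ?thesis unfolding cis_mult by simp
    qed
    also have "\<dots> = 0"
      unfolding sum_distrib_left[symmetric] using sum_roots_cis[OF Q, of "int h' - int h"] that M False by simp
    finally show ?thesis using False by simp
  qed simp
  have "complex_of_real (\<Sum>k<Q. fejer M (u - real k / real Q))
      = (\<Sum>k<Q. \<Sum>h<M. \<Sum>h'<M. cis (2 * pi * ((real h - real h') * (u - real k / real Q)))) / of_nat M"
    unfolding of_real_sum of_real_fejer sum_divide_distrib ..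
  also have "(\<Sum>k<Q. \<Sum>h<M. \<Sum>h'<M. cis (2 * pi * ((real h - real h') * (u - real k / real Q))))
      = (\<Sum>h<M. \<Sum>k<Q. \<Sum>h'<M. cis (2 * pi * ((real h - real h') * (u - real k / real Q))))"
    by (rule sum.swap)
  also have "\<dots> = (\<Sum>h<M. \<Sum>h'<M. \<Sum>k<Q. cis (2 * pi * ((real h - real h') * (u - real k / real Q))))"
    by (rule sum.cong[OF refl]) (rule sum.swap)
  also have "\<dots> = (\<Sum>h<M. \<Sum>h'<M. if h = h' then of_nat Q else 0)"
    by (intro sum.cong refl in0) auto
  also have "\<dots> = of_nat M * of_nat Q" by simp
  also have "of_nat M * of_nat Q / of_nat M = complex_of_real (real Q)" using M by simp
  finally show ?thesis using of_real_eq_iff by blast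
qed

text \<open>Of the \<open>M * M\<close> pairs of frequencies the diagonal ones contribute
  \<open>card I\<close> each and the others at most \<open>\<eta> * card I\<close> each; the kernel
  then divides by \<open>M\<close>.\<close>

lemma sum_fejer_le:
  fixes \<eta> :: real
  assumes I: "finite I" and M: "M > 0" and \<eta>: "\<eta> \<ge> 0"
    and S: "\<And>h. h \<in> {1..<M} \<Longrightarrow> norm (\<Sum>i\<in>I. cis (2 * pi * (real h * x i))) \<le> \<eta> * card I"
  shows "(\<Sum>i\<in>I. fejer M (x i - v)) \<le> card I * (1 + M * \<eta>)"
proof -
  have b: "norm (\<Sum>i\<in>I. cis (2 * pi * ((real h - real h') * (x i - v)))) \<le> (if h = h' then real (card I) else 0) + \<eta> * card I"
    if h: "h < M" "h' < M" for h h'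
  proof -
    have e: "norm (\<Sum>i\<in>I. cis (2 * pi * (c * (x i - v)))) = norm (\<Sum>i\<in>I. cis (2 * pi * (c * x i)))" for c
    proof -
      have "(\<Sum>i\<in>I. cis (2 * pi * (c * (x i - v)))) = cis (- 2 * pi * (c * v)) * (\<Sum>i\<in>I. cis (2 * pi * (c * x i)))"
        unfolding sum_distrib_left cis_mult by (intro sum.cong refl arg_cong[of _ _ cis]) (simp add: algebra_simps)
      then show ?thesis by (simp add: norm_mult)
    qed
    consider "h = h'" | "h > h'" | "h < h'" by linarith
    then show ?thesis
    proof cases
      case 1 then show ?thesis using \<eta> by simp
    next
      case 2
      then have c: "real h - real h' = real (h - h')" by simp
      have "norm (\<Sum>i\<in>I. cis (2 * pi * (real (h - h') * x i))) \<le> \<eta> * card I" by (rule S) (use 2 h in auto)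
      then show ?thesis unfolding e c using 2 by simp
    next
      case 3
      then have c: "real h - real h' = - real (h' - h)" by simp
      have "norm (\<Sum>i\<in>I. cis (2 * pi * (- real (h' - h) * x i))) = norm (cnj (\<Sum>i\<in>I. cis (2 * pi * (real (h' - h) * x i))))"
        unfolding cnj_sum cis_cnj by (intro arg_cong[of _ _ norm] sum.cong refl arg_cong[of _ _ cis]) simp
      also have "\<dots> \<le> \<eta> * card I" unfolding complex_mod_cnj by (rule S) (use 3 h in auto)
      finally show ?thesis unfolding e c using 3 by simp
    qed
  qed
  have "complex_of_real (\<Sum>i\<in>I. fejer M (x i - v))
      = (\<Sum>i\<in>I. \<Sum>h<M. \<Sum>h'<M. cis (2 * pi * ((real h - real h') * (x i - v)))) / of_nat M"
    unfolding of_real_sum of_real_fejer sum_divide_distrib ..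
  also have "(\<Sum>i\<in>I. \<Sum>h<M. \<Sum>h'<M. cis (2 * pi * ((real h - real h') * (x i - v))))
      = (\<Sum>h<M. \<Sum>i\<in>I. \<Sum>h'<M. cis (2 * pi * ((real h - real h') * (x i - v))))"
    by (rule sum.swap)
  also have "\<dots> = (\<Sum>h<M. \<Sum>h'<M. \<Sum>i\<in>I. cis (2 * pi * ((real h - real h') * (x i - v))))"
    by (rule sum.cong[OF refl]) (rule sum.swap)
  finally have eq: "complex_of_real (\<Sum>i\<in>I. fejer M (x i - v)) = (\<Sum>h<M. \<Sum>h'<M. \<Sum>i\<in>I. cis (2 * pi * ((real h - real h') * (x i - v)))) / of_nat M" .
  have "(\<Sum>i\<in>I. fejer M (x i - v)) \<le> norm (complex_of_real (\<Sum>i\<in>I. fejer M (x i - v)))" unfolding norm_of_real by simp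
  also have "\<dots> = norm (\<Sum>h<M. \<Sum>h'<M. \<Sum>i\<in>I. cis (2 * pi * ((real h - real h') * (x i - v)))) / real M"
    unfolding eq by (simp add: norm_divide)
  also have "\<dots> \<le> (\<Sum>h<M. \<Sum>h'<M. (if h = h' then real (card I) else 0) + \<eta> * card I) / real M"
    by (intro divide_right_mono order_trans[OF norm_sum] sum_mono b) auto
  also have "\<dots> = card I * (1 + M * \<eta>)"
    using M by (simp add: sum.distrib field_simps)
  finally show ?thesis .
qed

lemma sin_pi_lower:
  assumes "0 < \<delta>" "\<delta> \<le> w" "w \<le> 1 - \<delta>"
  shows "sin (pi * \<delta>) \<le> sin (pi * w)"
proof (cases "w \<le> 1/2")
  case True
  have "0 \<le> pi * \<delta>" "pi * \<delta> \<le> pi * w" "pi * w \<le> pi * (1/2)"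
    using assms True by (auto intro!: mult_left_mono)
  then show ?thesis using pi_gt_zero by (intro sin_monotone_2pi_le) linarith+
next
  case False
  have "sin (pi * w) = sin (pi * (1 - w))" by (simp add: right_diff_distrib)
  moreover have "sin (pi * \<delta>) \<le> sin (pi * (1 - w))"
  proof -
    have "0 \<le> pi * \<delta>" "pi * \<delta> \<le> pi * (1 - w)" "pi * (1 - w) \<le> pi * (1/2)"
      using assms False by (auto intro!: mult_left_mono)
    then show ?thesis using pi_gt_zero by (intro sin_monotone_2pi_le) linarith+
  qed
  ultimately show ?thesis by simp
qed

text \<open>A point of the interval receives almost all the mass of the kernels centred in the
  interval enlarged by \<open>\<delta>\<close>, since a kernel is at most
  \<open>\<epsilon> / 2\<close> at distance \<open>\<delta>\<close> or more from its centre. Summed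
  over all points, on the other hand, each kernel gives little more than \<open>card I\<close>. The
  constants are uniform in the points and the interval. Upper bounds suffice, because those for the
  complement turn into lower bounds.\<close>

lemma weyl_upper_bound:
  fixes \<epsilon> :: real
  assumes \<epsilon>: "\<epsilon> > 0"
  obtains \<eta> :: real and H where "\<eta> > 0"
    and "\<forall>(I :: nat set) (x :: nat \<Rightarrow> real) y L. finite I \<longrightarrow>
      (\<forall>h\<in>{1..H}. norm (\<Sum>i\<in>I. cis (2 * pi * (real h * x i))) \<le> \<eta> * card I) \<longrightarrow> 0 \<le> L \<longrightarrow>
      card {i\<in>I. \<exists>z::int. y \<le> x i + z \<and> x i + z \<le> y + L} \<le> (L + \<epsilon>) * card I"
proof (cases "\<epsilon> < 1")
  case False
  have "real (card {i\<in>I. P i}) \<le> (L + \<epsilon>) * card I" if "finite I" "0 \<le> L" for I :: "nat set" and P and L :: real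
  proof -
    have "real (card {i\<in>I. P i}) \<le> 1 * real (card I)" using that by (simp add: card_mono)
    also have "\<dots> \<le> (L + \<epsilon>) * card I" using that False by (intro mult_right_mono) auto
    finally show ?thesis .
  qed
  then show ?thesis by (intro that[of 1 0]) auto
next
  case True
  define \<delta> where "\<delta> = \<epsilon> / 8"
  have \<delta>: "0 < \<delta>" "\<delta> < 1/2" using \<epsilon> True by (auto simp: \<delta>_def)
  \<comment> \<open>\<open>\<sigma>\<close> bounds \<open>\<bar>sin (pi * w)\<bar>\<close> from
    below at distance at least \<open>\<delta>\<close> from the integers, so the choice of
    \<open>M\<close> makes the kernel at most \<open>\<epsilon> / 2\<close> there.\<close>
  define \<sigma> where "\<sigma> = sin (pi * \<delta>)"
  have \<sigma>: "\<sigma> > 0" unfolding \<sigma>_def using \<delta> by (intro sin_gt_zero) (auto simp: field_simps)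
  define M where "M = Suc (nat \<lceil>2 / (\<epsilon> * \<sigma>\<^sup>2)\<rceil>)"
  have M: "M > 0" by (simp add: M_def)
  have "2 / (\<epsilon> * \<sigma>\<^sup>2) \<le> M" unfolding M_def by linarith
  then have M\<sigma>: "1 / (M * \<sigma>\<^sup>2) \<le> \<epsilon> / 2" using \<epsilon> \<sigma> M by (simp add: field_simps)
  define Q where "Q = M + nat \<lceil>8 / \<epsilon>\<rceil>"
  have Q: "M \<le> Q" "Q > 0" using M by (auto simp: Q_def)
  have "8 / \<epsilon> \<le> Q" unfolding Q_def by linarith
  then have Q8: "1 / Q \<le> \<epsilon> / 8" using \<epsilon> Q by (simp add: field_simps)
  define \<eta> where "\<eta> = \<epsilon> / (8 * M)"
  have \<eta>: "\<eta> > 0" "M * \<eta> = \<epsilon> / 8" using \<epsilon> M by (auto simp: \<eta>_def)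
  have "card {i\<in>I. \<exists>z::int. y \<le> x i + z \<and> x i + z \<le> y + L} \<le> (L + \<epsilon>) * card I"
    if I: "finite I" and S: "\<forall>h\<in>{1..M}. norm (\<Sum>i\<in>I. cis (2 * pi * (real h * x i))) \<le> \<eta> * card I"
      and L: "0 \<le> L" for I :: "nat set" and x :: "nat \<Rightarrow> real" and y L :: real
  proof -
    define C where "C = {i\<in>I. \<exists>z::int. y \<le> x i + z \<and> x i + z \<le> y + L}"
    have C: "finite C" "C \<subseteq> I" "card C \<le> card I" using I by (auto simp: C_def intro: card_mono)
    show ?thesis
    proof (cases "L + \<epsilon> < 1")
      case False
      have "real (card C) \<le> 1 * real (card I)" using C by simp
      also have "\<dots> \<le> (L + \<epsilon>) * card I" using False by (intro mult_right_mono) auto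
      finally show ?thesis by (simp add: C_def)
    next
      case True
      \<comment> \<open>The translates whose kernels are centred at
        \<open>y - \<delta> + k / Q\<close>, between \<open>y - \<delta>\<close> and
        \<open>y + L + \<delta>\<close>.\<close>
      define J where "J = {k. k < Q \<and> real k / Q \<le> L + 2 * \<delta>}"
      have J: "finite J" "J \<subseteq> {..<Q}" by (auto simp: J_def)
      have "J \<subseteq> {..nat \<lfloor>Q * (L + 2 * \<delta>)\<rfloor>}"
      proof
        fix k assume "k \<in> J"
        then have "real k / Q \<le> L + 2 * \<delta>" by (simp add: J_def)
        then have "real k \<le> Q * (L + 2 * \<delta>)" using Q by (simp add: pos_divide_le_eq mult.commute)
        then show "k \<in> {..nat \<lfloor>Q * (L + 2 * \<delta>)\<rfloor>}" by (simp add: le_nat_floor)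
      qed
      then have "card J \<le> card {..nat \<lfloor>Q * (L + 2 * \<delta>)\<rfloor>}"
        by (intro card_mono) auto
      then have "card J \<le> Suc (nat \<lfloor>Q * (L + 2 * \<delta>)\<rfloor>)" by simp
      moreover have "0 \<le> Q * (L + 2 * \<delta>)" using L \<delta> by auto
      ultimately have cJ: "real (card J) \<le> Q * (L + 2 * \<delta>) + 1" by linarith
      define f where "f i k = fejer M (x i - (y - \<delta>) - real k / Q)" for i k
      have pt: "1 - \<epsilon> / 2 \<le> (\<Sum>k\<in>J. f i k) / Q" if i: "i \<in> C" for i
      proof -
        obtain z :: int where z: "y \<le> x i + z" "x i + z \<le> y + L" using i by (auto simp: C_def)
        have out: "f i k \<le> \<epsilon> / 2" if k: "k \<in> {..<Q} - J" for k
        proof -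
          define w where "w = x i - (y - \<delta>) - real k / Q + of_int z"
          have kQ: "real k / Q \<le> 1" "real k / Q > L + 2 * \<delta>" using k Q by (auto simp: J_def)
          have "w \<le> - \<delta>" "w \<ge> \<delta> - 1" using z kQ unfolding w_def by linarith+
          then have "\<sigma> \<le> sin (pi * (- w))" unfolding \<sigma>_def using \<delta> by (intro sin_pi_lower) auto
          then have "\<sigma>\<^sup>2 \<le> (sin (pi * (- w)))\<^sup>2" using \<sigma> by (intro power_mono) auto
          then have s: "\<sigma>\<^sup>2 \<le> (sin (pi * w))\<^sup>2" by simp
          have "sin (pi * w) \<noteq> 0" using s \<sigma> by (auto simp: power2_eq_square mult_le_0_iff not_le)
          then have "fejer M w \<le> 1 / (M * (sin (pi * w))\<^sup>2)" by (rule fejer_le[OF M])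
          also have "\<dots> \<le> 1 / (M * \<sigma>\<^sup>2)" using s \<sigma> M \<open>sin (pi * w) \<noteq> 0\<close> by (intro divide_left_mono mult_left_mono mult_pos_pos) auto
          also have "\<dots> \<le> \<epsilon> / 2" by (rule M\<sigma>)
          finally show ?thesis unfolding w_def f_def fejer_periodic .
        qed
        have "real Q = (\<Sum>k<Q. f i k)" unfolding f_def using sum_fejer_grid[OF M Q(1)] by simp
        also have "\<dots> = (\<Sum>k\<in>{..<Q} - J. f i k) + (\<Sum>k\<in>J. f i k)" using J by (intro sum.subset_diff) auto
        also have "(\<Sum>k\<in>{..<Q} - J. f i k) \<le> (\<Sum>k\<in>{..<Q} - J. \<epsilon> / 2)" by (intro sum_mono out)
        also have "\<dots> \<le> (\<Sum>k<Q. \<epsilon> / 2)" using \<epsilon> by (intro sum_mono2) auto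
        also have "\<dots> = Q * (\<epsilon> / 2)" by simp
        finally have "Q * (1 - \<epsilon> / 2) \<le> (\<Sum>k\<in>J. f i k)" by (simp add: algebra_simps)
        then show ?thesis using Q by (simp add: field_simps)
      qed
      have "card C * (1 - \<epsilon> / 2) = (\<Sum>i\<in>C. 1 - \<epsilon> / 2)" by simp
      also have "\<dots> \<le> (\<Sum>i\<in>C. (\<Sum>k\<in>J. f i k) / Q)" by (intro sum_mono pt)
      also have "\<dots> \<le> (\<Sum>i\<in>I. (\<Sum>k\<in>J. f i k) / Q)"
        using C I by (intro sum_mono2 divide_nonneg_nonneg sum_nonneg) (auto simp: f_def fejer_nonneg)
      also have "\<dots> = (\<Sum>k\<in>J. \<Sum>i\<in>I. f i k) / Q"
        unfolding sum_divide_distrib[symmetric] by (subst sum.swap) simp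
      also have "\<dots> \<le> (\<Sum>k\<in>J. card I * (1 + \<epsilon> / 8)) / Q"
      proof (intro divide_right_mono sum_mono)
        fix k
        have "(\<Sum>i\<in>I. fejer M (x i - ((y - \<delta>) + real k / Q))) \<le> card I * (1 + M * \<eta>)"
          by (rule sum_fejer_le[OF I M]) (use \<eta> S in auto)
        then show "(\<Sum>i\<in>I. f i k) \<le> card I * (1 + \<epsilon> / 8)" unfolding f_def \<eta>(2) by (simp add: diff_diff_eq)
      qed simp
      also have "\<dots> = card I * ((card J / Q) * (1 + \<epsilon> / 8))" by simp
      also have "\<dots> \<le> card I * (L + \<epsilon> / 2)"
      proof (intro mult_left_mono)
        have "card J / Q \<le> (Q * (L + 2 * \<delta>) + 1) / Q" using cJ by (intro divide_right_mono) auto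
        also have "\<dots> = L + 2 * \<delta> + 1 / Q" using Q by (simp add: field_simps)
        also have "\<dots> \<le> L + 3 * \<epsilon> / 8" using Q8 by (simp add: \<delta>_def)
        finally have "(card J / Q) * (1 + \<epsilon> / 8) \<le> (L + 3 * \<epsilon> / 8) * (1 + \<epsilon> / 8)"
          using \<epsilon> by (intro mult_right_mono) auto
        also have "\<dots> = L + 3 * \<epsilon> / 8 + (L + 3 * \<epsilon> / 8) * (\<epsilon> / 8)" by (simp add: algebra_simps)
        also have "\<dots> \<le> L + 3 * \<epsilon> / 8 + 1 * (\<epsilon> / 8)" using True \<epsilon> by (intro add_left_mono mult_right_mono) auto
        finally show "(card J / Q) * (1 + \<epsilon> / 8) \<le> L + \<epsilon> / 2" by simp
      qed simp
      finally have "card C * (1 - \<epsilon> / 2) \<le> card I * (L + \<epsilon> / 2)" .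
      moreover have "card C * (\<epsilon> / 2) \<le> card I * (\<epsilon> / 2)" using C \<epsilon> by (intro mult_right_mono) auto
      ultimately have "real (card C) \<le> (L + \<epsilon>) * card I" by (simp add: algebra_simps)
      then show ?thesis by (simp add: C_def)
    qed
  qed
  note main = this
  show ?thesis
    by (rule that[OF \<eta>(1)], intro allI impI, rule main)
qed

section \<open>Admissible refinements of intervals\<close>

text \<open>For \<open>s \<ge> 2\<close> and \<open>Q \<ge> 1\<close> the floor of the
  base-\<open>s\<close> logarithm, given as a bounded count so that computability is immediate. It
  is roughly the number of base-\<open>s\<close> digits that an interval of length
  \<open>1/Q\<close> determines.\<close>

definition flog :: "nat \<Rightarrow> nat \<Rightarrow> nat" where
  "flog s Q = card {m. m < Q \<and> s ^ Suc m \<le> Q}"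

text \<open>Modulo 1, the \<open>s ^ m\<close>-fold of \<open>[C/Q, (C+1)/Q]\<close> meets \<open>[j/t, (j+1)/t)\<close>.\<close>

definition meets_cell :: "nat \<Rightarrow> nat \<Rightarrow> nat \<Rightarrow> nat \<Rightarrow> nat \<Rightarrow> nat \<Rightarrow> bool" where
  "meets_cell s t C Q m j \<longleftrightarrow>
     (\<exists>y < Suc (t * s ^ m * (C + 1) div Q). t * s ^ m * C div Q \<le> y \<and> y mod t = j)"

text \<open>One-sided on purpose: each cell may exceed its share \<open>1/t\<close> by
  \<open>1/t^2\<close>, and lower bounds follow from the other cells. The test uses integers and the
  whole new interval, so it is decidable and binds every limit point inside.\<close>

definition good :: "nat \<Rightarrow> nat \<Rightarrow> nat \<Rightarrow> nat \<Rightarrow> nat \<Rightarrow> bool" where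
  "good s t Q C' Q' \<longleftrightarrow>
     (\<forall>j<t. card {m. m < flog s Q' \<and> flog s Q \<le> m \<and> meets_cell s t C' Q' m j} * (t * t)
        \<le> (flog s Q' - flog s Q) * (t + 1))"

text \<open>The positions counted are those where every point of \<open>[C'/Q', (C'+1)/Q']\<close> has the base-\<open>r\<close> digit 0.
  Normality to base \<open>r\<close> allows the share \<open>1/r \<le> 1/2 < 3/5\<close>.\<close>

definition biased :: "nat \<Rightarrow> nat \<Rightarrow> nat \<Rightarrow> nat \<Rightarrow> bool" where
  "biased r Q C' Q' \<longleftrightarrow>
     3 * (flog r Q' - flog r Q) \<le> 5 * card {m. m < flog r Q' \<and> flog r Q \<le> m \<and>
        (r ^ Suc m * C' div Q') mod r = 0 \<and> r ^ Suc m * (C' + 1) div Q' = r ^ Suc m * C' div Q'}"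

text \<open>A decidable form of membership in \<open>M\<close>.\<close>

definition perfect_powerless :: "nat \<Rightarrow> bool" where
  "perfect_powerless s \<longleftrightarrow> 2 \<le> s \<and> \<not> (\<exists>u<s. \<exists>k<s. u ^ k = s)"

definition refines :: "nat \<Rightarrow> nat \<Rightarrow> nat \<Rightarrow> nat \<Rightarrow> bool" where
  "refines C Q C' Q' \<longleftrightarrow> C * Q' \<le> C' * Q \<and> (C' + 1) * Q \<le> (C + 1) * Q'"

definition admissible :: "nat \<Rightarrow> nat \<Rightarrow> nat \<Rightarrow> nat \<Rightarrow> nat \<Rightarrow> nat \<Rightarrow> bool" where
  "admissible r t C Q C' Q' \<longleftrightarrow>
     refines C Q C' Q' \<and> 2 * Q \<le> Q' \<and> Q' ^ t \<le> Q ^ (t + 1) \<and>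
     (\<forall>s < Suc t. perfect_powerless s \<and> s \<noteq> r \<longrightarrow> good s t Q C' Q') \<and>
     (r = 0 \<or> biased r Q C' Q')"

section \<open>Integer logarithms\<close>

lemma flog_unique:
  assumes s: "s \<ge> 2" and p: "s ^ p \<le> Q" "Q < s ^ Suc p"
  shows "flog s Q = p"
proof -
  have "{m. m < Q \<and> s ^ Suc m \<le> Q} = {..<p}"
  proof (rule set_eqI)
    fix m
    show "m \<in> {m. m < Q \<and> s ^ Suc m \<le> Q} \<longleftrightarrow> m \<in> {..<p}"
    proof
      assume "m \<in> {m. m < Q \<and> s ^ Suc m \<le> Q}"
      then have "s ^ Suc m \<le> Q" by blast
      then have "s ^ Suc m < s ^ Suc p" using p(2) by (rule le_less_trans)
      then have "Suc m < Suc p" using s by (subst (asm) power_strict_increasing_iff) auto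
      then show "m \<in> {..<p}" by simp
    next
      assume m: "m \<in> {..<p}"
      then have "s ^ Suc m \<le> s ^ p" using s by (intro power_increasing) auto
      moreover have "p < s ^ p" using s by (intro power_gt_expt) auto
      ultimately show "m \<in> {m. m < Q \<and> s ^ Suc m \<le> Q}" using p m by auto
    qed
  qed
  then show ?thesis by (simp add: flog_def)
qed

lemma flog:
  assumes "s \<ge> 2" "Q \<ge> 1"
  shows "s ^ flog s Q \<le> Q" "Q < s ^ Suc (flog s Q)"
proof -
  obtain p where "s ^ p \<le> Q" "Q < s ^ (p + 1)" using ex_power_ivl1[OF assms] by blast
  then show "s ^ flog s Q \<le> Q" "Q < s ^ Suc (flog s Q)" using flog_unique[OF assms(1)] by auto
qed

lemma flog_mono:
  assumes "s \<ge> 2" "1 \<le> Q" "Q \<le> Q'"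
  shows "flog s Q \<le> flog s Q'"
proof -
  have "s ^ flog s Q < s ^ Suc (flog s Q')"
    using flog[of s Q] flog[of s Q'] assms by (meson le_trans order_le_less_trans)
  then have "flog s Q < Suc (flog s Q')" using assms by (subst (asm) power_strict_increasing_iff) auto
  then show ?thesis by simp
qed

section \<open>Existence of equidistributed blocks\<close>

text \<open>\<open>W\<close> is chosen before \<open>Q\<close>, \<open>c\<close> and
  \<open>\<rho>\<close>: an extension by the fixed factor \<open>b ^ W\<close> works at every scale,
  and one \<open>A\<close> settles all cells of all bases in \<open>S\<close>. The new left end is
  the random point rounded up to the grid of mesh \<open>1/Q'\<close>.\<close>

lemma good_block_exists:
  fixes b \<kappa>0 :: real and S :: "nat set"
  assumes b: "b \<ge> 2" and S: "finite S" "\<And>s. s \<in> S \<Longrightarrow> 2 \<le> s \<and> s \<le> t \<and> log b s \<notin> \<rat>"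
    and t: "t \<ge> 1" and \<kappa>0: "\<kappa>0 \<ge> 1"
  shows "\<exists>W\<ge>Wmin. \<forall>Q\<ge>1. \<forall>c \<rho>. 0 \<le> c \<and> 1 / (\<kappa>0 * real Q) \<le> \<rho> \<and> \<rho> \<le> 1 / real Q \<longrightarrow>
    (\<exists>A\<subseteq>{1..W}. \<forall>C' Q'. Q' = nat \<lceil>2 * b ^ W / \<rho>\<rceil> \<and> C' = nat \<lceil>real Q' * (c + \<rho> * digit_sum b A)\<rceil> \<longrightarrow>
       (\<forall>s\<in>S. good s t Q C' Q'))"
proof -
  \<comment> \<open>Of the permitted excess \<open>1/t^2\<close> per cell, a quarter is spent on the
    exponential sums, an eighth on the width of the new interval and a quarter on the discarded last
    digits.\<close>
  define \<epsilon> where "\<epsilon> = 1 / (4 * (real t)\<^sup>2)"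
  have \<epsilon>: "\<epsilon> > 0" using t by (simp add: \<epsilon>_def)
  obtain \<eta> :: real and H where \<eta>: "\<eta> > 0" and weyl: "\<forall>(I :: nat set) (x :: nat \<Rightarrow> real) y L. finite I \<longrightarrow>
      (\<forall>h\<in>{1..H}. norm (\<Sum>i\<in>I. cis (2 * pi * (real h * x i))) \<le> \<eta> * card I) \<longrightarrow> 0 \<le> L \<longrightarrow>
      card {i\<in>I. \<exists>z::int. y \<le> x i + z \<and> x i + z \<le> y + L} \<le> (L + \<epsilon>) * card I"
    by (rule weyl_upper_bound[OF \<epsilon>])
  \<comment> \<open>The last \<open>e\<close> digits in each base, too close to the width of the new
    interval, are given up. \<open>2 ^ e \<ge> 3 * H\<close> keeps the frequencies
    \<open>H * \<rho> * s ^ m\<close> below the top scale \<open>b ^ W\<close>, and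
    \<open>2 ^ e \<ge> 16 * t\<^sup>2\<close> keeps the blur at most
    \<open>1 / (8 * t\<^sup>2)\<close>.\<close>
  define e where "e = 3 * H + 16 * t\<^sup>2"
  have "e < 2 ^ e" by (rule less_exp)
  moreover have "3 * H \<le> e" "16 * t\<^sup>2 \<le> e" by (simp_all add: e_def)
  ultimately have e: "3 * H \<le> 2 ^ e" "16 * t\<^sup>2 \<le> 2 ^ e" by (meson less_imp_le_nat order_trans)+
  \<comment> \<open>\<open>Q < s ^ Suc (P s)\<close> and \<open>s \<le> t\<close> give
    \<open>\<rho> * s ^ P s \<ge> 1 / (\<kappa>0 * t)\<close>.\<close>
  define \<kappa> where "\<kappa> = 1 / (\<kappa>0 * t)"
  have \<kappa>: "\<kappa> > 0" using \<kappa>0 t by (simp add: \<kappa>_def)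
  have "1 < b" using b by simp
  have S': "s \<ge> 2 \<and> log b s \<notin> \<rat>" if "s \<in> S" for s using S(2)[OF that] by simp
  obtain N0 where N0: "\<forall>W P N c \<rho>. (\<forall>s\<in>S. N0 \<le> N s \<and> \<kappa> \<le> \<rho> * real s ^ P s \<and> real H * \<rho> * real s ^ (P s + N s) \<le> b ^ W) \<longrightarrow>
    (\<exists>A\<subseteq>{1..W}. \<forall>s\<in>S. \<forall>h\<in>{1..H}.
       norm (\<Sum>i<N s. cis (2 * pi * (real h * (real s ^ (P s + i) * (c + \<rho> * digit_sum b A))))) \<le> \<eta> * real (N s))"
    by (rule exists_digits_small_exponential_sums[OF \<open>1 < b\<close> S(1) S' \<eta> \<kappa>])
  \<comment> \<open>The term \<open>4 * t\<^sup>2 * e\<close> makes the discarded digits a small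
    share. \<open>W\<close> forces at least \<open>Nb + 1\<close> new digits in each base, because
    \<open>s \<le> 2 ^ t\<close> and \<open>b \<ge> 2\<close>.\<close>
  define Nb where "Nb = N0 + e + 4 * t\<^sup>2 * e"
  define W where "W = Wmin + t * (Nb + 1)"
  have "\<exists>A\<subseteq>{1..W}. \<forall>C' Q'. Q' = nat \<lceil>2 * b ^ W / \<rho>\<rceil> \<and> C' = nat \<lceil>real Q' * (c + \<rho> * digit_sum b A)\<rceil> \<longrightarrow>
       (\<forall>s\<in>S. good s t Q C' Q')"
    if Q: "Q \<ge> 1" and c: "0 \<le> c" and \<rho>: "1 / (\<kappa>0 * real Q) \<le> \<rho>" "\<rho> \<le> 1 / real Q" for Q c \<rho>
  proof -
    have "0 < 1 / (\<kappa>0 * real Q)" using Q \<kappa>0 by simp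
    then have \<rho>0: "\<rho> > 0" using \<rho> by linarith
    have \<rho>1: "\<rho> * Q \<le> 1" using \<rho>(2) Q by (simp add: field_simps)
    define Q' where "Q' = nat \<lceil>2 * b ^ W / \<rho>\<rceil>"
    have bW: "b ^ W \<ge> 1" using b by (intro one_le_power) auto
    have pos: "0 < 2 * b ^ W / \<rho>" using bW \<rho>0 by (intro divide_pos_pos) auto
    have Q'lo: "2 * b ^ W / \<rho> \<le> Q'" unfolding Q'_def by linarith
    have "Q' < 2 * b ^ W / \<rho> + 1" unfolding Q'_def using pos by linarith
    also have "1 \<le> b ^ W / \<rho>"
    proof -
      have "\<rho> * 1 \<le> \<rho> * Q" using Q \<rho>0 by (intro mult_left_mono) auto
      then have "\<rho> \<le> 1" using \<rho>1 by linarith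
      then show ?thesis using bW \<rho>0 by simp
    qed
    finally have Q'hi: "Q' \<le> 3 * b ^ W / \<rho>" by (simp add: add_divide_distrib[symmetric])
    have Q'1: "Q' \<ge> 1" using Q'lo pos by (cases Q') auto
    define P where "P s = flog s Q" for s
    define P' where "P' s = flog s Q'" for s
    define N where "N s = P' s - P s - e" for s
    have len: "P' s \<ge> P s + Nb + 1" if s: "s \<in> S" for s
    proof -
      have s2: "2 \<le> s" "s \<le> t" using S(2)[OF s] by auto
      have "real s ^ (Nb + 1) \<le> (2 ^ t) ^ (Nb + 1)"
      proof (rule power_mono)
        have "t < 2 ^ t" by (rule less_exp)
        then have "s \<le> 2 ^ t" using s2 by linarith
        then show "real s \<le> 2 ^ t" by (metis of_nat_le_iff of_nat_numeral of_nat_power)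
      qed simp
      also have "\<dots> = 2 ^ (t * (Nb + 1))" by (simp only: power_mult)
      also have "\<dots> \<le> b ^ (t * (Nb + 1))" using b by (intro power_mono) auto
      also have "\<dots> \<le> b ^ W" unfolding W_def using b by (intro power_increasing) auto
      finally have 1: "real s ^ (Nb + 1) \<le> b ^ W" .
      have "real s ^ (P s) * real s ^ (Nb + 1) \<le> real Q * b ^ W"
        using flog(1)[OF s2(1) Q] 1 unfolding P_def by (intro mult_mono) (auto simp flip: of_nat_power)
      also have "\<dots> \<le> b ^ W / \<rho>" using \<rho>1 \<rho>0 bW by (simp add: le_divide_eq mult_ac)
      also have "\<dots> < Q'" using Q'lo pos by simp
      also have "real Q' < real s ^ Suc (P' s)"
        using flog(2)[OF s2(1) Q'1] unfolding P'_def by (metis of_nat_less_iff of_nat_power)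
      finally have "real s ^ (P s + (Nb + 1)) < real s ^ Suc (P' s)" by (simp only: power_add)
      then have "P s + (Nb + 1) < Suc (P' s)" using s2 by (subst (asm) power_strict_increasing_iff) auto
      then show ?thesis by simp
    qed
    have NP: "P s + N s = P' s - e" "N s \<ge> N0" "P s + N s + e = P' s" if "s \<in> S" for s
      using len[OF that] by (auto simp: N_def Nb_def)
    have top: "real s ^ (P s + N s) * 2 ^ e \<le> Q'" if s: "s \<in> S" for s
    proof -
      have s2: "2 \<le> s" using S(2)[OF s] by auto
      have "real s ^ (P s + N s) * 2 ^ e \<le> real s ^ (P s + N s) * real s ^ e"
        using s2 by (intro mult_left_mono power_mono) auto
      also have "\<dots> = real s ^ P' s" using NP(3)[OF s] by (simp flip: power_add)
      also have "\<dots> \<le> Q'" using flog(1)[OF s2 Q'1] unfolding P'_def by (metis of_nat_le_iff of_nat_power)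
      finally show ?thesis .
    qed
    have lo: "\<kappa> \<le> \<rho> * real s ^ P s" and hi: "real H * \<rho> * real s ^ (P s + N s) \<le> b ^ W" if s: "s \<in> S" for s
    proof -
      have s2: "2 \<le> s" "s \<le> t" using S(2)[OF s] by auto
      have "real Q < real s ^ Suc (P s)" using flog(2)[OF s2(1) Q] unfolding P_def by (metis of_nat_less_iff of_nat_power)
      also have "\<dots> \<le> t * real s ^ P s" using s2 by (simp add: mult_right_mono)
      finally have "real Q \<le> t * real s ^ P s" by simp
      have "\<kappa> * (\<kappa>0 * t) = 1" using \<kappa>0 t by (simp add: \<kappa>_def)
      moreover have "1 \<le> \<rho> * (\<kappa>0 * real Q)" using \<rho>(1) Q \<kappa>0 by (simp add: field_simps)
      moreover have "\<rho> * (\<kappa>0 * real Q) \<le> \<rho> * (\<kappa>0 * (t * real s ^ P s))"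
        using \<open>real Q \<le> t * real s ^ P s\<close> \<rho>0 \<kappa>0 by (intro mult_left_mono) auto
      ultimately have "\<kappa> * (\<kappa>0 * t) \<le> (\<rho> * real s ^ P s) * (\<kappa>0 * t)" by (simp add: mult_ac)
      then show "\<kappa> \<le> \<rho> * real s ^ P s" using \<kappa>0 t by (subst (asm) mult_le_cancel_right_pos) auto
      have "3 * real H * \<rho> * real s ^ (P s + N s) \<le> 2 ^ e * \<rho> * real s ^ (P s + N s)"
      proof (intro mult_right_mono)
        show "3 * real H \<le> 2 ^ e" using e(1) by (metis of_nat_le_iff of_nat_mult of_nat_numeral of_nat_power)
      qed (use \<rho>0 in auto)
      also have "\<dots> = \<rho> * (real s ^ (P s + N s) * 2 ^ e)" by simp
      also have "\<dots> \<le> \<rho> * (3 * b ^ W / \<rho>)" using top[OF s] Q'hi \<rho>0 by (intro mult_left_mono) auto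
      also have "\<dots> = 3 * b ^ W" using \<rho>0 by simp
      finally show "real H * \<rho> * real s ^ (P s + N s) \<le> b ^ W" by simp
    qed
    have "\<forall>s\<in>S. N0 \<le> N s \<and> \<kappa> \<le> \<rho> * real s ^ P s \<and> real H * \<rho> * real s ^ (P s + N s) \<le> b ^ W"
      using NP(2) lo hi by blast
    from N0[THEN spec[of _ W], THEN spec[of _ P], THEN spec[of _ N], THEN spec[of _ c], THEN spec[of _ \<rho>], THEN mp, OF this] obtain A where A: "A \<subseteq> {1..W}" and small: "\<And>s h. s \<in> S \<Longrightarrow> h \<in> {1..H} \<Longrightarrow>
       norm (\<Sum>i<N s. cis (2 * pi * (real h * (real s ^ (P s + i) * (c + \<rho> * digit_sum b A))))) \<le> \<eta> * real (N s)"
      by blast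
    define \<xi> where "\<xi> = c + \<rho> * digit_sum b A"
    have "\<xi> \<ge> 0" unfolding \<xi>_def digit_sum_def using c \<rho>0 b by (intro add_nonneg_nonneg mult_nonneg_nonneg sum_nonneg) auto
    define C' where "C' = nat \<lceil>real Q' * \<xi>\<rceil>"
    have C'lo: "real Q' * \<xi> \<le> C'" unfolding C'_def by linarith
    have "0 \<le> real Q' * \<xi>" using \<open>\<xi> \<ge> 0\<close> by simp
    then have C'hi: "C' \<le> real Q' * \<xi> + 1" unfolding C'_def by linarith
    have "good s t Q C' Q'" if s: "s \<in> S" for s
      unfolding good_def
    proof (intro allI impI)
      fix j assume j: "j < t"
      \<comment> \<open>The new interval lies within \<open>2 / Q'\<close> of \<open>\<xi>\<close>,
        and for \<open>m < P s + N s\<close> multiplication by \<open>s ^ m \<le> Q' / 2 ^ e\<close>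
        spreads this to at most \<open>\<delta>\<close>.\<close>
      define \<delta> where "\<delta> = 2 / (2::real) ^ e"
      have \<delta>: "\<delta> > 0" "\<delta> \<le> 1 / (8 * (real t)\<^sup>2)"
      proof -
        have "real (16 * t\<^sup>2) \<le> real (2 ^ e)" using e(2) by (simp only: of_nat_le_iff)
        then have "16 * (real t)\<^sup>2 \<le> 2 ^ e" by simp
        then show "\<delta> \<le> 1 / (8 * (real t)\<^sup>2)" unfolding \<delta>_def using t by (simp add: field_simps)
      qed (simp add: \<delta>_def)
      define x where "x i = real s ^ (P s + i) * \<xi>" for i
      define y where "y = j / t - \<delta>"
      define L where "L = 1 / t + \<delta>"
      let ?B = "{m. m < flog s Q' \<and> flog s Q \<le> m \<and> meets_cell s t C' Q' m j}"
      let ?D = "{i\<in>{..<N s}. \<exists>z::int. y \<le> x i + z \<and> x i + z \<le> y + L}"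
      have D: "card ?D \<le> (L + \<epsilon>) * card {..<N s}"
      proof (rule weyl[THEN spec, THEN spec, THEN spec, THEN spec, THEN mp, THEN mp, THEN mp])
        show "\<forall>h\<in>{1..H}. norm (\<Sum>i\<in>{..<N s}. cis (2 * pi * (real h * x i))) \<le> \<eta> * card {..<N s}"
          using small[OF s] unfolding x_def \<xi>_def by simp
        show "0 \<le> L" unfolding L_def using \<delta> t by simp
      qed simp
      \<comment> \<open>The \<open>e\<close> discarded positions are counted as if they all met the
        cell.\<close>
      have "?B \<subseteq> (\<lambda>i. P s + i) ` ?D \<union> {P s + N s..<P' s}"
      proof
        fix m assume m: "m \<in> ?B"
        then have mP: "P s \<le> m" "m < P' s" by (auto simp: P_def P'_def)
        show "m \<in> (\<lambda>i. P s + i) ` ?D \<union> {P s + N s..<P' s}"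
        proof (cases "m < P s + N s")
          case True
          define i where "i = m - P s"
          have mi: "m = P s + i" "i < N s" using True mP by (auto simp: i_def)
          obtain u where u: "u \<le> t * s ^ m * (C' + 1) div Q'" "t * s ^ m * C' div Q' \<le> u" "u mod t = j"
            using m by (auto simp: meets_cell_def less_Suc_eq_le)
          have Q'0: "real Q' > 0" using Q'1 by simp
          have u1: "real u \<le> t * real s ^ m * (C' + 1) / Q'"
          proof -
            have "u * Q' \<le> t * s ^ m * (C' + 1)" using u(1) Q'1 by (simp add: less_eq_div_iff_mult_less_eq)
            then have "real (u * Q') \<le> real (t * s ^ m * (C' + 1))" by (simp only: of_nat_le_iff)
            then have "real u * real Q' \<le> t * real s ^ m * (C' + 1)" by (simp add: algebra_simps)
            then show ?thesis using Q'0 by (simp add: le_divide_eq)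
          qed
          have u2: "t * real s ^ m * C' / Q' < real u + 1"
          proof -
            have "t * s ^ m * C' < (u + 1) * Q'" using u(2) Q'1 by (simp add: div_less_iff_less_mult flip: less_Suc_eq_le)
            then have "real (t * s ^ m * C') < real ((u + 1) * Q')" by (simp only: of_nat_less_iff)
            then have "t * real s ^ m * C' < (real u + 1) * real Q'" by (simp add: algebra_simps)
            then show ?thesis using Q'0 by (simp add: divide_less_eq)
          qed
          define z where "z = u div t"
          have uz: "real u = t * real z + j" unfolding z_def using u(3) by (metis mult_div_mod_eq of_nat_add of_nat_mult)
          have t0: "real t > 0" using t by simp
          have "t * (real s ^ m * \<xi>) * Q' = t * real s ^ m * (Q' * \<xi>)" by simp
          also have "\<dots> \<le> t * real s ^ m * C'" using C'lo by (intro mult_left_mono) auto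
          finally have "t * (real s ^ m * \<xi>) \<le> t * real s ^ m * C' / Q'" using Q'0 by (simp add: le_divide_eq)
          then have "t * x i < t * real z + j + 1" using u2 uz unfolding x_def mi(1) by simp
          then have "t * (x i - z) < j + 1" by (simp add: right_diff_distrib)
          then have "x i - z < (j + 1) / t" using t0 by (simp add: less_divide_eq mult.commute)
          then have up: "x i + of_int (- int z) \<le> y + L" by (simp add: y_def L_def add_divide_distrib)
          have sm: "real s ^ m * 2 / Q' \<le> \<delta>"
          proof -
            have "real s ^ m \<le> real s ^ (P s + N s)" using True S(2)[OF s] by (intro power_increasing) auto
            then have "real s ^ m * 2 ^ e \<le> Q'" using top[OF s] by (meson mult_right_mono order_trans zero_le_numeral zero_le_power)
            then show ?thesis unfolding \<delta>_def using Q'0 by (simp add: field_simps)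
          qed
          have "t * real s ^ m * (C' + 1) / Q' \<le> t * real s ^ m * (real Q' * \<xi> + 2) / Q'"
            using C'hi by (intro divide_right_mono mult_left_mono) auto
          also have "\<dots> = t * (real s ^ m * \<xi> + real s ^ m * 2 / Q')" using Q'0 by (simp add: field_simps)
          also have "\<dots> \<le> t * (real s ^ m * \<xi> + \<delta>)" using sm by (intro mult_left_mono add_left_mono) auto
          finally have "t * real z + j \<le> t * (x i + \<delta>)" using u1 uz unfolding x_def mi(1) by simp
          then have "j \<le> (x i + \<delta> - z) * t" by (simp add: algebra_simps)
          then have "j / t \<le> x i + \<delta> - z" using t0 by (simp add: divide_le_eq)
          then have lo: "y \<le> x i + of_int (- int z)" by (simp add: y_def)
          have "i \<in> ?D" using mi lo up by blast
          then show ?thesis using mi(1) by blast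
        qed (use mP in auto)
      qed
      then have "card ?B \<le> card ((\<lambda>i. P s + i) ` ?D \<union> {P s + N s..<P' s})" by (intro card_mono) auto
      also have "\<dots> \<le> card ((\<lambda>i. P s + i) ` ?D) + card {P s + N s..<P' s}" by (rule card_Un_le)
      also have "\<dots> \<le> card ?D + e" using NP(3)[OF s] by (intro add_mono card_image_le) auto
      finally have cB: "real (card ?B) \<le> (L + \<epsilon>) * N s + e" using D by simp
      define l where "l = real (P' s - P s)"
      have l: "real (N s) \<le> l" "4 * (real t)\<^sup>2 * e \<le> l"
      proof -
        have "4 * t\<^sup>2 * e \<le> P' s - P s" using len[OF s] by (simp add: Nb_def)
        then have "real (4 * t\<^sup>2 * e) \<le> l" unfolding l_def by (simp only: of_nat_le_iff)
        then show "4 * (real t)\<^sup>2 * e \<le> l" by simp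
      qed (simp add: l_def N_def)
      have "(L + \<epsilon>) * N s \<le> (1 / t + 1 / (8 * (real t)\<^sup>2) + 1 / (4 * (real t)\<^sup>2)) * l"
        using \<delta> l(1) t by (intro mult_mono) (auto simp: L_def \<epsilon>_def)
      then have "real (card ?B) * (real t)\<^sup>2 \<le> ((1 / t + 1 / (8 * (real t)\<^sup>2) + 1 / (4 * (real t)\<^sup>2)) * l + e) * (real t)\<^sup>2"
        using cB by (intro mult_right_mono) auto
      also have "\<dots> = (t + 1/8 + 1/4) * l + (4 * (real t)\<^sup>2 * e) / 4"
        using t by (simp add: field_simps power2_eq_square)
      also have "\<dots> \<le> (t + 1/8 + 1/4) * l + l / 4" using l(2) by simp
      also have "\<dots> \<le> (t + 1) * l" unfolding l_def by (simp add: algebra_simps)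
      finally have "real (card ?B * (t * t)) \<le> real ((P' s - P s) * (t + 1))"
        unfolding l_def power2_eq_square of_nat_mult of_nat_add of_nat_1 by (simp only: mult_ac)
      then show "card ?B * (t * t) \<le> (flog s Q' - flog s Q) * (t + 1)"
        unfolding P_def P'_def by (simp only: of_nat_le_iff)
    qed
    then show ?thesis using A unfolding C'_def Q'_def \<xi>_def by blast
  qed
  note main = this
  have "W \<ge> Wmin" by (simp add: W_def)
  moreover have "\<forall>Q\<ge>1. \<forall>c \<rho>. 0 \<le> c \<and> 1 / (\<kappa>0 * real Q) \<le> \<rho> \<and> \<rho> \<le> 1 / real Q \<longrightarrow>
    (\<exists>A\<subseteq>{1..W}. \<forall>C' Q'. Q' = nat \<lceil>2 * b ^ W / \<rho>\<rceil> \<and> C' = nat \<lceil>real Q' * (c + \<rho> * digit_sum b A)\<rceil> \<longrightarrow>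
       (\<forall>s\<in>S. good s t Q C' Q'))"
    by (intro allI impI, rule main) auto
  ultimately show ?thesis by (rule_tac exI[of _ W]) (rule conjI)
qed

section \<open>Multiplicative independence\<close>

text \<open>By Bezout \<open>p * a = q * c + 1\<close>, so \<open>s\<close> is the
  \<open>q\<close>-th power of \<open>u ^ a / s ^ c\<close>, and this quotient is an integer because
  its \<open>q\<close>-th power is.\<close>

lemma coprime_power_eq_imp_power:
  fixes s u p q :: nat
  assumes eq: "s ^ p = u ^ q" and co: "coprime p q" and p: "p > 0" and q: "q > 0" and s: "s > 0" and u: "u > 0"
  shows "\<exists>w. s = w ^ q"
proof -
  obtain a c where "p * a = q * c + gcd p q" using bezout_nat[of p q] p by auto
  then have ac: "p * a = q * c + 1" using co by simp
  have "(u ^ a) ^ q = (s ^ p) ^ a" unfolding eq by (simp flip: power_mult add: mult.commute)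
  also have "\<dots> = s ^ (q * c + 1)" by (simp only: ac flip: power_mult)
  also have "\<dots> = (s ^ c) ^ q * s" by (simp add: power_mult[symmetric] mult.commute)
  finally have e: "(u ^ a) ^ q = (s ^ c) ^ q * s" .
  then have "(s ^ c) ^ q dvd (u ^ a) ^ q" by simp
  then have "s ^ c dvd u ^ a" using q by (simp add: pow_divides_pow_iff)
  then obtain w where "u ^ a = s ^ c * w" by blast
  then have "(s ^ c) ^ q * w ^ q = (s ^ c) ^ q * s" using e by (simp add: power_mult_distrib)
  then have "w ^ q = s" using s by simp
  then show ?thesis by blast
qed

text \<open>A dependent \<open>u < s\<close> gives \<open>s ^ p' = u ^ q'\<close> with coprime
  exponents, so \<open>s\<close> is a \<open>q'\<close>-th power; for \<open>q' = 1\<close> the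
  power \<open>s ^ p'\<close> would be \<open>u < s\<close>. Searching below \<open>s\<close> is
  enough, since \<open>w ^ q'\<close> exceeds both \<open>w\<close> and \<open>q'\<close>.\<close>

lemma perfect_powerless_iff: "perfect_powerless s \<longleftrightarrow> s \<in> minimal_bases"
proof
  assume s: "perfect_powerless s"
  then have s2: "s \<ge> 2" by (simp add: perfect_powerless_def)
  have "s \<le> u" if u: "base u" "mult_dependent s u" for u
  proof (rule ccontr)
    assume "\<not> s \<le> u"
    then have us: "u < s" by simp
    have u2: "u \<ge> 2" using u by (simp add: base_def)
    obtain p q where pq: "0 < p" "0 < q" "s ^ p = u ^ q"
      using u s2 mult_dependent_iff_power[of s u] by (auto simp: base_def)
    define g where "g = gcd p q"
    have g: "g > 0" using pq by (simp add: g_def)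
    obtain p' q' where pq': "p = p' * g" "q = q' * g" "coprime p' q'"
      unfolding g_def using gcd_coprime_exists[of p q] pq by auto
    have p0: "p' > 0" "q' > 0" using pq pq' by auto
    have "(s ^ p') ^ g = (u ^ q') ^ g" using pq(3) unfolding pq' by (simp add: power_mult)
    then have e: "s ^ p' = u ^ q'" using g by (simp add: power_eq_iff_eq_base)
    obtain w where w: "s = w ^ q'"
      using coprime_power_eq_imp_power[OF e pq'(3) p0] s2 u2 by auto
    have "q' \<noteq> 1"
    proof
      assume "q' = 1"
      then have "s ^ p' = u" using e by simp
      moreover have "s ^ 1 \<le> s ^ p'" using p0 s2 by (intro power_increasing) auto
      ultimately show False using us by simp
    qed
    then have q2: "q' \<ge> 2" using p0 by simp
    have w2: "w \<ge> 2"
    proof (rule ccontr)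
      assume "\<not> w \<ge> 2"
      then have "w = 0 \<or> w = 1" by auto
      then show False using w s2 p0 by (auto simp: zero_power)
    qed
    have "w ^ 1 < w ^ q'" using w2 q2 by (intro power_strict_increasing) auto
    moreover have "q' < w ^ q'" using w2 by (intro power_gt_expt) auto
    ultimately show False using s w unfolding perfect_powerless_def by auto
  qed
  then show "s \<in> minimal_bases" using s2 by (simp add: minimal_bases_def base_def)
next
  assume s: "s \<in> minimal_bases"
  then have s2: "s \<ge> 2" by (simp add: minimal_bases_def base_def)
  have "u ^ k \<noteq> s" if u: "u < s" for u k
  proof
    assume k: "u ^ k = s"
    have "u \<ge> 2"
    proof (rule ccontr)
      assume "\<not> u \<ge> 2"
      then have "u = 0 \<or> u = 1" by auto
      then show False using k s2 by (cases k) auto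
    qed
    moreover have "k > 0" using k s2 by (cases k) auto
    moreover have "s ^ 1 = u ^ k" using k by simp
    ultimately have "mult_dependent s u"
      using s2 mult_dependent_iff_power[of s u] unfolding base_def by blast
    then have "s \<le> u" using s \<open>u \<ge> 2\<close> by (simp add: minimal_bases_def base_def)
    then show False using u by simp
  qed
  then show "perfect_powerless s" using s2 by (auto simp: perfect_powerless_def)
qed

lemma minimal_bases_log_irrational:
  assumes "r \<in> minimal_bases" "s \<in> minimal_bases" "r \<noteq> s"
  shows "log (real r ^ 3) (real s) \<notin> \<rat>"
proof
  assume q: "log (real r ^ 3) (real s) \<in> \<rat>"
  have rs: "r \<ge> 2" "s \<ge> 2" using assms by (auto simp: minimal_bases_def base_def)
  have r3: "real r ^ 3 > 1" using rs by (intro one_less_power) auto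
  define y where "y = log (real r ^ 3) (real s)"
  have "0 < real r ^ 3" "real r ^ 3 \<noteq> 1" "0 < real s" using r3 rs by linarith+
  then have "real s = (real r ^ 3) powr y" unfolding y_def by (intro powr_log_cancel[symmetric])
  also have "(real r ^ 3) powr y = (real r powr 3) powr y" using rs by simp
  also have "\<dots> = real r powr (3 * y)" by (rule powr_powr)
  finally have e: "real s = real r powr (3 * y)" .
  have "3 * y \<in> \<rat>" using q unfolding y_def by (intro Rats_mult) auto
  then have "mult_dependent r s" "mult_dependent s r" using e unfolding mult_dependent_def by blast+
  then have "r \<le> s" "s \<le> r" using assms rs by (auto simp: minimal_bases_def base_def)
  then show False using assms by simp
qed

text \<open>In neutral mode no base is exempt, so \<open>b\<close> has to be independent of all
  integers at once. For 5/2 a relation would read \<open>s ^ j * 2 ^ i = 5 ^ i\<close>, which parity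
  forbids.\<close>

lemma log_five_halves_irrational:
  assumes s: "s \<ge> (2::nat)"
  shows "log (5/2) (real s) \<notin> \<rat>"
proof
  assume "log (5/2) (real s) \<in> \<rat>"
  then obtain i :: int and j :: nat where j: "j \<noteq> 0" and ij: "log (5/2) (real s) = of_int i / of_nat j"
    by (auto elim: Rats_cases' simp: Rats_eq_int_div_nat)
  have "log (5/2) (real s) > 0" using s by simp
  then have i: "i > 0" using j unfolding ij by (simp add: zero_less_divide_iff)
  have "real s = (5/2) powr (of_int i / of_nat j)" unfolding ij[symmetric] using s by simp
  then have "real s ^ j = ((5/2) powr (of_int i / of_nat j)) powr real j" using s by (simp add: powr_realpow)
  also have "\<dots> = (5/2) powr real (nat i)" using i j by (simp add: powr_powr)
  also have "\<dots> = (5/2) ^ nat i" by (simp add: powr_realpow)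
  finally have "real s ^ j * 2 ^ nat i = 5 ^ nat i" by (simp add: power_divide)
  then have "real (s ^ j * 2 ^ nat i) = real (5 ^ nat i)" by simp
  then have "s ^ j * 2 ^ nat i = 5 ^ nat i" by (simp only: of_nat_eq_iff)
  moreover have "even (s ^ j * 2 ^ nat i)" using i by simp
  moreover have "odd ((5::nat) ^ nat i)" by simp
  ultimately show False by metis
qed

section \<open>The geometry of one step\<close>

text \<open>The spare \<open>1 / b ^ W\<close> is room for rounding: it keeps the new interval
  inside \<open>[c, c + \<rho>]\<close> even for the largest digit sum.\<close>

lemma geometric_le_1:
  fixes b :: real assumes b: "b \<ge> 2"
  shows "(\<Sum>k=1..W. 1 / b ^ k) + 1 / b ^ W \<le> 1"
proof (induction W)
  case (Suc W)
  have "1 / b ^ Suc W + 1 / b ^ Suc W = (2 / b) * (1 / b ^ W)" by simp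
  also have "\<dots> \<le> 1 * (1 / b ^ W)" using b by (intro mult_right_mono) auto
  finally show ?case using Suc by simp
qed simp

lemma digit_sum_le:
  assumes b: "b \<ge> 2" and A: "A \<subseteq> {1..W}"
  shows "digit_sum b A + 1 / b ^ W \<le> 1"
proof -
  have "digit_sum b A \<le> (\<Sum>k=1..W. 1 / b ^ k)"
    unfolding digit_sum_def using A b by (intro sum_mono2) auto
  then show ?thesis using geometric_le_1[OF b, of W] by linarith
qed

text \<open>For \<open>b = r ^ 3\<close> the bound is \<open>2 / r ^ 3\<close>, so even after
  multiplication by \<open>r\<close> the remainder stays at most \<open>1 / r\<close>. This yields
  two zero digits after each place \<open>k\<close>.\<close>

lemma digit_sum_tail_le:
  assumes b: "b \<ge> 2" and A: "A \<subseteq> {1..W}" and k: "k < W"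
  shows "digit_sum b {k'\<in>A. k < k'} * b ^ k + b ^ k / b ^ W \<le> 2 / b"
proof -
  have "digit_sum b {k'\<in>A. k < k'} \<le> (\<Sum>k'\<in>{k<..W}. 1 / b ^ k')"
    unfolding digit_sum_def using A b by (intro sum_mono2) auto
  also have "\<dots> = (\<Sum>j=1..W - k. 1 / b ^ (j + k))"
    by (rule sum.reindex_bij_witness[of _ "\<lambda>j. j + k" "\<lambda>k'. k' - k"]) auto
  also have "\<dots> = (\<Sum>j=1..W - k. 1 / b ^ j) / b ^ k"
    by (simp add: sum_divide_distrib power_add)
  finally have 1: "digit_sum b {k'\<in>A. k < k'} * b ^ k \<le> (\<Sum>j=1..W - k. 1 / b ^ j)"
    using b by (simp add: le_divide_eq)
  obtain J where J: "W - k = Suc J" using k by (metis Suc_diff_Suc)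
  have "b ^ W = b ^ k * b ^ (W - k)" using k by (simp flip: power_add)
  then have 2: "b ^ k / b ^ W = 1 / b ^ (W - k)" using b by simp
  have "(\<Sum>j=1..Suc J. 1 / b ^ j) = 1 / b + (\<Sum>j=1..J. 1 / b ^ Suc j)"
    using sum.atLeast_Suc_atMost[of 1 "Suc J" "\<lambda>j. 1 / b ^ j"] sum.shift_bounds_cl_Suc_ivl[of "\<lambda>j. 1 / b ^ j" 1 J] by simp
  also have "(\<Sum>j=1..J. 1 / b ^ Suc j) = (\<Sum>j=1..J. 1 / b ^ j) / b" by (simp add: sum_divide_distrib mult.commute)
  finally have "(\<Sum>j=1..Suc J. 1 / b ^ j) + 1 / b ^ Suc J = (1 + ((\<Sum>j=1..J. 1 / b ^ j) + 1 / b ^ J)) / b"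
    by (simp add: add_divide_distrib)
  also have "\<dots> \<le> (1 + 1) / b" using geometric_le_1[OF b, of J] b by (intro divide_right_mono add_left_mono) auto
  finally have "(\<Sum>j=1..Suc J. 1 / b ^ j) + 1 / b ^ Suc J \<le> 2 / b" by simp
  then show ?thesis using 1 unfolding 2 J by linarith
qed

lemma real_div_eqI:
  fixes f C Q N :: nat
  assumes "Q > 0" "real N \<le> real f * (real C / real Q)" "real f * (real C / real Q) < real N + 1"
  shows "f * C div Q = N"
proof (rule div_nat_eqI)
  have "real (Q * N) \<le> real (f * C)" using assms by (simp add: field_simps)
  then show "Q * N \<le> f * C" by (simp only: of_nat_le_iff)
  have "real (f * C) < real (Q * Suc N)" using assms by (simp add: field_simps)
  then show "f * C < Q * Suc N" by (simp only: of_nat_less_iff)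
qed

text \<open>Each place \<open>k\<close> of the sum occupies three base-\<open>r\<close> digits, and
  for \<open>i < 2\<close> the fractional part of \<open>r ^ (n + 3 * k + i) * \<xi>\<close> is
  below \<open>1 / r\<close> with room for the whole interval. So \<open>2 * W\<close> of the at
  most \<open>3 * W + 3\<close> new digits are certainly 0.\<close>

lemma biased_block:
  fixes r n a W Q C' Q' :: nat and A :: "nat set"
  defines "\<xi> \<equiv> real a / real r ^ n + digit_sum (real r ^ 3) A / real r ^ n"
  assumes r: "r \<ge> 2" and A: "A \<subseteq> {1..W}" and W: "W \<ge> 9" and Q: "Q \<ge> 1"
    and n: "2 * Q \<le> r ^ n" "r ^ n \<le> 2 * Q * r"
    and Q': "real Q' = 2 * (real r ^ 3) ^ W * real r ^ n"
    and C': "real Q' * \<xi> \<le> C'" "C' < real Q' * \<xi> + 1"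
  shows "biased r Q C' Q'"
proof -
  define b where "b = real r ^ 3"
  have rpos: "real r > 0" using r by simp
  have b8: "b \<ge> 2 ^ 3" unfolding b_def using r by (intro power_mono) auto
  then have b: "b \<ge> 2" by simp
  have Q'n: "Q' = 2 * r ^ (n + 3 * W)"
  proof -
    have "real Q' = real (2 * r ^ (n + 3 * W))" unfolding Q' by (simp add: power_add power_mult)
    then show ?thesis by (simp only: of_nat_eq_iff)
  qed
  have Q'1: "Q' \<ge> 1" "real Q' > 0" unfolding Q'n using r by auto
  define P where "P = flog r Q"
  define P' where "P' = flog r Q'"
  have Pn: "P \<le> n"
  proof -
    have "r ^ P \<le> Q" unfolding P_def by (rule flog(1)[OF r Q])
    then have "r ^ P \<le> r ^ n" using n by linarith
    then show ?thesis using r by (simp add: power_increasing_iff)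
  qed
  have nP: "n \<le> P + 2"
  proof -
    have "r ^ n \<le> 2 * Q * r" by (rule n)
    also have "\<dots> < 2 * r ^ Suc P * r" using flog(2)[OF r Q] r unfolding P_def by simp
    also have "\<dots> \<le> r * r ^ Suc P * r" using r by (intro mult_right_mono) auto
    also have "\<dots> = r ^ (P + 3)" by (simp add: power_add eval_nat_numeral)
    finally have "n < P + 3" using r by (subst (asm) power_strict_increasing_iff) auto
    then show ?thesis by simp
  qed
  have P'lo: "n + 3 * W \<le> P'"
  proof -
    have "r ^ (n + 3 * W) \<le> Q'" unfolding Q'n by simp
    also have "\<dots> < r ^ Suc P'" using flog(2)[OF r Q'1(1)] unfolding P'_def .
    finally have "n + 3 * W < Suc P'" using r by (subst (asm) power_strict_increasing_iff) auto
    then show ?thesis by simp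
  qed
  have P'hi: "P' \<le> n + 3 * W + 1"
  proof -
    have "r ^ P' \<le> Q'" using flog(1)[OF r Q'1(1)] unfolding P'_def .
    also have "\<dots> \<le> r * r ^ (n + 3 * W)" unfolding Q'n using r by (intro mult_right_mono) auto
    also have "\<dots> = r ^ (n + 3 * W + 1)" by simp
    finally show ?thesis using r by (simp only: power_increasing_iff)
  qed
  let ?T = "{m. m < P' \<and> P \<le> m \<and> (r ^ Suc m * C' div Q') mod r = 0 \<and> r ^ Suc m * (C' + 1) div Q' = r ^ Suc m * C' div Q'}"
  define g where "g ki = n + 3 * fst ki + snd ki" for ki :: "nat \<times> nat"
  have "g ` ({..<W} \<times> {..<2}) \<subseteq> ?T"
  proof (rule image_subsetI)
    fix ki assume "ki \<in> {..<W} \<times> {..<2::nat}"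
    then obtain k i where ki: "ki = (k, i)" "k < W" "i < 2" by auto
    define m where "m = n + 3 * k + i"
    \<comment> \<open>Multiplication by \<open>r ^ m\<close> turns the places up to \<open>k\<close>
      into integers; together with \<open>a\<close> they form \<open>N\<close>, while the later
      places form the remainder \<open>\<tau>\<close>.\<close>
    define Z where "Z = (\<Sum>k'\<in>{k'\<in>A. k' \<le> k}. r ^ (3 * (k - k') + i))"
    define N where "N = r ^ (3 * k + i) * a + Z"
    define \<tau> where "\<tau> = real r ^ i * (digit_sum b {k'\<in>A. k < k'} * b ^ k)"
    have rb: "real r ^ (3 * k + i) = b ^ k * real r ^ i" for k by (simp add: b_def power_add power_mult)
    have fA: "finite A" using A finite_subset by auto
    have "real r ^ m * \<xi> = real r ^ (3 * k + i) * (real a + digit_sum b A)"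
      using rpos unfolding m_def \<xi>_def b_def by (simp add: power_add field_simps)
    also have "digit_sum b A = digit_sum b {k'\<in>A. k' \<le> k} + digit_sum b {k'\<in>A. k < k'}"
    proof -
      have "A = {k'\<in>A. k' \<le> k} \<union> {k'\<in>A. k < k'}" by auto
      then show ?thesis unfolding digit_sum_def using fA
        by (metis (no_types, lifting) sum.union_disjoint finite_Un disjoint_iff mem_Collect_eq not_less)
    qed
    also have "real r ^ (3 * k + i) * (real a + (digit_sum b {k'\<in>A. k' \<le> k} + digit_sum b {k'\<in>A. k < k'}))
       = real r ^ (3 * k + i) * real a + real r ^ (3 * k + i) * digit_sum b {k'\<in>A. k' \<le> k} + \<tau>"
      unfolding \<tau>_def rb by (simp add: algebra_simps)
    also have "real r ^ (3 * k + i) * digit_sum b {k'\<in>A. k' \<le> k} = real Z"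
      unfolding digit_sum_def Z_def of_nat_sum sum_distrib_left
    proof (rule sum.cong)
      fix k' assume k': "k' \<in> {k'\<in>A. k' \<le> k}"
      then have "b ^ k = b ^ (k - k') * b ^ k'" by (simp flip: power_add)
      then show "real r ^ (3 * k + i) * (1 / b ^ k') = real (r ^ (3 * (k - k') + i))"
        using b unfolding of_nat_power rb by simp
    qed simp
    finally have e: "real r ^ m * \<xi> = real N + \<tau>" by (simp add: N_def)
    have \<tau>0: "0 \<le> \<tau>" unfolding \<tau>_def digit_sum_def using b rpos by (intro mult_nonneg_nonneg sum_nonneg) auto
    have "\<tau> + real r ^ m * (2 / Q') = real r ^ i * (digit_sum b {k'\<in>A. k < k'} * b ^ k + b ^ k / b ^ W)"
    proof -
      have "real r ^ m * (2 / Q') = real r ^ i * (b ^ k / b ^ W)"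
        unfolding Q' m_def using rpos by (simp add: power_add power_mult b_def)
      then show ?thesis by (simp add: \<tau>_def distrib_left)
    qed
    also have "\<dots> \<le> real r ^ i * (2 / b)"
      by (intro mult_left_mono digit_sum_tail_le b A ki) simp
    also have "\<dots> \<le> real r ^ 1 * (2 / b)" using ki(3) r b by (intro mult_right_mono power_increasing) auto
    also have "\<dots> = (2 / r) / r" using rpos by (simp add: b_def power3_eq_cube)
    also have "\<dots> \<le> 1 / r" using r by (intro divide_right_mono) auto
    finally have up: "\<tau> + real r ^ m * (2 / Q') \<le> 1 / r" .
    have D: "r ^ Suc m * C'' div Q' = r * N" if C'': "real Q' * \<xi> \<le> C''" "C'' < real Q' * \<xi> + 2" for C''
    proof (rule real_div_eqI)
      have "\<xi> \<le> C'' / Q'" using C'' Q'1 by (simp add: le_divide_eq mult.commute)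
      then have "real r ^ m * \<xi> \<le> real r ^ m * (C'' / Q')" by (intro mult_left_mono) auto
      then have "real N \<le> real r ^ m * (C'' / Q')" using e \<tau>0 by linarith
      then have "real r * real N \<le> real r * (real r ^ m * (C'' / Q'))" by (intro mult_left_mono) auto
      then show "real (r * N) \<le> real (r ^ Suc m) * (C'' / Q')" by (simp add: mult.assoc)
      have "C'' / Q' < (real Q' * \<xi> + 2) / Q'" using C'' Q'1 by (intro divide_strict_right_mono) auto
      also have "\<dots> = \<xi> + 2 / Q'" using Q'1 by (simp add: field_simps)
      finally have "real r ^ m * (C'' / Q') < real r ^ m * (\<xi> + 2 / Q')" using rpos by (intro mult_strict_left_mono) auto
      also have "\<dots> = real N + (\<tau> + real r ^ m * (2 / Q'))" using e by (simp add: distrib_left)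
      also have "\<dots> \<le> real N + 1 / r" using up by simp
      finally have "real r * (real r ^ m * (C'' / Q')) < real r * (real N + 1 / r)" using rpos by (intro mult_strict_left_mono)
      also have "\<dots> = real r * real N + 1" using rpos by (simp add: distrib_left)
      finally show "real (r ^ Suc m) * (C'' / Q') < real (r * N) + 1" by (simp add: mult.assoc)
    qed (use Q'1 in simp)
    have D1: "r ^ Suc m * C' div Q' = r * N" using C' by (intro D) auto
    have D2: "r ^ Suc m * (C' + 1) div Q' = r * N" using C' by (intro D) auto
    have "m < P'" "P \<le> m" using ki P'lo Pn unfolding m_def by linarith+
    then show "g ki \<in> ?T" using D1 D2 unfolding ki g_def m_def by simp
  qed
  moreover have "inj_on g ({..<W} \<times> {..<2})"
    by (rule inj_onI) (auto simp: g_def, presburger+)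
  ultimately have "2 * W \<le> card ?T"
    using card_inj_on_le[of g "{..<W} \<times> {..<2}" ?T] by simp
  \<comment> \<open>\<open>P' - P \<le> 3 * W + 3\<close>, and \<open>9 * W + 9 \<le> 10 * W\<close>
    is where the 9 comes from.\<close>
  moreover have "3 * (P' - P) \<le> 10 * W" using P'hi nP W by linarith
  ultimately show ?thesis unfolding biased_def P_def[symmetric] P'_def[symmetric] by linarith
qed

text \<open>\<open>Q' / Q\<close> is at most the constant \<open>3 * \<kappa>0 * b ^ W\<close>,
  whose \<open>t\<close>-th power is at most \<open>Q\<close> once \<open>Q\<close> is large. This
  is how blocks of bounded relative length meet \<open>Q' ^ t \<le> Q ^ (t + 1)\<close>.\<close>

lemma refining_block:
  fixes b \<rho> c \<kappa>0 :: real and Q C C' Q' t W :: nat and A :: "nat set"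
  defines "\<xi> \<equiv> c + \<rho> * digit_sum b A"
  assumes b: "b \<ge> 2" and A: "A \<subseteq> {1..W}" and Q: "Q \<ge> 1" and \<rho>: "1 / (\<kappa>0 * Q) \<le> \<rho>" "\<rho> \<le> 1 / Q" and \<kappa>0: "\<kappa>0 \<ge> 1"
    and c: "C / Q \<le> c" "c + \<rho> \<le> (C + 1) / Q"
    and Q': "2 * b ^ W / \<rho> \<le> Q'" "Q' \<le> 3 * b ^ W / \<rho>"
    and C': "real Q' * \<xi> \<le> C'" "C' < real Q' * \<xi> + 1"
    and large: "(3 * \<kappa>0 * b ^ W) ^ t \<le> Q"
  shows "refines C Q C' Q' \<and> 2 * Q \<le> Q' \<and> Q' ^ t \<le> Q ^ (t + 1)"
proof -
  have Q0: "real Q > 0" using Q by simp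
  have "0 < 1 / (\<kappa>0 * real Q)" using Q \<kappa>0 by simp
  then have \<rho>0: "\<rho> > 0" using \<rho> by linarith
  have bW: "b ^ W \<ge> 1" using b by (intro one_le_power) auto
  have "2 * real Q \<le> 2 * b ^ W / \<rho>"
  proof -
    have "2 * (real Q * \<rho>) \<le> 2 * b ^ W" using \<rho>(2) Q0 bW by (simp add: field_simps)
    then show ?thesis using \<rho>0 by (simp add: le_divide_eq)
  qed
  then have "real (2 * Q) \<le> real Q'" using Q' by simp
  then have 1: "2 * Q \<le> Q'" by (simp only: of_nat_le_iff)
  have Q'0: "real Q' > 0" using 1 Q by simp
  have X: "0 \<le> digit_sum b A" unfolding digit_sum_def using b by (intro sum_nonneg) auto
  have "c \<le> \<xi>" unfolding \<xi>_def using X \<rho>0 by simp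
  moreover have "\<xi> \<le> C' / Q'" using C'(1) Q'0 by (simp add: le_divide_eq mult.commute)
  ultimately have "C / Q \<le> C' / Q'" using c by linarith
  then have "real (C * Q') \<le> real (C' * Q)" using Q0 Q'0 by (simp add: field_simps)
  then have 2: "C * Q' \<le> C' * Q" by (simp only: of_nat_le_iff)
  have "(C' + 1) / Q' \<le> (real Q' * \<xi> + 2) / Q'" using C'(2) by (intro divide_right_mono) auto
  also have "\<dots> = \<xi> + 2 / Q'" using Q'0 by (simp add: field_simps)
  also have "2 / Q' \<le> \<rho> / b ^ W" using Q'(1) \<rho>0 bW Q'0 by (simp add: field_simps)
  also have "\<xi> + \<rho> / b ^ W = c + \<rho> * (digit_sum b A + 1 / b ^ W)" by (simp add: \<xi>_def distrib_left)
  also have "\<dots> \<le> c + \<rho> * 1" using \<rho>0 digit_sum_le[OF b A] by (intro add_left_mono mult_left_mono) auto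
  also have "\<dots> \<le> (C + 1) / Q" using c by simp
  finally have "real ((C' + 1) * Q) \<le> real ((C + 1) * Q')" using Q0 Q'0 by (simp add: field_simps)
  then have 3: "(C' + 1) * Q \<le> (C + 1) * Q'" by (simp only: of_nat_le_iff)
  have "1 / \<rho> \<le> \<kappa>0 * Q" using \<rho>(1) \<kappa>0 Q0 \<rho>0 by (simp add: field_simps)
  then have "3 * b ^ W * (1 / \<rho>) \<le> 3 * b ^ W * (\<kappa>0 * Q)" using bW by (intro mult_left_mono) auto
  then have "real Q' \<le> 3 * \<kappa>0 * b ^ W * Q" using Q'(2) by (simp add: mult_ac)
  then have "real Q' ^ t \<le> (3 * \<kappa>0 * b ^ W * Q) ^ t" by (intro power_mono) auto
  also have "\<dots> = (3 * \<kappa>0 * b ^ W) ^ t * real Q ^ t" by (simp add: power_mult_distrib)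
  also have "\<dots> \<le> Q * real Q ^ t" using large by (intro mult_right_mono) auto
  finally have "real (Q' ^ t) \<le> real (Q ^ (t + 1))" by simp
  then have 4: "Q' ^ t \<le> Q ^ (t + 1)" by (simp only: of_nat_le_iff)
  show ?thesis unfolding refines_def using 1 2 3 4 by blast
qed

text \<open>In a biased mode the block must start at an \<open>r\<close>-adic interval, for the
  zeros to be digits of the number itself. One of length at least \<open>1 / (2 * r * Q)\<close>
  fits into the given interval, whence \<open>\<kappa>0 = 2 * r\<close>. In neutral mode the given
  interval serves directly.\<close>

lemma feasible:
  assumes r: "r = 0 \<or> r \<in> minimal_bases" and t: "t \<ge> 1"
  shows "\<exists>Q0. \<forall>Q\<ge>Q0. \<forall>C. \<exists>C' Q'. admissible r t C Q C' Q'"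
proof -
  define b :: real where "b = (if r = 0 then 5/2 else real r ^ 3)"
  define S where "S = {s. s \<le> t \<and> perfect_powerless s \<and> s \<noteq> r}"
  define \<kappa>0 :: real where "\<kappa>0 = (if r = 0 then 1 else 2 * real r)"
  have r2: "r \<ge> 2" if "r \<noteq> 0" using r that by (auto simp: minimal_bases_def base_def)
  have b: "b \<ge> 2"
  proof (cases "r = 0")
    case False
    have "(2::real) ^ 3 \<le> real r ^ 3" using r2[OF False] by (intro power_mono) auto
    then show ?thesis using False by (simp add: b_def)
  qed (simp add: b_def)
  have \<kappa>0: "\<kappa>0 \<ge> 1" using r2 by (auto simp: \<kappa>0_def)
  have S1: "finite S" unfolding S_def by simp
  have S2: "2 \<le> s \<and> s \<le> t \<and> log b s \<notin> \<rat>" if "s \<in> S" for s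
  proof -
    have s: "s \<le> t" "s \<in> minimal_bases" "s \<noteq> r" using that by (auto simp: S_def perfect_powerless_iff)
    then have "2 \<le> s" by (simp add: minimal_bases_def base_def)
    then show ?thesis using s r minimal_bases_log_irrational[of r s] log_five_halves_irrational[of s] by (auto simp: b_def)
  qed
  obtain W where W: "W \<ge> 9" and blk: "\<forall>Q\<ge>1. \<forall>c \<rho>. 0 \<le> c \<and> 1 / (\<kappa>0 * real Q) \<le> \<rho> \<and> \<rho> \<le> 1 / real Q \<longrightarrow>
    (\<exists>A\<subseteq>{1..W}. \<forall>C' Q'. Q' = nat \<lceil>2 * b ^ W / \<rho>\<rceil> \<and> C' = nat \<lceil>real Q' * (c + \<rho> * digit_sum b A)\<rceil> \<longrightarrow>
       (\<forall>s\<in>S. good s t Q C' Q'))"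
    using good_block_exists[OF b S1 S2 t \<kappa>0, of 9] by blast
  have bW: "b ^ W \<ge> 1" using b by (intro one_le_power) auto
  define Q0 where "Q0 = Suc (nat \<lceil>(3 * \<kappa>0 * b ^ W) ^ t\<rceil>)"
  have "\<exists>C' Q'. admissible r t C Q C' Q'" if QQ: "Q \<ge> Q0" for Q C
  proof -
    have large: "(3 * \<kappa>0 * b ^ W) ^ t \<le> Q" and Q: "Q \<ge> 1" using QQ unfolding Q0_def by linarith+
    have Qp: "real Q > 0" using Q by simp
    obtain n a and c \<rho> :: real where c: "0 \<le> c" "C / Q \<le> c" "c + \<rho> \<le> (C + 1) / Q"
      and \<rho>: "1 / (\<kappa>0 * Q) \<le> \<rho>" "\<rho> \<le> 1 / Q"
      and rn: "r \<noteq> 0 \<Longrightarrow> 2 * Q \<le> r ^ n \<and> r ^ n \<le> 2 * Q * r \<and> c = real a / real r ^ n \<and> \<rho> = 1 / real r ^ n"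
    proof (cases "r = 0")
      case True
      show ?thesis
        by (rule that[of "C / Q" "1 / Q" 0 0]) (use True Qp in \<open>auto simp: \<kappa>0_def add_divide_distrib\<close>)
    next
      case False
      have r2: "r \<ge> 2" using r2 False by simp
      obtain k where k: "r ^ k \<le> 2 * Q" "2 * Q < r ^ (k + 1)" using ex_power_ivl1[OF r2, of "2 * Q"] Q by auto
      \<comment> \<open>With \<open>r ^ n \<ge> 2 * Q\<close> a full cell of the
        \<open>r\<close>-adic grid lies inside \<open>[C/Q, (C+1)/Q]\<close>.\<close>
      define n where "n = k + 1"
      have n: "2 * Q \<le> r ^ n" "r ^ n \<le> 2 * Q * r" using k unfolding n_def by auto
      have rnp: "real r ^ n > 0" using r2 by simp
      have n': "2 * real Q \<le> real r ^ n" "real r ^ n \<le> 2 * real Q * real r"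
        using n by (metis of_nat_le_iff of_nat_mult of_nat_numeral of_nat_power)+
      define a where "a = nat \<lceil>C * real r ^ n / Q\<rceil>"
      have "0 \<le> C * real r ^ n / Q" using rnp by simp
      then have a: "C * real r ^ n / Q \<le> a" "a < C * real r ^ n / Q + 1" unfolding a_def by linarith+
      have "C / Q \<le> a / real r ^ n" using a(1) rnp Qp by (simp add: field_simps)
      moreover have "a / real r ^ n + 1 / real r ^ n \<le> (C + 1) / Q"
      proof -
        have "a / real r ^ n + 1 / real r ^ n \<le> (C * real r ^ n / Q + 2) / real r ^ n"
          using a(2) unfolding add_divide_distrib[symmetric] by (intro divide_right_mono) auto
        also have "\<dots> = C / Q + 2 / real r ^ n" using rnp by (simp add: add_divide_distrib)
        also have "2 / real r ^ n \<le> 1 / Q" using n'(1) rnp Qp by (simp add: field_simps)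
        finally show ?thesis by (simp add: add_divide_distrib)
      qed
      moreover have "1 / (\<kappa>0 * Q) \<le> 1 / real r ^ n" using n'(2) False rnp Qp r2 by (simp add: \<kappa>0_def frac_le mult_ac)
      moreover have "1 / real r ^ n \<le> 1 / Q" by (intro frac_le) (use n'(1) Qp in linarith)+
      ultimately show ?thesis using n by (intro that[of "a / real r ^ n" "1 / real r ^ n" n a]) auto
    qed
    have "0 < 1 / (\<kappa>0 * real Q)" using Q \<kappa>0 by simp
    then have \<rho>0: "\<rho> > 0" using \<rho> by linarith
    obtain A where A: "A \<subseteq> {1..W}" and gd: "\<forall>C' Q'. Q' = nat \<lceil>2 * b ^ W / \<rho>\<rceil> \<and> C' = nat \<lceil>real Q' * (c + \<rho> * digit_sum b A)\<rceil> \<longrightarrow>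
       (\<forall>s\<in>S. good s t Q C' Q')"
      using blk[THEN spec[of _ Q], THEN mp, OF Q, THEN spec[of _ c], THEN spec[of _ \<rho>], THEN mp, OF conjI[OF c(1) conjI[OF \<rho>]]]
      by (elim exE conjE) (rule that)
    define Q' where "Q' = nat \<lceil>2 * b ^ W / \<rho>\<rceil>"
    define \<xi> where "\<xi> = c + \<rho> * digit_sum b A"
    define C' where "C' = nat \<lceil>real Q' * \<xi>\<rceil>"
    have G: "\<forall>s\<in>S. good s t Q C' Q'"
      using gd[THEN spec[of _ C'], THEN spec[of _ Q'], THEN mp] unfolding Q'_def C'_def \<xi>_def by simp
    have pos: "0 < 2 * b ^ W / \<rho>" using bW \<rho>0 by (intro divide_pos_pos) auto
    have Q'lo: "2 * b ^ W / \<rho> \<le> Q'" unfolding Q'_def by linarith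
    have "1 / real Q \<le> 1" using Q by simp
    then have \<rho>1: "\<rho> \<le> 1" using \<rho>(2) by linarith
    have "Q' < 2 * b ^ W / \<rho> + 1" unfolding Q'_def using pos by linarith
    also have "1 \<le> b ^ W / \<rho>" using bW \<rho>0 \<rho>1 by simp
    finally have Q'hi: "Q' \<le> 3 * b ^ W / \<rho>" by (simp add: add_divide_distrib[symmetric])
    have "0 \<le> digit_sum b A" unfolding digit_sum_def using b by (intro sum_nonneg) auto
    then have \<xi>0: "\<xi> \<ge> 0" unfolding \<xi>_def using c \<rho>0 by auto
    then have "0 \<le> real Q' * \<xi>" by simp
    then have C'b: "real Q' * \<xi> \<le> C'" "C' < real Q' * \<xi> + 1" unfolding C'_def by linarith+
    have R: "refines C Q C' Q' \<and> 2 * Q \<le> Q' \<and> Q' ^ t \<le> Q ^ (t + 1)"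
      by (rule refining_block[OF b A Q \<rho> \<kappa>0 c(2,3) Q'lo Q'hi C'b[unfolded \<xi>_def] large])
    have B: "biased r Q C' Q'" if r0: "r \<noteq> 0"
    proof (rule biased_block[OF r2[OF r0] A W Q])
      show "2 * Q \<le> r ^ n" "r ^ n \<le> 2 * Q * r" using rn[OF r0] by auto
      \<comment> \<open>An integer, so the ceiling is exact and \<open>Q'\<close> is twice a power
        of \<open>r\<close>.\<close>
      have "2 * b ^ W / \<rho> = real_of_int (int (2 * (r ^ 3) ^ W * r ^ n))"
        using rn[OF r0] r0 by (simp add: b_def)
      then have "\<lceil>2 * b ^ W / \<rho>\<rceil> = int (2 * (r ^ 3) ^ W * r ^ n)" by (simp only: ceiling_of_int)
      then have "Q' = 2 * (r ^ 3) ^ W * r ^ n" unfolding Q'_def by (simp only: nat_int)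
      then show "real Q' = 2 * (real r ^ 3) ^ W * real r ^ n" by simp
      have "\<xi> = real a / real r ^ n + digit_sum (real r ^ 3) A / real r ^ n"
        using rn[OF r0] r0 unfolding \<xi>_def b_def by simp
      then show "real Q' * (real a / real r ^ n + digit_sum (real r ^ 3) A / real r ^ n) \<le> C'"
        "C' < real Q' * (real a / real r ^ n + digit_sum (real r ^ 3) A / real r ^ n) + 1"
        using C'b by auto
    qed
    have "admissible r t C Q C' Q'"
      unfolding admissible_def using R G B by (auto simp: S_def less_Suc_eq_le)
    then show ?thesis by blast
  qed
  then show ?thesis by blast
qed

section \<open>Normality and visiting frequencies\<close>

definition visits :: "real \<Rightarrow> nat \<Rightarrow> real \<Rightarrow> real \<Rightarrow> nat set" where
  "visits \<xi> s u v = {m. u \<le> frac (real s ^ m * \<xi>) \<and> frac (real s ^ m * \<xi>) < v}"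

lemma visits_split:
  assumes "0 \<le> u" "u \<le> v" "v \<le> 1" "finite I"
  shows "card (I \<inter> visits \<xi> s 0 u) + card (I \<inter> visits \<xi> s u v) + card (I \<inter> visits \<xi> s v 1) = card I"
proof -
  have "I = (I \<inter> visits \<xi> s 0 u) \<union> ((I \<inter> visits \<xi> s u v) \<union> (I \<inter> visits \<xi> s v 1))"
    using assms by (auto simp: visits_def frac_lt_1 not_less)
  then have "card I = card ((I \<inter> visits \<xi> s 0 u) \<union> ((I \<inter> visits \<xi> s u v) \<union> (I \<inter> visits \<xi> s v 1)))" by simp
  also have "\<dots> = card (I \<inter> visits \<xi> s 0 u) + card ((I \<inter> visits \<xi> s u v) \<union> (I \<inter> visits \<xi> s v 1))"
    using assms by (intro card_Un_disjoint) (auto simp: visits_def)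
  also have "card ((I \<inter> visits \<xi> s u v) \<union> (I \<inter> visits \<xi> s v 1)) = card (I \<inter> visits \<xi> s u v) + card (I \<inter> visits \<xi> s v 1)"
    using assms by (intro card_Un_disjoint) (auto simp: visits_def)
  finally show ?thesis by simp
qed

text \<open>At most \<open>t * (v - u) + 2\<close> cells meet \<open>[u, v)\<close>, each with share
  at most \<open>(1 + 1/t) / t\<close>; expanding \<open>(v - u + 2/t) * (1 + 1/t)\<close> with
  \<open>v - u \<le> 1\<close> gives the 5.\<close>

lemma good_visits_upper:
  assumes gd: "good s t Q C' Q'" and t: "t \<ge> 1" and Q': "Q' \<ge> 1"
    and \<xi>: "real C' / Q' \<le> \<xi>" "\<xi> \<le> (real C' + 1) / Q'" and uv: "0 \<le> u" "u \<le> v" "v \<le> 1"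
  shows "card ({flog s Q..<flog s Q'} \<inter> visits \<xi> s u v) \<le> (v - u + 5 / t) * (flog s Q' - flog s Q)"
proof -
  define l where "l = flog s Q' - flog s Q"
  let ?B = "\<lambda>j. {m. m < flog s Q' \<and> flog s Q \<le> m \<and> meets_cell s t C' Q' m j}"
  define J where "J = {nat \<lfloor>t * u\<rfloor>..nat \<lceil>t * v\<rceil> - 1} \<inter> {..<t}"
  have t0: "real t > 0" using t by simp
  have Q'0: "real Q' > 0" using Q' by simp
  have \<xi>0: "\<xi> \<ge> 0" using \<xi>(1) by (rule order_trans[rotated]) simp
  have sub: "{flog s Q..<flog s Q'} \<inter> visits \<xi> s u v \<subseteq> (\<Union>j\<in>J. ?B j)"
  proof
    fix m assume m: "m \<in> {flog s Q..<flog s Q'} \<inter> visits \<xi> s u v"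
    define x where "x = real s ^ m * \<xi>"
    define f where "f = frac x"
    have f: "u \<le> f" "f < v" "0 \<le> f" "f < 1" using m by (auto simp: visits_def f_def x_def frac_lt_1)
    define j where "j = nat \<lfloor>t * f\<rfloor>"
    have tf: "0 \<le> t * f" "t * f < t" using f t0 by auto
    have jt: "j < t" unfolding j_def using tf by (simp add: nat_less_iff floor_less_iff)
    have x0: "x \<ge> 0" unfolding x_def using \<xi>0 by simp
    define y where "y = nat \<lfloor>t * x\<rfloor>"
    have tx: "0 \<le> t * x" using x0 t0 by simp
    have yx: "real y \<le> t * x" "t * x < real y + 1" unfolding y_def using tx by linarith+
    define z where "z = nat \<lfloor>x\<rfloor>"
    have zx: "x = real z + f" using x0 unfolding z_def f_def frac_def by simp
    have "t * x = of_nat (t * z) + t * f" using zx by (simp add: distrib_left)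
    then have "\<lfloor>t * x\<rfloor> = int (t * z) + \<lfloor>t * f\<rfloor>" by (metis floor_add_int add.commute of_int_of_nat_eq)
    then have "y = t * z + j" 
    proof -
      have "int y = \<lfloor>t * x\<rfloor>" "int j = \<lfloor>t * f\<rfloor>" unfolding y_def j_def using tx tf by simp_all
      then have "int y = int (t * z + j)" using \<open>\<lfloor>t * x\<rfloor> = int (t * z) + \<lfloor>t * f\<rfloor>\<close> by simp
      then show ?thesis by (simp only: of_nat_eq_iff)
    qed
    then have ym: "y mod t = j" using jt by simp
    have "t * s ^ m * C' div Q' \<le> y"
    proof -
      have "real s ^ m * (C' / Q') \<le> x" unfolding x_def using \<xi> by (intro mult_left_mono) auto
      then have "t * (real s ^ m * (C' / Q')) \<le> t * x" using t0 by (intro mult_left_mono) auto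
      then have "t * (real s ^ m * (C' / Q')) < real y + 1" using yx by linarith
      then have "t * (real s ^ m * (C' / Q')) * Q' < (real y + 1) * Q'" using Q'0 by (intro mult_strict_right_mono) auto
      then have "real (t * s ^ m * C') < real ((y + 1) * Q')" using Q'0 by (simp add: algebra_simps)
      then have "t * s ^ m * C' < (y + 1) * Q'" by (simp only: of_nat_less_iff)
      then have "t * s ^ m * C' div Q' < y + 1" using Q' by (simp add: div_less_iff_less_mult)
      then show ?thesis by simp
    qed
    moreover have "y \<le> t * s ^ m * (C' + 1) div Q'"
    proof -
      have "x \<le> real s ^ m * ((real C' + 1) / Q')" unfolding x_def using \<xi> by (intro mult_left_mono) auto
      then have "t * x \<le> t * (real s ^ m * ((real C' + 1) / Q'))" using t0 by (intro mult_left_mono) auto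
      then have "real y \<le> t * (real s ^ m * ((real C' + 1) / Q'))" using yx by linarith
      then have "real y * Q' \<le> t * (real s ^ m * ((real C' + 1) / Q')) * Q'" by (intro mult_right_mono) auto
      also have "t * (real s ^ m * ((real C' + 1) / Q')) * Q' = t * (real s ^ m * (real C' + 1))" using Q'0 by simp
      finally have "real (y * Q') \<le> real (t * s ^ m * (C' + 1))" by (simp add: algebra_simps)
      then have "y * Q' \<le> t * s ^ m * (C' + 1)" by (simp only: of_nat_le_iff)
      then show ?thesis using Q' by (simp add: less_eq_div_iff_mult_less_eq)
    qed
    ultimately have "y < Suc (t * s ^ m * (C' + 1) div Q') \<and> t * s ^ m * C' div Q' \<le> y \<and> y mod t = j"
      using ym by (simp only: less_Suc_eq_le)
    then have "meets_cell s t C' Q' m j" unfolding meets_cell_def by blast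
    then have "m \<in> ?B j" using m by auto
    moreover have "j \<in> J"
    proof -
      have "t * u \<le> t * f" "t * f < t * v" using f t0 by auto
      then have "\<lfloor>t * u\<rfloor> \<le> \<lfloor>t * f\<rfloor>" "\<lfloor>t * f\<rfloor> < \<lceil>t * v\<rceil>" by (auto intro: floor_mono) linarith
      then show ?thesis using jt tf unfolding J_def j_def by auto
    qed
    ultimately show "m \<in> (\<Union>j\<in>J. ?B j)" by blast
  qed
  have J: "finite J" "J \<subseteq> {..<t}" by (auto simp: J_def)
  have "card J \<le> card {nat \<lfloor>t * u\<rfloor>..nat \<lceil>t * v\<rceil> - 1}" unfolding J_def by (intro card_mono) auto
  moreover have "0 \<le> t * u" "t * u \<le> t * v" using uv t0 by auto
  ultimately have cJ: "real (card J) \<le> t * (v - u) + 2" by (simp add: right_diff_distrib) linarith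
  have "card ({flog s Q..<flog s Q'} \<inter> visits \<xi> s u v) \<le> card (\<Union>j\<in>J. ?B j)"
    by (intro card_mono sub) (use J in auto)
  also have "\<dots> \<le> (\<Sum>j\<in>J. card (?B j))" by (rule card_UN_le[OF J(1)])
  finally have 1: "card ({flog s Q..<flog s Q'} \<inter> visits \<xi> s u v) \<le> (\<Sum>j\<in>J. card (?B j))" .
  have cell: "real (card (?B j)) \<le> l * (t + 1) / (real t)\<^sup>2" if "j \<in> J" for j
  proof -
    have "card (?B j) * (t * t) \<le> l * (t + 1)" using gd that J unfolding good_def l_def by auto
    then have "real (card (?B j) * (t * t)) \<le> real (l * (t + 1))" by (simp only: of_nat_le_iff)
    then show ?thesis using t0 by (simp add: le_divide_eq power2_eq_square)
  qed
  have "real (\<Sum>j\<in>J. card (?B j)) \<le> (\<Sum>j\<in>J. l * (t + 1) / (real t)\<^sup>2)"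
    unfolding of_nat_sum by (intro sum_mono cell)
  also have "\<dots> = card J * (l * (t + 1) / (real t)\<^sup>2)" by simp
  also have "\<dots> \<le> (t * (v - u) + 2) * (l * (t + 1) / (real t)\<^sup>2)" using cJ by (intro mult_right_mono) auto
  also have "\<dots> = ((v - u) + 2 / t) * (1 + 1 / t) * l" using t0 by (simp add: field_simps power2_eq_square)
  also have "\<dots> \<le> (v - u + 5 / t) * l"
  proof (intro mult_right_mono)
    have "1 / real t \<le> 1" using t by simp
    have "((v - u) + 2 * y) * (1 + y) = (v - u) + 2 * y + (v - u) * y + 2 * (y * y)" for y
      by (simp add: algebra_simps)
    from this[of "1 / t"] have "((v - u) + 2 / t) * (1 + 1 / t) = (v - u) + 2 / t + (v - u) * (1 / t) + 2 * ((1 / t) * (1 / t))"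
      by simp
    also have "(v - u) * (1 / t) \<le> 1 * (1 / t)" using uv by (intro mult_right_mono) auto
    also have "(1 / real t) * (1 / t) \<le> 1 * (1 / t)" using \<open>1 / real t \<le> 1\<close> by (intro mult_right_mono) auto
    finally show "((v - u) + 2 / t) * (1 + 1 / t) \<le> v - u + 5 / t" by simp
  qed simp
  finally show ?thesis using 1 unfolding l_def by linarith
qed

text \<open>The upper bounds for \<open>[0, u)\<close> and \<open>[v, 1)\<close> amount to a lower
  bound for \<open>[u, v)\<close>; two errors of \<open>5 / t\<close> make 10.\<close>

lemma good_visits:
  assumes gd: "good s t Q C' Q'" and t: "t \<ge> 1" and Q': "Q' \<ge> 1"
    and \<xi>: "real C' / Q' \<le> \<xi>" "\<xi> \<le> (real C' + 1) / Q'" and uv: "0 \<le> u" "u \<le> v" "v \<le> 1"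
    and le: "flog s Q \<le> flog s Q'"
  shows "\<bar>real (card ({flog s Q..<flog s Q'} \<inter> visits \<xi> s u v)) - (v - u) * (real (flog s Q') - real (flog s Q))\<bar>
     \<le> 10 / t * (real (flog s Q') - real (flog s Q))"
proof -
  let ?I = "{flog s Q..<flog s Q'}"
  define l where "l = real (flog s Q') - real (flog s Q)"
  have l: "real (flog s Q' - flog s Q) = l" using le by (simp add: l_def)
  have l0: "l \<ge> 0" using le by (simp add: l_def)
  note up = good_visits_upper[OF gd t Q' \<xi>, unfolded l]
  have "real (card (?I \<inter> visits \<xi> s 0 u)) \<le> (u - 0 + 5 / t) * l" by (rule up) (use uv in auto)
  moreover have "real (card (?I \<inter> visits \<xi> s v 1)) \<le> (1 - v + 5 / t) * l" by (rule up) (use uv in auto)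
  moreover have M: "real (card (?I \<inter> visits \<xi> s u v)) \<le> (v - u + 5 / t) * l" by (rule up) (use uv in auto)
  moreover have "card (?I \<inter> visits \<xi> s 0 u) + card (?I \<inter> visits \<xi> s u v) + card (?I \<inter> visits \<xi> s v 1) = card ?I"
    by (rule visits_split[OF uv]) simp
  then have "real (card (?I \<inter> visits \<xi> s 0 u)) + real (card (?I \<inter> visits \<xi> s u v)) + real (card (?I \<inter> visits \<xi> s v 1)) = l"
    using l by (simp flip: of_nat_add)
  moreover have "(5 / t) * l \<ge> 0" using l0 by simp
  moreover have "\<bar>m - (v * l - u * l)\<bar> \<le> 2 * e"
    if "a \<le> u * l + e" "c \<le> l - v * l + e" "m \<le> v * l - u * l + e" "a + m + c = l" "e \<ge> 0" for a c m e :: real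
    using that by linarith
  moreover have "(u - 0 + 5 / t) * l = u * l + (5 / t) * l" "(1 - v + 5 / t) * l = l - v * l + (5 / t) * l"
    "(v - u + 5 / t) * l = v * l - u * l + (5 / t) * l" and e: "10 / t * l = 2 * ((5 / t) * l)" "(v - u) * l = v * l - u * l"
    by (simp_all add: algebra_simps)
  ultimately show ?thesis unfolding l_def[symmetric] e by metis
qed

lemma biased_visits:
  assumes bi: "biased r Q C' Q'" and r: "r \<ge> 2" and Q': "Q' \<ge> 1"
    and \<xi>: "real C' / Q' \<le> \<xi>" "\<xi> \<le> (real C' + 1) / Q'"
  shows "3 * (flog r Q' - flog r Q) \<le> 5 * card ({flog r Q..<flog r Q'} \<inter> visits \<xi> r 0 (1 / r))"
proof -
  let ?T = "{m. m < flog r Q' \<and> flog r Q \<le> m \<and>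
        (r ^ Suc m * C' div Q') mod r = 0 \<and> r ^ Suc m * (C' + 1) div Q' = r ^ Suc m * C' div Q'}"
  have Q'0: "real Q' > 0" using Q' by simp
  have "?T \<subseteq> {flog r Q..<flog r Q'} \<inter> visits \<xi> r 0 (1 / r)"
  proof
    fix m assume m: "m \<in> ?T"
    then obtain N where N: "r ^ Suc m * C' div Q' = r * N" by (auto simp: mod_eq_0_iff_dvd)
    then have N2: "r ^ Suc m * (C' + 1) div Q' = r * N" using m by simp
    have "r * N * Q' \<le> r ^ Suc m * C'" unfolding N[symmetric] by simp
    then have "real (r * N * Q') \<le> real (r ^ Suc m * C')" by (simp only: of_nat_le_iff)
    then have "real N \<le> real r ^ m * (C' / Q')" using Q'0 r by (simp add: field_simps)
    also have "\<dots> \<le> real r ^ m * \<xi>" using \<xi> by (intro mult_left_mono) auto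
    finally have lo: "real N \<le> real r ^ m * \<xi>" .
    have "r ^ Suc m * (C' + 1) < (r * N + 1) * Q'" using N2 Q' div_less_iff_less_mult[of Q' "r ^ Suc m * (C' + 1)" "r * N + 1"] by simp
    then have "real (r ^ Suc m * (C' + 1)) < real ((r * N + 1) * Q')" by (simp only: of_nat_less_iff)
    then have "real r ^ m * ((real C' + 1) / Q') < N + 1 / r" using Q'0 r by (simp add: field_simps)
    moreover have "real r ^ m * \<xi> \<le> real r ^ m * ((real C' + 1) / Q')" using \<xi> by (intro mult_left_mono) auto
    ultimately have hi: "real r ^ m * \<xi> < N + 1 / r" by linarith
    have "1 / real r \<le> 1" using r by simp
    then have "real r ^ m * \<xi> < N + 1" using hi by linarith
    then have "\<lfloor>real r ^ m * \<xi>\<rfloor> = int N" using lo by (intro floor_unique) auto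
    then have "frac (real r ^ m * \<xi>) < 1 / r" using hi by (simp add: frac_def)
    then show "m \<in> {flog r Q..<flog r Q'} \<inter> visits \<xi> r 0 (1 / r)" using m by (auto simp: visits_def)
  qed
  then have "card ?T \<le> card ({flog r Q..<flog r Q'} \<inter> visits \<xi> r 0 (1 / r))" by (intro card_mono) auto
  then show ?thesis using bi unfolding biased_def by linarith
qed

lemma discrepancy_visits:
  "discrepancy (map (\<lambda>j. frac (real s ^ j * \<xi>)) [0..<N]) =
     (SUP (u, v) \<in> {(u, v). 0 \<le> u \<and> u < v \<and> v \<le> 1}. \<bar>real (card ({..<N} \<inter> visits \<xi> s u v)) / real N - (v - u)\<bar>)"
proof -
  have "{n. n < length (map (\<lambda>j. frac (real s ^ j * \<xi>)) [0..<N]) \<and> u \<le> map (\<lambda>j. frac (real s ^ j * \<xi>)) [0..<N] ! n \<and>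
      map (\<lambda>j. frac (real s ^ j * \<xi>)) [0..<N] ! n < v} = {..<N} \<inter> visits \<xi> s u v" for u v
    by (auto simp: visits_def)
  then show ?thesis unfolding discrepancy_def by simp
qed

lemma visits_ratio_le_1: "real (card ({..<N} \<inter> visits \<xi> s u v)) / real N \<le> 1"
proof (cases "N = 0")
  case False
  have "card ({..<N} \<inter> visits \<xi> s u v) \<le> card {..<N}" by (intro card_mono) auto
  then show ?thesis using False by simp
qed simp

lemma normal_imp_visits:
  fixes u v \<epsilon> :: real
  assumes nm: "normal_to_base \<xi> s" and uv: "0 \<le> u" "u < v" "v \<le> 1" and \<epsilon>: "\<epsilon> > 0"
  shows "\<exists>N0. \<forall>N\<ge>N0. \<bar>real (card ({..<N} \<inter> visits \<xi> s u v)) - (v - u) * N\<bar> \<le> \<epsilon> * N"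
proof -
  let ?D = "\<lambda>N. discrepancy (map (\<lambda>j. frac (real s ^ j * \<xi>)) [0..<N])"
  have "?D \<longlonglongrightarrow> 0" using nm by (simp add: normal_to_base_def)
  then obtain N0 where N0: "\<And>N. N \<ge> N0 \<Longrightarrow> \<bar>?D N\<bar> < \<epsilon>" using \<epsilon> by (auto simp: lim_sequentially dist_real_def)
  have "\<bar>real (card ({..<N} \<inter> visits \<xi> s u v)) - (v - u) * N\<bar> \<le> \<epsilon> * N" if N: "N \<ge> max 1 N0" for N
  proof -
    have "(case (u, v) of (u, v) \<Rightarrow> \<bar>real (card ({..<N} \<inter> visits \<xi> s u v)) / real N - (v - u)\<bar>) \<le> ?D N"
      unfolding discrepancy_visits
    proof (rule cSUP_upper)
      show "bdd_above ((\<lambda>(u, v). \<bar>real (card ({..<N} \<inter> visits \<xi> s u v)) / real N - (v - u)\<bar>) ` {(u, v). 0 \<le> u \<and> u < v \<and> v \<le> 1})"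
      proof (rule bdd_aboveI[of _ 2])
        fix x assume "x \<in> (\<lambda>(u, v). \<bar>real (card ({..<N} \<inter> visits \<xi> s u v)) / real N - (v - u)\<bar>) ` {(u, v). 0 \<le> u \<and> u < v \<and> v \<le> 1}"
        then obtain u v where x: "x = \<bar>real (card ({..<N} \<inter> visits \<xi> s u v)) / real N - (v - u)\<bar>" and "0 \<le> u" "u < v" "v \<le> 1" by auto
        moreover have "0 \<le> real (card ({..<N} \<inter> visits \<xi> s u v)) / real N" by simp
        ultimately show "x \<le> 2" using visits_ratio_le_1[of N \<xi> s u v] unfolding x abs_le_iff by linarith
      qed
    qed (use uv in auto)
    then have "\<bar>real (card ({..<N} \<inter> visits \<xi> s u v)) / real N - (v - u)\<bar> \<le> \<epsilon>"
      using N0[of N] N by (simp add: abs_less_iff)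
    then have "\<bar>real (card ({..<N} \<inter> visits \<xi> s u v)) / real N - (v - u)\<bar> * N \<le> \<epsilon> * N" by (intro mult_right_mono) auto
    moreover have "\<bar>real (card ({..<N} \<inter> visits \<xi> s u v)) / real N - (v - u)\<bar> * N
       = \<bar>(real (card ({..<N} \<inter> visits \<xi> s u v)) / real N - (v - u)) * N\<bar>" by (simp add: abs_mult)
    moreover have "(real (card ({..<N} \<inter> visits \<xi> s u v)) / real N - (v - u)) * N = real (card ({..<N} \<inter> visits \<xi> s u v)) - (v - u) * N"
      using N by (simp add: left_diff_distrib)
    ultimately show ?thesis by simp
  qed
  then show ?thesis by blast
qed

text \<open>\<open>K\<close> may depend on \<open>\<epsilon>\<close> but not on \<open>u\<close> and
  \<open>v\<close>, because the discrepancy is a supremum over all of them.\<close>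

lemma visits_imp_normal:
  assumes "\<And>\<epsilon>::real. \<epsilon> > 0 \<Longrightarrow> \<exists>K::real. \<forall>N u v. 0 \<le> u \<and> u < v \<and> v \<le> 1 \<longrightarrow>
     \<bar>real (card ({..<N} \<inter> visits \<xi> s u v)) - (v - u) * N\<bar> \<le> \<epsilon> * N + K"
  shows "normal_to_base \<xi> s"
  unfolding normal_to_base_def
proof (rule LIMSEQ_I)
  fix \<epsilon> :: real assume \<epsilon>: "\<epsilon> > 0"
  obtain K where K: "\<And>N u v. 0 \<le> u \<Longrightarrow> u < v \<Longrightarrow> v \<le> 1 \<Longrightarrow>
     \<bar>real (card ({..<N} \<inter> visits \<xi> s u v)) - (v - u) * N\<bar> \<le> \<epsilon> / 4 * N + K"
    using assms[of "\<epsilon> / 4"] \<epsilon> by auto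
  define N0 where "N0 = Suc (nat \<lceil>4 * K / \<epsilon>\<rceil>)"
  have "norm (discrepancy (map (\<lambda>j. frac (real s ^ j * \<xi>)) [0..<N]) - 0) < \<epsilon>" if N: "N \<ge> N0" for N
  proof -
    let ?S = "{(u, v). 0 \<le> u \<and> u < v \<and> v \<le> (1::real)}"
    let ?g = "\<lambda>(u, v). \<bar>real (card ({..<N} \<inter> visits \<xi> s u v)) / real N - (v - u)\<bar>"
    have N1: "real N > 0" and KN: "4 * K / \<epsilon> \<le> N" using N unfolding N0_def by linarith+
    have b: "?g p \<le> \<epsilon> / 2" if "p \<in> ?S" for p
    proof -
      obtain u v where "p = (u, v)" by (cases p)
      then have p: "p = (u, v)" "0 \<le> u" "u < v" "v \<le> 1" using that by auto
      have "\<bar>real (card ({..<N} \<inter> visits \<xi> s u v)) / real N - (v - u)\<bar> = \<bar>(real (card ({..<N} \<inter> visits \<xi> s u v)) - (v - u) * N) / N\<bar>"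
        using N1 by (simp add: diff_divide_distrib)
      also have "\<dots> = \<bar>real (card ({..<N} \<inter> visits \<xi> s u v)) - (v - u) * N\<bar> / N" using N1 by simp
      also have "\<dots> \<le> (\<epsilon> / 4 * N + K) / N" using K[OF p(2-4)] by (intro divide_right_mono) auto
      also have "\<dots> \<le> \<epsilon> / 2" using KN N1 \<epsilon> by (simp add: field_simps)
      finally show ?thesis unfolding p by simp
    qed
    have ne: "(0, 1) \<in> ?S" by simp
    have "(SUP p\<in>?S. ?g p) \<le> \<epsilon> / 2"
    proof (rule cSUP_least)
      show "?S \<noteq> {}" using ne by blast
    qed (rule b)
    moreover have "0 \<le> ?g (0, 1)" by simp
    moreover have "?g (0, 1) \<le> (SUP p\<in>?S. ?g p)"
    proof (rule cSUP_upper[OF ne])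
      show "bdd_above (?g ` ?S)" by (rule bdd_aboveI[of _ "\<epsilon> / 2"]) (use b in blast)
    qed
    ultimately show ?thesis unfolding discrepancy_visits using \<epsilon> by simp
  qed
  then show "\<exists>N0. \<forall>N\<ge>N0. norm (discrepancy (map (\<lambda>j. frac (real s ^ j * \<xi>)) [0..<N]) - 0) < \<epsilon>" by blast
qed

section \<open>Limits of admissible refinements\<close>

definition stage :: "nat \<Rightarrow> nat" where
  "stage Q = (LEAST k. Q < 2 ^ fact (Suc k))"

lemma stage_less: "Q < 2 ^ fact (Suc (stage Q))"
proof -
  have "Q < 2 ^ Q" by (rule less_exp)
  also have "(2::nat) ^ Q \<le> 2 ^ fact (Suc Q)"
    using fact_ge_self[of "Suc Q"] by (intro power_increasing) auto
  finally show ?thesis unfolding stage_def by (rule LeastI)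
qed

lemma stage_ge:
  assumes "Q \<ge> 2"
  shows "2 ^ fact (stage Q) \<le> Q" "stage Q \<ge> 1"
proof -
  have "stage Q \<noteq> 0"
  proof
    assume "stage Q = 0"
    then show False using stage_less[of Q] assms by simp
  qed
  then show "stage Q \<ge> 1" by simp
  then obtain k where k: "stage Q = Suc k" by (cases "stage Q") auto
  then have "\<not> Q < 2 ^ fact (Suc k)" using not_less_Least[of k "\<lambda>k. Q < 2 ^ fact (Suc k)"] by (simp add: stage_def)
  then show "2 ^ fact (stage Q) \<le> Q" using k by simp
qed

text \<open>The bad steps cover non-overlapping pieces of the line, all of them between
  \<open>c\<close> and the smaller of \<open>P n\<close> and \<open>d\<close>.\<close>

lemma zone_sum_le:
  fixes P :: "nat \<Rightarrow> real"
  assumes mono: "\<And>n. P n \<le> P (Suc n)" and zone: "\<And>i. i < n \<Longrightarrow> bad i \<Longrightarrow> c \<le> P i \<and> P (Suc i) \<le> d"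
  shows "(\<Sum>i<n. if bad i then P (Suc i) - P i else 0) \<le> max 0 (min (P n) d - c)"
  using zone
proof (induction n)
  case (Suc n)
  have IH: "(\<Sum>i<n. if bad i then P (Suc i) - P i else 0) \<le> max 0 (min (P n) d - c)"
    by (rule Suc.IH) (use Suc.prems in auto)
  show ?case
  proof (cases "bad n")
    case True
    then have "c \<le> P n" "P (Suc n) \<le> d" using Suc.prems[of n] by auto
    then show ?thesis using IH True mono[of n] by (simp add: max_def min_def split: if_splits)
  next
    case False
    then show ?thesis using IH mono[of n] by (simp add: max_def min_def split: if_splits)
  qed
qed simp

text \<open>The analysis is separated from the algorithm: whatever rule selects the modes
  \<open>M\<close> and the levels \<open>t\<close>, normality is read off the run alone.\<close>

locale refinement =
  fixes C Q M t :: "nat \<Rightarrow> nat" and \<xi> :: real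
  assumes adm: "\<And>n. admissible (M n) (t n) (C n) (Q n) (C (Suc n)) (Q (Suc n))"
    and Q_0: "Q 0 \<ge> 2"
    and t_unbounded: "\<And>T. \<exists>n0. \<forall>n\<ge>n0. T \<le> t n"
    and xi: "\<And>n. real (C n) / Q n \<le> \<xi>" "\<And>n. \<xi> \<le> (real (C n) + 1) / Q n"
begin

lemma Q_double: "2 * Q n \<le> Q (Suc n)" and Q_power: "Q (Suc n) ^ t n \<le> Q n ^ (t n + 1)"
  using adm[of n] by (auto simp: admissible_def)

lemma Q_lower: "2 ^ Suc n \<le> Q n"
proof (induction n)
  case (Suc n)
  then show ?case using Q_double[of n] by simp
qed (use Q_0 in simp)

lemma Q_ge: "Q n \<ge> 2"
proof -
  have "(2::nat) ^ 1 \<le> 2 ^ Suc n" by (intro power_increasing) auto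
  from order_trans[OF this Q_lower[of n]] show ?thesis by simp
qed

lemma Q_mono: "m \<le> n \<Longrightarrow> Q m \<le> Q n"
  by (rule lift_Suc_mono_le[of Q]) (use Q_double order_trans in \<open>fastforce intro: order_trans[OF _ Q_double]\<close>)+

lemma Q_unbounded: "\<exists>n0. \<forall>n\<ge>n0. K \<le> Q n"
proof -
  have "K \<le> Q n" if "n \<ge> K" for n
  proof -
    have "n < 2 ^ n" by (rule less_exp)
    moreover have "(2::nat) ^ n \<le> 2 ^ Suc n" by simp
    ultimately show ?thesis using Q_lower[of n] that by linarith
  qed
  then show ?thesis by blast
qed

definition \<Lambda> :: "nat \<Rightarrow> real" where "\<Lambda> n = log 2 (Q n)"

lemma Lam_step:
  assumes "t n \<ge> 1"
  shows "\<Lambda> (Suc n) \<le> \<Lambda> n * (1 + 1 / t n)"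
proof -
  have "real (Q (Suc n) ^ t n) \<le> real (Q n ^ (t n + 1))" using Q_power[of n] by (simp only: of_nat_le_iff)
  then have "log 2 (real (Q (Suc n)) ^ t n) \<le> log 2 (real (Q n) ^ (t n + 1))"
    using Q_ge[of n] Q_ge[of "Suc n"] by (simp only: of_nat_power, subst log_le_cancel_iff) auto
  moreover have "log 2 (real (Q (Suc n)) ^ t n) = t n * \<Lambda> (Suc n)" "log 2 (real (Q n) ^ (t n + 1)) = (t n + 1) * \<Lambda> n"
    unfolding \<Lambda>_def using Q_ge[of n] Q_ge[of "Suc n"] by (intro log_nat_power; linarith)+
  ultimately have "t n * \<Lambda> (Suc n) \<le> (t n + 1) * \<Lambda> n" by simp
  then have "\<Lambda> (Suc n) \<le> (t n + 1) * \<Lambda> n / t n" using assms by (simp add: field_simps)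
  also have "\<dots> = \<Lambda> n * (1 + 1 / t n)" using assms by (simp add: field_simps)
  finally show ?thesis .
qed

abbreviation P :: "nat \<Rightarrow> nat \<Rightarrow> nat" where "P s n \<equiv> flog s (Q n)"

lemma P_Lam:
  assumes s: "s \<ge> 2"
  shows "P s n * log 2 s \<le> \<Lambda> n" "\<Lambda> n < (P s n + 1) * log 2 s"
proof -
  have Q1: "Q n \<ge> 1" using Q_ge[of n] by simp
  have "real (s ^ P s n) \<le> real (Q n)" using flog(1)[OF s Q1] by (simp only: of_nat_le_iff)
  then have "log 2 (real s ^ P s n) \<le> log 2 (Q n)" using s Q1 by simp
  then show "P s n * log 2 s \<le> \<Lambda> n" using s by (simp add: \<Lambda>_def log_nat_power)
  have "real (Q n) < real (s ^ Suc (P s n))" using flog(2)[OF s Q1] by (simp only: of_nat_less_iff)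
  then have "log 2 (Q n) < log 2 (real s ^ Suc (P s n))" using s Q1 by (simp only: of_nat_power, subst log_less_cancel_iff) auto
  also have "\<dots> = (P s n + 1) * log 2 s" using s by (subst log_nat_power) (auto simp: algebra_simps)
  finally show "\<Lambda> n < (P s n + 1) * log 2 s" by (simp add: \<Lambda>_def)
qed

lemma log2_ge_1: "s \<ge> 2 \<Longrightarrow> log 2 (real s) \<ge> 1"
  by (simp add: le_log_iff)

lemma P_mono: "s \<ge> 2 \<Longrightarrow> m \<le> n \<Longrightarrow> P s m \<le> P s n"
  using flog_mono[of s "Q m" "Q n"] Q_ge[of m] Q_mono[of m n] by auto

lemma P_unbounded:
  assumes s: "s \<ge> 2"
  shows "\<exists>n. K < P s n"
proof -
  obtain n where "s ^ Suc (Suc K) \<le> Q n" using Q_unbounded by blast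
  also have "\<dots> < s ^ Suc (P s n)" using flog(2)[OF s, of "Q n"] Q_ge[of n] by simp
  finally have "Suc (Suc K) < Suc (P s n)" using s by (subst (asm) power_strict_increasing_iff) auto
  then have "K < P s n" by simp
  then show ?thesis by blast
qed

text \<open>A block adds only about the share \<open>1 / t n\<close> to the digits before it, and
  levels tend to infinity. So frequencies at the ends of blocks control those in between.\<close>

lemma P_step:
  assumes s: "s \<ge> 2" and t: "t n \<ge> 1"
  shows "real (P s (Suc n)) - P s n \<le> (P s n + 1) / t n + 1"
proof -
  have l: "log 2 (real s) > 0" using log2_ge_1[OF s] by linarith
  have "P s (Suc n) * log 2 s \<le> \<Lambda> n * (1 + 1 / t n)"
    using P_Lam(1)[OF s, of "Suc n"] Lam_step[OF t] by linarith
  also have "\<dots> \<le> (P s n + 1) * log 2 s * (1 + 1 / t n)"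
    using P_Lam(2)[OF s, of n] by (intro mult_right_mono) auto
  also have "\<dots> = (P s n + 1) * (1 + 1 / t n) * log 2 s" by simp
  finally have "real (P s (Suc n)) \<le> (P s n + 1) * (1 + 1 / t n)" using l by (subst (asm) mult_le_cancel_right_pos) auto
  then show ?thesis by (simp add: algebra_simps add_divide_distrib)
qed

lemma good_step:
  assumes s: "perfect_powerless s" "s \<le> t n" "s \<noteq> M n" and uv: "0 \<le> u" "u \<le> v" "v \<le> 1"
  shows "\<bar>real (card ({P s n..<P s (Suc n)} \<inter> visits \<xi> s u v)) - (v - u) * (real (P s (Suc n)) - real (P s n))\<bar>
     \<le> 10 / t n * (real (P s (Suc n)) - real (P s n))"
proof (rule good_visits)
  show "good s (t n) (Q n) (C (Suc n)) (Q (Suc n))" using adm[of n] s by (auto simp: admissible_def)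
  have "s \<ge> 2" using s by (simp add: perfect_powerless_def)
  then show "t n \<ge> 1" using s by simp
  show "Q (Suc n) \<ge> 1" using Q_ge[of "Suc n"] by simp
  show "P s n \<le> P s (Suc n)" using \<open>s \<ge> 2\<close> by (intro P_mono) auto
qed (use xi uv in auto)

text \<open>On these blocks admissibility promises nothing for base \<open>s\<close>, so their whole
  length is charged as error.\<close>

definition bad_length :: "nat \<Rightarrow> nat \<Rightarrow> real" where
  "bad_length s n = (\<Sum>i<n. if M i = s then real (P s (Suc i)) - real (P s i) else 0)"

lemma deviation_at_blocks:
  fixes u v \<delta> :: real
  assumes s: "perfect_powerless s" and uv: "0 \<le> u" "u \<le> v" "v \<le> 1"
    and n1: "\<And>n. n \<ge> n1 \<Longrightarrow> s \<le> t n \<and> 10 / t n \<le> \<delta>" and n: "n \<ge> n1"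
  shows "\<bar>real (card ({..<P s n} \<inter> visits \<xi> s u v)) - (v - u) * P s n\<bar> \<le> P s n1 + \<delta> * P s n + bad_length s n"
  using n
proof (induction n rule: dec_induct)
  case base
  have s2: "s \<ge> 2" using s by (simp add: perfect_powerless_def)
  have "0 \<le> 10 / real (t n1)" by simp
  also have "\<dots> \<le> \<delta>" using n1[of n1] by simp
  finally have d: "\<delta> \<ge> 0" .
  have b: "bad_length s n1 \<ge> 0" unfolding bad_length_def using P_mono[OF s2] by (intro sum_nonneg) auto
  have "card ({..<P s n1} \<inter> visits \<xi> s u v) \<le> card {..<P s n1}" by (intro card_mono) auto
  then have 1: "real (card ({..<P s n1} \<inter> visits \<xi> s u v)) \<le> P s n1" by simp
  have "(v - u) * P s n1 \<le> 1 * real (P s n1)" using uv by (intro mult_right_mono) auto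
  moreover have "0 \<le> (v - u) * P s n1" using uv by simp
  moreover have "0 \<le> \<delta> * P s n1" using d by simp
  ultimately show ?case using 1 b unfolding abs_le_iff by simp
next
  case (step n)
  have s2: "s \<ge> 2" using s by (simp add: perfect_powerless_def)
  define l where "l = real (P s (Suc n)) - real (P s n)"
  let ?c = "real (card ({P s n..<P s (Suc n)} \<inter> visits \<xi> s u v))"
  have le: "P s n \<le> P s (Suc n)" using s2 by (intro P_mono) auto
  then have l: "l \<ge> 0" by (simp add: l_def)
  have split: "real (card ({..<P s (Suc n)} \<inter> visits \<xi> s u v)) = real (card ({..<P s n} \<inter> visits \<xi> s u v)) + ?c"
  proof -
    have eq: "{..<P s (Suc n)} \<inter> visits \<xi> s u v = ({..<P s n} \<inter> visits \<xi> s u v) \<union> ({P s n..<P s (Suc n)} \<inter> visits \<xi> s u v)"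
      using le by auto
    have "card ({..<P s (Suc n)} \<inter> visits \<xi> s u v) = card ({..<P s n} \<inter> visits \<xi> s u v) + card ({P s n..<P s (Suc n)} \<inter> visits \<xi> s u v)"
      by (subst eq, rule card_Un_disjoint) auto
    then show ?thesis by simp
  qed
  have "\<bar>?c - (v - u) * l\<bar> \<le> \<delta> * l + (if M n = s then l else 0)"
  proof (cases "M n = s")
    case True
    have "card ({P s n..<P s (Suc n)} \<inter> visits \<xi> s u v) \<le> card {P s n..<P s (Suc n)}" by (intro card_mono) auto
    then have "?c \<le> real (card {P s n..<P s (Suc n)})" by (simp only: of_nat_le_iff)
    then have "?c \<le> l" using le by (simp add: l_def)
    moreover have "(v - u) * l \<le> 1 * l" using uv l by (intro mult_right_mono) auto
    moreover have "0 \<le> (v - u) * l" using uv l by simp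
    moreover have "0 \<le> \<delta> * l"
    proof -
      have "0 \<le> 10 / real (t n1)" by simp
      also have "\<dots> \<le> \<delta>" using n1[of n1] by simp
      finally show ?thesis using l by simp
    qed
    moreover have "0 \<le> ?c" by simp
    ultimately show ?thesis using True unfolding abs_le_iff by (simp del: of_nat_0_le_iff; linarith)
  next
    case False
    have "\<bar>?c - (v - u) * l\<bar> \<le> 10 / t n * l"
      unfolding l_def using n1[of n] step False by (intro good_step s uv) auto
    also have "\<dots> \<le> \<delta> * l" using n1[of n] step l by (intro mult_right_mono) auto
    finally show ?thesis using False by simp
  qed
  moreover have "bad_length s (Suc n) = bad_length s n + (if M n = s then l else 0)"
    by (simp add: bad_length_def l_def)
  moreover have "(v - u) * P s (Suc n) = (v - u) * P s n + (v - u) * l" "\<delta> * P s (Suc n) = \<delta> * P s n + \<delta> * l"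
    by (simp_all add: l_def algebra_simps)
  ultimately show ?case using step.IH split unfolding abs_le_iff by linarith
qed

lemma normal_if_bad_length_small:
  assumes s: "perfect_powerless s"
    and bad: "\<And>\<delta>::real. \<delta> > 0 \<Longrightarrow> \<exists>(K::real) n0. \<forall>n\<ge>n0. bad_length s n \<le> \<delta> * P s n + K"
  shows "normal_to_base \<xi> s"
proof (rule visits_imp_normal)
  fix \<epsilon> :: real assume \<epsilon>: "\<epsilon> > 0"
  have s2: "s \<ge> 2" using s by (simp add: perfect_powerless_def)
  \<comment> \<open>One third each for the good blocks, the bad blocks and the incomplete block at
    the end.\<close>
  define \<delta> where "\<delta> = \<epsilon> / 3"
  have \<delta>: "\<delta> > 0" using \<epsilon> by (simp add: \<delta>_def)
  obtain K n0 where K: "\<And>n. n \<ge> n0 \<Longrightarrow> bad_length s n \<le> \<delta> * P s n + K" using bad[OF \<delta>] by blast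
  define T where "T = s + Suc (nat \<lceil>10 / \<delta>\<rceil>)"
  obtain n0' where n0': "\<And>n. n \<ge> n0' \<Longrightarrow> T \<le> t n" using t_unbounded by blast
  define n1 where "n1 = max n0 n0'"
  have tn: "s \<le> t n \<and> 10 / t n \<le> \<delta> \<and> 1 \<le> t n" if "n \<ge> n1" for n
  proof -
    have T: "T \<le> t n" using n0' that by (simp add: n1_def)
    then have "10 / \<delta> \<le> t n" "t n \<ge> 1" unfolding T_def by linarith+
    then show ?thesis using \<delta> T by (simp add: T_def field_simps)
  qed
  have "\<bar>real (card ({..<N} \<inter> visits \<xi> s u v)) - (v - u) * N\<bar> \<le> \<epsilon> * N + (P s n1 + \<bar>K\<bar> + 1 + \<delta>)"
    if uv: "0 \<le> u" "u < v" "v \<le> 1" for N u v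
  proof (cases "N < P s n1")
    case True
    have "card ({..<N} \<inter> visits \<xi> s u v) \<le> card {..<N}" by (intro card_mono) auto
    then have "real (card ({..<N} \<inter> visits \<xi> s u v)) \<le> N" by simp
    moreover have "(v - u) * N \<le> 1 * real N" using uv by (intro mult_right_mono) auto
    moreover have "0 \<le> (v - u) * N" using uv by simp
    moreover have "0 \<le> \<epsilon> * N" using \<epsilon> by simp
    moreover have "real N \<le> P s n1" using True by simp
    moreover have "0 \<le> real (card ({..<N} \<inter> visits \<xi> s u v))" by simp
    ultimately show ?thesis using \<delta> unfolding abs_le_iff by linarith
  next
    case False
    obtain n' where n': "N < P s n'" using P_unbounded[OF s2] by blast
    define n where "n = (LEAST n. N < P s n) - 1"
    have L: "N < P s (LEAST n. N < P s n)" using n' by (rule LeastI)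
    have Lpos: "(LEAST n. N < P s n) > n1"
    proof (rule ccontr)
      assume "\<not> ?thesis"
      then have "P s (LEAST n. N < P s n) \<le> P s n1" using s2 by (intro P_mono) auto
      then show False using L False by simp
    qed
    then have n: "n \<ge> n1" "N < P s (Suc n)" using L by (auto simp: n_def)
    have "\<not> N < P s n" using Lpos by (intro not_less_Least) (auto simp: n_def)
    then have Pn: "P s n \<le> N" by simp
    have "real N - P s n \<le> real (P s (Suc n)) - P s n" using n by simp
    also have "\<dots> \<le> (P s n + 1) / t n + 1" using tn[OF n(1)] by (intro P_step s2) auto
    also have "\<dots> = (P s n + 1) * (1 / t n) + 1" by simp
    also have "\<dots> \<le> (N + 1) * \<delta> + 1"
    proof -
      have "1 / real (t n) \<le> 10 / t n" by (intro divide_right_mono) auto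
      then have "1 / real (t n) \<le> \<delta>" using tn[OF n(1)] by linarith
      then show ?thesis using Pn by (intro add_right_mono mult_mono) auto
    qed
    finally have gap: "real N - P s n \<le> \<delta> * N + \<delta> + 1" by (simp add: algebra_simps)
    have dev: "\<bar>real (card ({..<P s n} \<inter> visits \<xi> s u v)) - (v - u) * P s n\<bar> \<le> P s n1 + \<delta> * P s n + bad_length s n"
      by (rule deviation_at_blocks[OF s]) (use uv tn n in auto)
    have "bad_length s n \<le> \<delta> * P s n + K" using n by (intro K) (simp add: n1_def)
    moreover have "\<delta> * P s n \<le> \<delta> * N" using Pn \<delta> by (intro mult_left_mono) auto
    ultimately have dev': "\<bar>real (card ({..<P s n} \<inter> visits \<xi> s u v)) - (v - u) * P s n\<bar> \<le> P s n1 + 2 * (\<delta> * N) + \<bar>K\<bar>"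
      using dev by linarith
    let ?c = "real (card ({P s n..<N} \<inter> visits \<xi> s u v))"
    have eq: "{..<N} \<inter> visits \<xi> s u v = ({..<P s n} \<inter> visits \<xi> s u v) \<union> ({P s n..<N} \<inter> visits \<xi> s u v)"
      using Pn by auto
    have "card ({..<N} \<inter> visits \<xi> s u v) = card ({..<P s n} \<inter> visits \<xi> s u v) + card ({P s n..<N} \<inter> visits \<xi> s u v)"
      by (subst eq, rule card_Un_disjoint) auto
    then have split: "real (card ({..<N} \<inter> visits \<xi> s u v)) = real (card ({..<P s n} \<inter> visits \<xi> s u v)) + ?c" by simp
    have "card ({P s n..<N} \<inter> visits \<xi> s u v) \<le> card {P s n..<N}" by (intro card_mono) auto
    then have "?c \<le> real (card {P s n..<N})" by (simp only: of_nat_le_iff)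
    then have c: "?c \<le> real N - P s n" using Pn by simp
    have c0: "0 \<le> ?c" by simp
    have aux: "\<bar>x + c - (y + z)\<bar> \<le> e + (a + k + 1 + \<delta>)"
      if "\<bar>x - y\<bar> \<le> a + 2 * d + k" "0 \<le> c" "c \<le> g" "0 \<le> z" "z \<le> 1 * g" "g \<le> d + \<delta> + 1" "e = 3 * d" for x y z c e a k d g :: real
      using that unfolding abs_le_iff by linarith
    have z2: "(v - u) * (real N - P s n) \<le> 1 * (real N - P s n)" using uv Pn by (intro mult_right_mono) auto
    have z1: "0 \<le> (v - u) * (real N - P s n)" using uv Pn by simp
    have z3: "(v - u) * N = (v - u) * P s n + (v - u) * (real N - P s n)" by (simp add: algebra_simps)
    have z4: "\<epsilon> * N = 3 * (\<delta> * N)" by (simp add: \<delta>_def)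
    show ?thesis unfolding split z3 by (rule aux[OF dev' c0 c z1 z2 gap z4])
  qed
  then show "\<exists>K. \<forall>N u v. 0 \<le> u \<and> u < v \<and> v \<le> 1 \<longrightarrow>
     \<bar>real (card ({..<N} \<inter> visits \<xi> s u v)) - (v - u) * N\<bar> \<le> \<epsilon> * N + K" by blast
qed

end

section \<open>Requested modes and factorial zones\<close>

context refinement
begin

lemma Lam_less_P:
  assumes "s \<ge> 2"
  shows "\<Lambda> n < (real (P s n) + 1) * log 2 s"
  using P_Lam(2)[OF assms, of n] by (simp add: add.commute)

lemma stage_Lam: "fact (stage (Q n)) \<le> \<Lambda> n" "\<Lambda> n < fact (Suc (stage (Q n)))" "stage (Q n) \<ge> 1"
proof -
  have Q2: "Q n \<ge> 2" by (rule Q_ge)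
  show "fact (stage (Q n)) \<le> \<Lambda> n"
    using le_log2_of_power[OF stage_ge(1)[OF Q2]] by (simp add: \<Lambda>_def)
  show "\<Lambda> n < fact (Suc (stage (Q n)))"
    using log2_of_power_less[OF stage_less[of "Q n"]] Q2 unfolding \<Lambda>_def by (simp only: of_nat_fact)
  show "stage (Q n) \<ge> 1" by (rule stage_ge(2)[OF Q2])
qed

lemma Lam_stageI:
  assumes "fact k \<le> \<Lambda> n" "\<Lambda> n < fact (Suc k)"
  shows "stage (Q n) = k"
proof -
  have "\<not> stage (Q n) < k"
  proof
    assume "stage (Q n) < k"
    then have "fact (Suc (stage (Q n))) \<le> (fact k :: real)" by (intro fact_mono) auto
    then show False using assms stage_Lam(2)[of n] by linarith
  qed
  moreover have "\<not> k < stage (Q n)"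
  proof
    assume "k < stage (Q n)"
    then have "fact (Suc k) \<le> (fact (stage (Q n)) :: real)" by (intro fact_mono) auto
    then show False using assms stage_Lam(1)[of n] by linarith
  qed
  ultimately show ?thesis by simp
qed

lemma Lam_mono: "m \<le> n \<Longrightarrow> \<Lambda> m \<le> \<Lambda> n"
  unfolding \<Lambda>_def using Q_ge[of m] Q_ge[of n] Q_mono[of m n] by simp

lemma stage_mono: 
  assumes "m \<le> n" shows "stage (Q m) \<le> stage (Q n)"
proof (rule ccontr)
  assume "\<not> ?thesis"
  then have "fact (Suc (stage (Q n))) \<le> (fact (stage (Q m)) :: real)" by (intro fact_mono) auto
  then show False using stage_Lam(1)[of m] stage_Lam(2)[of n] Lam_mono[OF assms] by linarith
qed

lemma stage_unbounded: "\<exists>n0. \<forall>n\<ge>n0. k \<le> stage (Q n)"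
proof -
  obtain n0 where n0: "\<And>n. n \<ge> n0 \<Longrightarrow> 2 ^ fact (Suc k) \<le> Q n" using Q_unbounded by blast
  have "k \<le> stage (Q n)" if "n \<ge> n0" for n
  proof (rule ccontr)
    assume "\<not> k \<le> stage (Q n)"
    then have "fact (Suc (stage (Q n))) \<le> (fact (Suc k) :: nat)" by (intro fact_mono_nat) auto
    then have "(2::nat) ^ fact (Suc (stage (Q n))) \<le> 2 ^ fact (Suc k)" by (intro power_increasing) auto
    then show False using n0[OF that] stage_less[of "Q n"] by linarith
  qed
  then show ?thesis by blast
qed

text \<open>Steps in mode \<open>s\<close> are split into those before \<open>n0\<close>, those of
  earlier stages and those of the current stage \<open>k\<close>. With \<open>l = log 2 s\<close>,
  the second kind ends below \<open>4 * (k-1)! / l\<close>, a share of order \<open>1/k\<close> of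
  the digits; the third is a share of about \<open>3 * y\<close>, small for large
  \<open>X\<close>.\<close>

lemma normal_if_zones_shrink:
  assumes s: "perfect_powerless s"
    and zone: "\<And>X::nat. \<exists>k0. \<forall>n. M n = s \<longrightarrow> k0 \<le> stage (Q n) \<longrightarrow> \<Lambda> n \<le> fact (stage (Q n)) * (1 + 1 / (real X + 1))"
  shows "normal_to_base \<xi> s"
proof (rule normal_if_bad_length_small[OF s])
  fix \<delta> :: real assume \<delta>: "\<delta> > 0"
  have s2: "s \<ge> 2" using s by (simp add: perfect_powerless_def)
  define l where "l = log 2 (real s)"
  have l: "l \<ge> 1" unfolding l_def using s2 by (rule log2_ge_1)
  \<comment> \<open>Gives \<open>3 * y \<le> \<delta> / 2\<close> for the current stage; likewise
    the \<open>8 / \<delta>\<close> in \<open>k1\<close> gives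
    \<open>4 / k \<le> \<delta> / 2\<close> for the earlier ones.\<close>
  define X where "X = nat \<lceil>6 / \<delta>\<rceil>"
  define y where "y = 1 / (real X + 1)"
  have y: "0 < y" "y \<le> 1" by (auto simp: y_def)
  have "6 / \<delta> \<le> real X" unfolding X_def by linarith
  then have "6 / \<delta> \<le> real X + 1" by linarith
  then have y\<delta>: "3 * y \<le> \<delta> / 2" using \<delta> by (simp add: y_def field_simps)
  obtain k0 where k0: "\<And>n. M n = s \<Longrightarrow> k0 \<le> stage (Q n) \<Longrightarrow> \<Lambda> n \<le> fact (stage (Q n)) * (1 + y)"
    using zone[of X] unfolding y_def by blast
  define k1 where "k1 = k0 + Suc (nat \<lceil>8 / \<delta>\<rceil>)"
  obtain n1 where n1: "\<And>n. n \<ge> n1 \<Longrightarrow> k1 \<le> stage (Q n)" using stage_unbounded by blast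
  obtain n2 where n2: "\<And>n. n \<ge> n2 \<Longrightarrow> X + 1 \<le> t n" using t_unbounded by blast
  define n0 where "n0 = max n1 n2"
  let ?P = "\<lambda>n. real (P s n)"
  have mono: "?P n \<le> ?P (Suc n)" for n using P_mono[OF s2, of n "Suc n"] by simp
  have bad: "fact (stage (Q i)) / l - 1 \<le> ?P i \<and> ?P (Suc i) \<le> fact (stage (Q i)) * (1 + 3 * y) / l"
    if i: "i \<ge> n0" "M i = s" for i
  proof
    have L: "\<Lambda> i \<le> fact (stage (Q i)) * (1 + y)" using i n1[of i] by (intro k0) (auto simp: n0_def k1_def)
    have tX: "X + 1 \<le> t i" using i n2[of i] by (simp add: n0_def)
    have "fact (stage (Q i)) < (?P i + 1) * l" using stage_Lam(1)[of i] Lam_less_P[OF s2, of i] unfolding l_def by linarith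
    then have "fact (stage (Q i)) / l < ?P i + 1" using l by (simp add: divide_less_eq)
    then show "fact (stage (Q i)) / l - 1 \<le> ?P i" by simp
    have ty: "1 / real (t i) \<le> y" unfolding y_def using tX by (intro divide_left_mono) auto
    have "?P (Suc i) * l \<le> \<Lambda> (Suc i)" using P_Lam(1)[OF s2, of "Suc i"] unfolding l_def .
    also have "\<dots> \<le> \<Lambda> i * (1 + 1 / t i)" using tX by (intro Lam_step) simp
    \<comment> \<open>The last step may leave the zone by a factor
      \<open>1 + 1 / t i \<le> 1 + y\<close>, which turns \<open>1 + y\<close> into at most
      \<open>1 + 3 * y\<close>.\<close>
    also have "\<dots> \<le> (fact (stage (Q i)) * (1 + y)) * (1 + y)" using L ty y by (intro mult_mono) auto
    also have "\<dots> = fact (stage (Q i)) * ((1 + y) * (1 + y))" by simp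
    also have "\<dots> \<le> fact (stage (Q i)) * (1 + 3 * y)"
    proof (intro mult_left_mono)
      have "y * y \<le> 1 * y" using y by (intro mult_right_mono) auto
      then show "(1 + y) * (1 + y) \<le> 1 + 3 * y" by (simp add: algebra_simps)
    qed simp
    finally show "?P (Suc i) \<le> fact (stage (Q i)) * (1 + 3 * y) / l" using l by (simp add: le_divide_eq)
  qed
  have "bad_length s n \<le> \<delta> * ?P n + (?P n0 + 1 + \<delta>)" if n: "n \<ge> n0" for n
  proof -
    define k where "k = stage (Q n)"
    have "k1 \<le> k" unfolding k_def using n by (intro n1) (simp add: n0_def)
    then have "8 / \<delta> \<le> real k" "k \<ge> 1" unfolding k1_def by linarith+
    then have k\<delta>: "4 / real k \<le> \<delta> / 2" using \<delta> by (simp add: field_simps)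
    obtain k' where k': "k = Suc k'" using \<open>k \<ge> 1\<close> by (cases k) auto
    define b1 where "b1 i \<longleftrightarrow> i < n0 \<and> M i = s" for i
    define b2 where "b2 i \<longleftrightarrow> n0 \<le> i \<and> M i = s \<and> stage (Q i) < k" for i
    define b3 where "b3 i \<longleftrightarrow> n0 \<le> i \<and> M i = s \<and> stage (Q i) = k" for i
    define S where "S b = (\<Sum>i<n. if b i then ?P (Suc i) - ?P i else 0)" for b :: "nat \<Rightarrow> bool"
    have "bad_length s n = (\<Sum>i<n. (if b1 i then ?P (Suc i) - ?P i else 0) + (if b2 i then ?P (Suc i) - ?P i else 0) + (if b3 i then ?P (Suc i) - ?P i else 0))"
      unfolding bad_length_def
    proof (intro sum.cong refl)
      fix i assume "i \<in> {..<n}"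
      then have "stage (Q i) \<le> k" unfolding k_def by (intro stage_mono) auto
      then show "(if M i = s then ?P (Suc i) - ?P i else 0)
        = (if b1 i then ?P (Suc i) - ?P i else 0) + (if b2 i then ?P (Suc i) - ?P i else 0) + (if b3 i then ?P (Suc i) - ?P i else 0)"
        by (auto simp: b1_def b2_def b3_def)
    qed
    then have tot: "bad_length s n = S b1 + S b2 + S b3" by (simp add: S_def sum.distrib)
    have "S b1 \<le> max 0 (min (?P n) (?P n0) - 0)"
      unfolding S_def
    proof (rule zone_sum_le[where P = ?P, OF mono])
      fix i assume "b1 i"
      then show "0 \<le> ?P i \<and> ?P (Suc i) \<le> ?P n0" using P_mono[OF s2, of "Suc i" n0] by (simp add: b1_def)
    qed
    then have 1: "S b1 \<le> ?P n0" by simp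
    have fk: "fact k / l \<le> ?P n + 1"
    proof -
      have "fact k < (?P n + 1) * l" using stage_Lam(1)[of n] Lam_less_P[OF s2, of n] unfolding l_def k_def by linarith
      then show ?thesis using l by (simp add: divide_le_eq)
    qed
    have "S b2 \<le> max 0 (min (?P n) (4 * fact k' / l) - 0)"
      unfolding S_def
    proof (rule zone_sum_le[where P = ?P, OF mono])
      fix i assume b: "b2 i"
      then have "?P (Suc i) \<le> fact (stage (Q i)) * (1 + 3 * y) / l" using bad[of i] by (simp add: b2_def)
      also have "\<dots> \<le> fact k' * 4 / l"
        using b y l k' by (intro divide_right_mono mult_mono fact_mono) (auto simp: b2_def)
      finally show "0 \<le> ?P i \<and> ?P (Suc i) \<le> 4 * fact k' / l" by (simp add: mult.commute)
    qed
    also have "\<dots> \<le> 4 * fact k' / l" using l by simp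
    also have "\<dots> = 4 / real k * (fact k / l)" using k' by simp
    also have "\<dots> \<le> \<delta> / 2 * (?P n + 1)" using k\<delta> fk l \<delta> by (intro mult_mono) auto
    finally have 2: "S b2 \<le> \<delta> / 2 * (?P n + 1)" .
    have "S b3 \<le> max 0 (min (?P n) (fact k * (1 + 3 * y) / l) - (fact k / l - 1))"
      unfolding S_def
    proof (rule zone_sum_le[where P = ?P, OF mono])
      fix i assume "b3 i"
      then show "fact k / l - 1 \<le> ?P i \<and> ?P (Suc i) \<le> fact k * (1 + 3 * y) / l" using bad[of i] by (simp add: b3_def)
    qed
    also have "\<dots> \<le> 3 * y * (fact k / l) + 1"
    proof -
      have "fact k * (1 + 3 * y) / l = fact k / l + 3 * y * (fact k / l)" by (simp add: distrib_left add_divide_distrib)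
      moreover have "0 \<le> 3 * y * (fact k / l)" using y l by simp
      ultimately show ?thesis by (simp add: max_def min_def)
    qed
    also have "3 * y * (fact k / l) \<le> \<delta> / 2 * (?P n + 1)" using y\<delta> fk l y \<delta> by (intro mult_mono) auto
    finally have 3: "S b3 \<le> \<delta> / 2 * (?P n + 1) + 1" by simp
    have "\<delta> / 2 * (?P n + 1) + \<delta> / 2 * (?P n + 1) = \<delta> * ?P n + \<delta>" by (simp add: algebra_simps)
    then show ?thesis using tot 1 2 3 by linarith
  qed
  then show "\<exists>K n0. \<forall>n\<ge>n0. bad_length s n \<le> \<delta> * real (P s n) + K" by blast
qed

lemma biased_step:
  assumes "r \<ge> 2" "M n = r"
  shows "3 * (real (P r (Suc n)) - P r n) \<le> 5 * real (card ({P r n..<P r (Suc n)} \<inter> visits \<xi> r 0 (1 / r)))"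
proof -
  have "biased r (Q n) (C (Suc n)) (Q (Suc n))" using adm[of n] assms by (auto simp: admissible_def)
  then have "3 * (P r (Suc n) - P r n) \<le> 5 * card ({P r n..<P r (Suc n)} \<inter> visits \<xi> r 0 (1 / r))"
    by (rule biased_visits[OF _ assms(1)]) (use Q_ge[of "Suc n"] xi in auto)
  then have "real (3 * (P r (Suc n) - P r n)) \<le> real (5 * card ({P r n..<P r (Suc n)} \<inter> visits \<xi> r 0 (1 / r)))"
    by (simp only: of_nat_le_iff)
  then show ?thesis using P_mono[OF assms(1), of n "Suc n"] by simp
qed

text \<open>Compare the zeros at both ends of a long zone. Normality allows about
  \<open>1 / r \<le> 1/2\<close> of the digits up to either end, whereas inside the zone at least
  3/5 are 0. Hence the zone would have to be shorter than the fixed share that it actually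
  takes.\<close>

lemma not_normal_if_zones_recur:
  fixes x :: nat
  assumes r: "r \<ge> 2"
    and recur: "\<And>k0. \<exists>k\<ge>k0. \<forall>i. stage (Q i) = k \<longrightarrow> \<Lambda> i < fact k * (1 + 1 / (real x + 1)) \<longrightarrow> M i = r"
  shows "\<not> normal_to_base \<xi> r"
proof
  assume nm: "normal_to_base \<xi> r"
  define y where "y = 1 / (real x + 1)"
  have y: "0 < y" "y \<le> 1" by (auto simp: y_def)
  define l where "l = log 2 (real r)"
  have l: "l \<ge> 1" unfolding l_def using r by (rule log2_ge_1)
  define V where "V = visits \<xi> r 0 (1 / r)"
  \<comment> \<open>The gap \<open>3/5 - 1/2\<close> against two errors of
    \<open>\<epsilon> * p2\<close> gives
    \<open>p2 - p1 \<le> 20 * \<epsilon> * p2 = p2 * y / 8\<close>. Up to rounding,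
    \<open>p2\<close> is at least \<open>F * (1 + y)\<close> and \<open>p1\<close> at most
    \<open>F * (1 + y / 2)\<close>, but
    \<open>(1 + y) * (1 - y / 8) \<ge> 1 + 3/4 * y\<close>.\<close>
  define \<epsilon> where "\<epsilon> = y / 160"
  have \<epsilon>: "\<epsilon> > 0" using y by (simp add: \<epsilon>_def)
  have uv: "0 \<le> (0::real)" "0 < 1 / real r" "1 / real r \<le> 1" using r by auto
  obtain N0 where N0: "\<And>N. N \<ge> N0 \<Longrightarrow> \<bar>real (card ({..<N} \<inter> V)) - (1 / r - 0) * N\<bar> \<le> \<epsilon> * N"
    using normal_imp_visits[OF nm uv \<epsilon>] unfolding V_def by blast
  obtain n1 where n1: "N0 < P r n1" using P_unbounded[OF r] by blast
  \<comment> \<open>\<open>1 / T = y / 2\<close>: the step that enters the zone overshoots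
    \<open>k!\<close> by at most half the width of the zone.\<close>
  define T where "T = 2 * (x + 1)"
  obtain n2 where n2: "\<And>n. n \<ge> n2 \<Longrightarrow> T \<le> t n" using t_unbounded by blast
  define n0 where "n0 = max n1 n2"
  \<comment> \<open>\<open>k\<close> must exceed the stage of \<open>n0\<close>, so that
    \<open>i1\<close> comes after \<open>n0\<close>, and also \<open>4 * l / y\<close>, so that a
    rounding error of 1 is less than \<open>F * y / 4\<close>.\<close>
  define k0 where "k0 = Suc (stage (Q n0)) + nat \<lceil>4 * l / y\<rceil> + 1"
  obtain k where k: "k \<ge> k0" and kM: "\<And>i. stage (Q i) = k \<Longrightarrow> \<Lambda> i < fact k * (1 + y) \<Longrightarrow> M i = r"
    using recur[of k0] unfolding y_def by blast
  define F where "F = fact k / l"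
  have Fy: "F * y / 4 > 1"
  proof -
    have "4 * l / y < real k" using k unfolding k0_def by linarith
    also have "real k \<le> fact k" using fact_ge_self[of k] by (metis of_nat_fact of_nat_le_iff)
    finally have "4 * l < fact k * y" using y by (simp add: divide_less_eq)
    then show ?thesis using l by (simp add: F_def field_simps)
  qed
  have ex1: "\<exists>i. fact k \<le> \<Lambda> i" and ex2: "\<exists>i. fact k * (1 + y) \<le> \<Lambda> i"
  proof -
    obtain i where i: "Suc (Suc k) \<le> stage (Q i)" using stage_unbounded by blast
    have "fact k * (1 + y) \<le> fact k * (real (Suc k) + 1)" using y by (intro mult_left_mono) auto
    also have "\<dots> \<le> (fact (Suc (Suc k)) :: real)" by (simp add: algebra_simps)
    also have "\<dots> \<le> fact (stage (Q i))" using i by (intro fact_mono) auto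
    also have "\<dots> \<le> \<Lambda> i" by (rule stage_Lam(1))
    finally have *: "fact k * (1 + y) \<le> \<Lambda> i" .
    then show "\<exists>i. fact k * (1 + y) \<le> \<Lambda> i" by blast
    have "fact k * 1 \<le> (fact k :: real) * (1 + y)" using y by (intro mult_left_mono) auto
    then have "fact k \<le> \<Lambda> i" using * by linarith
    then show "\<exists>i. fact k \<le> \<Lambda> i" by blast
  qed
  define i1 where "i1 = (LEAST i. fact k \<le> \<Lambda> i)"
  define i2 where "i2 = (LEAST i. fact k * (1 + y) \<le> \<Lambda> i)"
  have i1: "fact k \<le> \<Lambda> i1" unfolding i1_def using ex1 by (rule LeastI_ex)
  have i2: "fact k * (1 + y) \<le> \<Lambda> i2" unfolding i2_def using ex2 by (rule LeastI_ex)
  have i2': "\<Lambda> i < fact k * (1 + y)" if "i < i2" for i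
    using not_less_Least[of i "\<lambda>i. fact k * (1 + y) \<le> \<Lambda> i"] that unfolding i2_def by linarith
  have "\<Lambda> n0 < fact (Suc (stage (Q n0)))" by (rule stage_Lam(2))
  also have "\<dots> \<le> (fact k :: real)" using k unfolding k0_def by (intro fact_mono) auto
  finally have L0: "\<Lambda> n0 < fact k" .
  have n0i1: "n0 < i1"
  proof (rule ccontr)
    assume "\<not> n0 < i1"
    then show False using Lam_mono[of i1 n0] i1 L0 by linarith
  qed
  then obtain i0 where i0: "i1 = Suc i0" "i0 \<ge> n0" by (cases i1) auto
  have "\<not> fact k \<le> \<Lambda> i0" using i0 by (intro not_less_Least) (simp add: i1_def[symmetric])
  then have Li0: "\<Lambda> i0 < fact k" by simp
  have Ti0: "T \<le> t i0" using n2[of i0] i0 by (simp add: n0_def)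
  have ty: "1 / real (t i0) \<le> y / 2"
  proof -
    have "real T \<le> real (t i0)" using Ti0 by (simp only: of_nat_le_iff)
    moreover have "0 < real T" by (simp add: T_def)
    ultimately have "1 / real (t i0) \<le> 1 / T" by (intro divide_left_mono) auto
    also have "1 / real T = y / 2" by (simp add: T_def y_def field_simps)
    finally show ?thesis .
  qed
  have "\<Lambda> i1 \<le> \<Lambda> i0 * (1 + 1 / t i0)" unfolding i0(1) using Ti0 by (intro Lam_step) (simp add: T_def)
  also have "\<dots> \<le> fact k * (1 + y / 2)" using Li0 ty y by (intro mult_mono) auto
  finally have Li1: "\<Lambda> i1 \<le> fact k * (1 + y / 2)" .
  have i12: "i1 \<le> i2"
  proof (rule ccontr)
    assume "\<not> i1 \<le> i2"
    then have "\<Lambda> i2 \<le> \<Lambda> i0" using i0 by (intro Lam_mono) auto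
    moreover have "fact k * 1 \<le> (fact k :: real) * (1 + y)" using y by (intro mult_left_mono) auto
    ultimately show False using i2 Li0 by linarith
  qed
  have Mr: "M i = r" if "i1 \<le> i" "i < i2" for i
  proof (rule kM)
    show "\<Lambda> i < fact k * (1 + y)" by (rule i2'[OF that(2)])
    have "fact k \<le> \<Lambda> i" using i1 Lam_mono[OF that(1)] by linarith
    moreover have "\<Lambda> i < fact (Suc k)"
    proof -
      have "k \<ge> 1" using k by (simp add: k0_def)
      have "\<Lambda> i < fact k * (1 + y)" by (rule i2'[OF that(2)])
      also have "\<dots> \<le> fact k * (real k + 1)" using y \<open>k \<ge> 1\<close> by (intro mult_left_mono) auto
      also have "\<dots> = fact (Suc k)" by (simp add: algebra_simps)
      finally show ?thesis .
    qed
    ultimately show "stage (Q i) = k" by (rule Lam_stageI)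
  qed
  have sum: "3 * (real (P r j) - P r i1) \<le> 5 * (real (card ({..<P r j} \<inter> V)) - real (card ({..<P r i1} \<inter> V)))"
    if "i1 \<le> j" "j \<le> i2" for j
    using that
  proof (induction j rule: dec_induct)
    case (step j)
    have le: "P r j \<le> P r (Suc j)" using r by (intro P_mono) auto
    have eq: "{..<P r (Suc j)} \<inter> V = ({..<P r j} \<inter> V) \<union> ({P r j..<P r (Suc j)} \<inter> V)" using le by auto
    have "card ({..<P r (Suc j)} \<inter> V) = card ({..<P r j} \<inter> V) + card ({P r j..<P r (Suc j)} \<inter> V)"
      by (subst eq, rule card_Un_disjoint) auto
    moreover have "3 * (real (P r (Suc j)) - P r j) \<le> 5 * real (card ({P r j..<P r (Suc j)} \<inter> V))"
      unfolding V_def using step by (intro biased_step r Mr) auto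
    ultimately show ?case using step by simp
  qed simp
  define p1 where "p1 = real (P r i1)"
  define p2 where "p2 = real (P r i2)"
  have "N0 \<le> P r i1" using n1 P_mono[OF r, of n1 i1] n0i1 by (simp add: n0_def)
  then have N1: "N0 \<le> P r i1" "N0 \<le> P r i2" using P_mono[OF r i12] by auto
  have p12: "p1 \<le> p2" unfolding p1_def p2_def using P_mono[OF r i12] by simp
  have p1: "p1 \<ge> 0" by (simp add: p1_def)
  have c: "3 * (p2 - p1) \<le> 5 * (real (card ({..<P r i2} \<inter> V)) - real (card ({..<P r i1} \<inter> V)))"
    using sum[OF i12] by (simp add: p1_def p2_def)
  have d1: "\<bar>real (card ({..<P r i1} \<inter> V)) - p1 / r\<bar> \<le> \<epsilon> * p1" using N0[OF N1(1)] by (simp add: p1_def)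
  have d2: "\<bar>real (card ({..<P r i2} \<inter> V)) - p2 / r\<bar> \<le> \<epsilon> * p2" using N0[OF N1(2)] by (simp add: p2_def)
  have "\<epsilon> * p1 \<le> \<epsilon> * p2" using p12 \<epsilon> by (intro mult_left_mono) auto
  moreover have "p2 / r - p1 / r \<le> (p2 - p1) / 2"
  proof -
    have "(p2 - p1) / r \<le> (p2 - p1) / 2" using p12 r by (intro divide_left_mono) auto
    then show ?thesis by (simp add: diff_divide_distrib)
  qed
  moreover have "p2 / r - \<epsilon> * p2 \<le> real (card ({..<P r i2} \<inter> V))" "real (card ({..<P r i2} \<inter> V)) \<le> p2 / r + \<epsilon> * p2"
    "p1 / r - \<epsilon> * p1 \<le> real (card ({..<P r i1} \<inter> V))"
    using d1 d2 by (auto simp: abs_le_iff)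
  moreover have "p2 - p1 \<le> 20 * e"
    if "f \<le> e" "q2 - q1 \<le> (p2 - p1) / 2" "A2 \<le> q2 + e" "q1 - f \<le> A1" "3 * (p2 - p1) \<le> 5 * (A2 - A1)" for e f q1 q2 A1 A2 :: real
    using that by (simp add: field_simps)
  ultimately have "p2 - p1 \<le> 20 * (\<epsilon> * p2)" using c by blast
  also have "\<dots> = p2 * (y / 8)" by (simp add: \<epsilon>_def)
  finally have "p2 - p1 \<le> p2 * (y / 8)" .
  then have P1: "p2 * (1 - y / 8) \<le> p1" by (simp add: algebra_simps)
  have P2: "F * (1 + y) - 1 \<le> p2"
  proof -
    have "fact k * (1 + y) < (p2 + 1) * l" using i2 Lam_less_P[OF r, of i2] unfolding l_def p2_def by linarith
    then have "fact k * (1 + y) / l < p2 + 1" using l by (simp add: divide_less_eq)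
    then show ?thesis by (simp add: F_def)
  qed
  have P3: "p1 \<le> F * (1 + y / 2)"
  proof -
    have "p1 * l \<le> fact k * (1 + y / 2)" using Li1 P_Lam(1)[OF r, of i1] unfolding l_def p1_def by linarith
    then have "p1 \<le> fact k * (1 + y / 2) / l" using l by (simp add: le_divide_eq)
    then show ?thesis by (simp add: F_def)
  qed
  have F0: "F > 0" using l by (simp add: F_def)
  have "(F * (1 + y) - 1) * (1 - y / 8) \<le> p2 * (1 - y / 8)" using P2 y by (intro mult_right_mono) auto
  then have a: "(F * (1 + y) - 1) * (1 - y / 8) \<le> F * (1 + y / 2)" using P1 P3 by linarith
  have "(1 + y) * (1 - y / 8) = 1 + y - y / 8 - y * y / 8" by (simp add: field_simps)
  moreover have "y * y \<le> 1 * y" using y by (intro mult_right_mono) auto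
  ultimately have "1 + y * (3 / 4) \<le> (1 + y) * (1 - y / 8)" by linarith
  then have "F * (1 + y * (3 / 4)) \<le> F * ((1 + y) * (1 - y / 8))" using F0 by (intro mult_left_mono) auto
  moreover have "(F * (1 + y) - 1) * (1 - y / 8) = F * ((1 + y) * (1 - y / 8)) - (1 - y / 8)" by (simp add: left_diff_distrib mult.assoc)
  ultimately have "F * (1 + y * (3 / 4)) - 1 \<le> F * (1 + y / 2)" using a y by linarith
  then have "F * y / 4 \<le> 1" by (simp add: algebra_simps)
  then show False using Fy by linarith
qed

end

section \<open>Closure properties of computable functions\<close>

text \<open>An intermediate notion: programs carry no arity, so it is supplied as the length of the
  argument list. Once pairing is available, functions of one argument take over.\<close>

definition list_computable :: "nat \<Rightarrow> (nat list \<Rightarrow> nat) \<Rightarrow> bool" where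
  "list_computable k f \<longleftrightarrow> (\<exists>p. \<forall>xs. length xs = k \<longrightarrow> evals p xs (f xs))"

lemma list_computable_cong:
  assumes "list_computable k f" "\<And>xs. length xs = k \<Longrightarrow> f xs = g xs"
  shows "list_computable k g"
  using assms unfolding list_computable_def by metis

lemma list_computable_zero: "list_computable k (\<lambda>_. 0)"
  unfolding list_computable_def by (blast intro: evals.Zero)

lemma list_computable_nth: "i < k \<Longrightarrow> list_computable k (\<lambda>xs. xs ! i)"
  unfolding list_computable_def by (auto intro: evals.Proj)

lemma list_computable_comp:
  assumes "list_computable (length gs) f" "\<And>g. g \<in> set gs \<Longrightarrow> list_computable k g"
  shows "list_computable k (\<lambda>xs. f (map (\<lambda>g. g xs) gs))"
proof -
  obtain p where p: "\<And>xs. length xs = length gs \<Longrightarrow> evals p xs (f xs)"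
    using assms(1) unfolding list_computable_def by blast
  have "\<forall>g\<in>set gs. \<exists>q. \<forall>xs. length xs = k \<longrightarrow> evals q xs (g xs)"
    using assms(2) unfolding list_computable_def by blast
  then obtain q where q: "\<And>g xs. g \<in> set gs \<Longrightarrow> length xs = k \<Longrightarrow> evals (q g) xs (g xs)" by metis
  have "evals (Comp p (map q gs)) xs (f (map (\<lambda>g. g xs) gs))" if "length xs = k" for xs
    by (rule evals.Comp[of "map (\<lambda>g. g xs) gs"]) (use p q that in auto)
  then show ?thesis unfolding list_computable_def by blast
qed

lemma list_computable_comp1:
  assumes "list_computable 1 (\<lambda>xs. f (xs ! 0))" "list_computable k g"
  shows "list_computable k (\<lambda>xs. f (g xs))"
  using list_computable_comp[of "[g]" "\<lambda>xs. f (xs ! 0)" k] assms by simp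

lemma list_computable_comp2:
  assumes "list_computable 2 (\<lambda>xs. f (xs ! 0) (xs ! 1))" "list_computable k g" "list_computable k h"
  shows "list_computable k (\<lambda>xs. f (g xs) (h xs))"
  using list_computable_comp[of "[g, h]" "\<lambda>xs. f (xs ! 0) (xs ! 1)" k] assms by (auto simp: numeral_2_eq_2)

lemma list_computable_Suc: "list_computable k g \<Longrightarrow> list_computable k (\<lambda>xs. Suc (g xs))"
proof (rule list_computable_comp1[of Suc])
  have "evals Succ xs (Suc (xs ! 0))" if "length xs = 1" for xs
    using that by (cases xs) (auto intro: evals.Succ)
  then show "list_computable 1 (\<lambda>xs. Suc (xs ! 0))" unfolding list_computable_def by blast
qed

lemma list_computable_const: "list_computable k (\<lambda>_. c)"
  by (induction c) (auto intro: list_computable_zero list_computable_Suc)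

lemma list_computable_rec:
  assumes "list_computable k f" "list_computable (Suc (Suc k)) g"
  shows "list_computable (Suc k) (\<lambda>xs. rec_nat (f (tl xs)) (\<lambda>n y. g (n # y # tl xs)) (hd xs))"
proof -
  obtain p q where p: "\<And>xs. length xs = k \<Longrightarrow> evals p xs (f xs)"
    and q: "\<And>xs. length xs = Suc (Suc k) \<Longrightarrow> evals q xs (g xs)"
    using assms unfolding list_computable_def by blast
  have "evals (PrimRec p q) (n # ys) (rec_nat (f ys) (\<lambda>n y. g (n # y # ys)) n)" if "length ys = k" for n ys
  proof (induction n)
    case 0
    show ?case using p[OF that] by (simp add: evals.PrimRec_0)
  next
    case (Suc n)
    show ?case using evals.PrimRec_Suc[OF Suc] q that by simp
  qed
  then have "evals (PrimRec p q) xs (rec_nat (f (tl xs)) (\<lambda>n y. g (n # y # tl xs)) (hd xs))"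
    if "length xs = Suc k" for xs using that by (cases xs) auto
  then show ?thesis unfolding list_computable_def by blast
qed

lemma list_computable_Least:
  assumes f: "list_computable (Suc k) f" and ex: "\<And>xs. length xs = k \<Longrightarrow> \<exists>n. f (n # xs) = 0"
  shows "list_computable k (\<lambda>xs. LEAST n. f (n # xs) = 0)"
proof -
  obtain p where p: "\<And>xs. length xs = Suc k \<Longrightarrow> evals p xs (f xs)"
    using f unfolding list_computable_def by blast
  have "evals (Mu p) xs (LEAST n. f (n # xs) = 0)" if xs: "length xs = k" for xs
  proof (rule evals.Mu)
    have "f ((LEAST n. f (n # xs) = 0) # xs) = 0" using ex[OF xs] by (rule LeastI_ex)
    then show "evals p ((LEAST n. f (n # xs) = 0) # xs) 0"
      using p[of "(LEAST n. f (n # xs) = 0) # xs"] xs by simp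
    fix j assume "j < (LEAST n. f (n # xs) = 0)"
    then have "f (j # xs) \<noteq> 0" by (rule not_less_Least)
    then show "\<exists>y>0. evals p (j # xs) y" using p[of "j # xs"] xs by auto
  qed
  then show ?thesis unfolding list_computable_def by blast
qed

lemma list_computable_rec1:
  assumes "list_computable 2 (\<lambda>xs. g (xs ! 0) (xs ! 1))" "list_computable k h"
  shows "list_computable k (\<lambda>xs. rec_nat c (\<lambda>n y. g n y) (h xs))"
proof (rule list_computable_comp1[OF _ assms(2), of "\<lambda>n. rec_nat c g n"])
  have "list_computable (Suc 0) (\<lambda>xs. rec_nat c (\<lambda>n y. g ((n # y # tl xs) ! 0) ((n # y # tl xs) ! 1)) (hd xs))"
    using assms(1) by (intro list_computable_rec list_computable_const) (simp add: numeral_2_eq_2)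
  then show "list_computable 1 (\<lambda>xs. rec_nat c g (xs ! 0))"
    unfolding One_nat_def by (rule list_computable_cong) (auto simp: length_Suc_conv)
qed

lemma list_computable_rec2:
  assumes "list_computable 1 (\<lambda>xs. f (xs ! 0))" "list_computable 3 (\<lambda>xs. g (xs ! 0) (xs ! 1) (xs ! 2))"
    "list_computable k h" "list_computable k j"
  shows "list_computable k (\<lambda>xs. rec_nat (f (j xs)) (\<lambda>n y. g n y (j xs)) (h xs))"
proof (rule list_computable_comp2[OF _ assms(3,4), of "\<lambda>n x. rec_nat (f x) (\<lambda>n y. g n y x) n"])
  have "list_computable (Suc 1) (\<lambda>xs. rec_nat (f (tl xs ! 0)) (\<lambda>n y. g ((n # y # tl xs) ! 0) ((n # y # tl xs) ! 1) ((n # y # tl xs) ! 2)) (hd xs))"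
    using assms(2) by (intro list_computable_rec[OF assms(1), of "\<lambda>xs. g (xs ! 0) (xs ! 1) (xs ! 2)"]) (simp add: numeral_3_eq_3)
  then show "list_computable 2 (\<lambda>xs. rec_nat (f (xs ! 1)) (\<lambda>n y. g n y (xs ! 1)) (xs ! 0))"
    unfolding Suc_1 by (rule list_computable_cong) (auto simp: length_Suc_conv numeral_2_eq_2)
qed

section \<open>Arithmetic and the pairing function\<close>

lemma list_computable_add: "list_computable k f \<Longrightarrow> list_computable k g \<Longrightarrow> list_computable k (\<lambda>xs. f xs + g xs)"
proof -
  assume f: "list_computable k f" and g: "list_computable k g"
  have "list_computable k (\<lambda>xs. rec_nat (g xs) (\<lambda>n y. Suc y) (f xs))"
    by (rule list_computable_rec2[OF _ _ f g, where f = "\<lambda>x. x"])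
       (auto intro!: list_computable_Suc list_computable_nth)
  moreover have "rec_nat b (\<lambda>n y. Suc y) a = a + b" for a b by (induction a) auto
  ultimately show ?thesis by simp
qed

lemma list_computable_mult: "list_computable k f \<Longrightarrow> list_computable k g \<Longrightarrow> list_computable k (\<lambda>xs. f xs * g xs)"
proof -
  assume f: "list_computable k f" and g: "list_computable k g"
  have "list_computable k (\<lambda>xs. rec_nat 0 (\<lambda>n y. y + g xs) (f xs))"
    by (rule list_computable_rec2[OF _ _ f g, where f = "\<lambda>x. 0"])
       (auto intro!: list_computable_add list_computable_nth list_computable_const)
  moreover have "rec_nat 0 (\<lambda>n y. y + b) a = a * b" for a b :: nat by (induction a) auto
  ultimately show ?thesis by simp
qed

lemma list_computable_pred: "list_computable k f \<Longrightarrow> list_computable k (\<lambda>xs. f xs - 1)"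
proof -
  assume f: "list_computable k f"
  have "list_computable k (\<lambda>xs. rec_nat 0 (\<lambda>n y. n) (f xs))"
    by (rule list_computable_rec1[OF _ f]) (auto intro!: list_computable_nth)
  moreover have "rec_nat 0 (\<lambda>n y. n) a = a - 1" for a :: nat by (cases a) auto
  ultimately show ?thesis by simp
qed

lemma list_computable_diff: "list_computable k f \<Longrightarrow> list_computable k g \<Longrightarrow> list_computable k (\<lambda>xs. f xs - g xs)"
proof -
  assume f: "list_computable k f" and g: "list_computable k g"
  have "list_computable k (\<lambda>xs. rec_nat (f xs) (\<lambda>n y. y - 1) (g xs))"
    by (rule list_computable_rec2[OF _ _ g f, where f = "\<lambda>x. x"])
       (auto intro!: list_computable_pred list_computable_nth simp del: One_nat_def)
  moreover have "rec_nat a (\<lambda>n y. y - 1) b = a - b" for a b :: nat by (induction b) auto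
  ultimately show ?thesis by simp
qed

lemma list_computable_triangle: "list_computable k f \<Longrightarrow> list_computable k (\<lambda>xs. triangle (f xs))"
proof -
  assume f: "list_computable k f"
  have "list_computable k (\<lambda>xs. rec_nat 0 (\<lambda>n y. y + Suc n) (f xs))"
    by (rule list_computable_rec1[OF _ f]) (auto intro!: list_computable_add list_computable_Suc list_computable_nth)
  moreover have "rec_nat 0 (\<lambda>n y. y + Suc n) a = triangle a" for a :: nat by (induction a) auto
  ultimately show ?thesis by simp
qed

definition pair :: "nat \<Rightarrow> nat \<Rightarrow> nat" where "pair a b = prod_encode (a, b)"
definition pfst :: "nat \<Rightarrow> nat" where "pfst n = fst (prod_decode n)"
definition psnd :: "nat \<Rightarrow> nat" where "psnd n = snd (prod_decode n)"

lemma pfst_pair [simp]: "pfst (pair a b) = a" and psnd_pair [simp]: "psnd (pair a b) = b"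
  and pair_collapse [simp]: "pair (pfst n) (psnd n) = n"
  by (simp_all add: pair_def pfst_def psnd_def)

lemma pair_eq_iff [simp]: "pair a b = pair c d \<longleftrightarrow> a = c \<and> b = d"
  by (simp add: pair_def)

lemma list_computable_pair: "list_computable k f \<Longrightarrow> list_computable k g \<Longrightarrow> list_computable k (\<lambda>xs. pair (f xs) (g xs))"
  unfolding pair_def prod_encode_def by (simp, intro list_computable_add list_computable_triangle)

lemma triangle_strict_mono: "a < b \<Longrightarrow> triangle a < triangle b"
  by (rule lift_Suc_mono_less[of triangle]) auto

text \<open>\<open>pfst n + psnd n\<close> is the diagonal on which Cantor's enumeration meets
  \<open>n\<close>, the first \<open>w\<close> with \<open>n < triangle (Suc w)\<close>. Truncated
  subtraction turns this inequality into a zero, which minimisation can find.\<close>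

lemma Least_triangle: "(LEAST w. Suc n - triangle (Suc w) = 0) = pfst n + psnd n"
proof (rule Least_equality)
  have n: "n = triangle (pfst n + psnd n) + pfst n"
    using pair_collapse[of n] unfolding pair_def prod_encode_def by simp
  show "Suc n - triangle (Suc (pfst n + psnd n)) = 0" by (subst n) simp
  fix w assume w: "Suc n - triangle (Suc w) = 0"
  show "pfst n + psnd n \<le> w"
  proof (rule ccontr)
    assume "\<not> ?thesis"
    then have "Suc w < pfst n + psnd n \<or> Suc w = pfst n + psnd n" by auto
    then have "triangle (Suc w) \<le> triangle (pfst n + psnd n)" using triangle_strict_mono by fastforce
    then show False using w n by linarith
  qed
qed

lemma list_computable_pfst_psnd:
  "list_computable 1 (\<lambda>xs. pfst (xs ! 0))" "list_computable 1 (\<lambda>xs. psnd (xs ! 0))"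
proof -
  have "list_computable 1 (\<lambda>xs. LEAST w. (\<lambda>ys. Suc (ys ! 1) - triangle (Suc (ys ! 0))) (w # xs) = 0)"
  proof (rule list_computable_Least)
    show "list_computable (Suc 1) (\<lambda>ys. Suc (ys ! 1) - triangle (Suc (ys ! 0)))"
      by (intro list_computable_diff list_computable_Suc list_computable_triangle list_computable_nth) auto
    fix xs :: "nat list"
    have "m < triangle (Suc m)" for m by (induction m) auto
    then show "\<exists>n. Suc ((n # xs) ! 1) - triangle (Suc ((n # xs) ! 0)) = 0" by (intro exI[of _ "xs ! 0"]) (auto simp: Suc_le_eq)
  qed
  then have w: "list_computable 1 (\<lambda>xs. pfst (xs ! 0) + psnd (xs ! 0))"
    by (simp only: nth_Cons_0 nth_Cons_Suc One_nat_def Least_triangle)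
  have "list_computable 1 (\<lambda>xs. xs ! 0 - triangle (pfst (xs ! 0) + psnd (xs ! 0)))"
    by (intro list_computable_diff list_computable_triangle w list_computable_nth) auto
  moreover have "n - triangle (pfst n + psnd n) = pfst n" for n
    using pair_collapse[of n] unfolding pair_def prod_encode_def by simp
  ultimately show 1: "list_computable 1 (\<lambda>xs. pfst (xs ! 0))" by simp
  have "list_computable 1 (\<lambda>xs. (pfst (xs ! 0) + psnd (xs ! 0)) - pfst (xs ! 0))"
    by (intro list_computable_diff 1 w)
  then show "list_computable 1 (\<lambda>xs. psnd (xs ! 0))" by simp
qed

lemma total_computable_iff: "total_computable f \<longleftrightarrow> list_computable 1 (\<lambda>xs. f (xs ! 0))"
proof
  assume "total_computable f"
  then obtain p where p: "\<And>n. evals p [n] (f n)" unfolding total_computable_def by blast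
  have "evals p xs (f (xs ! 0))" if "length xs = 1" for xs using that p by (cases xs) auto
  then show "list_computable 1 (\<lambda>xs. f (xs ! 0))" unfolding list_computable_def by blast
next
  assume "list_computable 1 (\<lambda>xs. f (xs ! 0))"
  then obtain p where p: "\<And>xs. length xs = 1 \<Longrightarrow> evals p xs (f (xs ! 0))" unfolding list_computable_def by blast
  then have "evals p [n] (f n)" for n using p[of "[n]"] by simp
  then show "total_computable f" unfolding total_computable_def by blast
qed

section \<open>Computable functions of one argument\<close>

named_theorems tc_intros

lemma tc_comp: "total_computable f \<Longrightarrow> total_computable g \<Longrightarrow> total_computable (\<lambda>n. f (g n))"
  unfolding total_computable_iff by (rule list_computable_comp1)

lemma tc_id [tc_intros]: "total_computable (\<lambda>n. n)"
  unfolding total_computable_iff by (rule list_computable_nth) simp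

lemma tc_const [tc_intros]: "total_computable (\<lambda>n. c)"
  unfolding total_computable_iff by (rule list_computable_const)

lemma tc_pfst [tc_intros]: "total_computable f \<Longrightarrow> total_computable (\<lambda>n. pfst (f n))"
  by (rule tc_comp[of pfst]) (simp_all only: total_computable_iff list_computable_pfst_psnd)

lemma tc_psnd [tc_intros]: "total_computable f \<Longrightarrow> total_computable (\<lambda>n. psnd (f n))"
  by (rule tc_comp[of psnd]) (simp_all only: total_computable_iff list_computable_pfst_psnd)

lemma tc_pair [tc_intros]: "total_computable f \<Longrightarrow> total_computable g \<Longrightarrow> total_computable (\<lambda>n. pair (f n) (g n))"
  unfolding total_computable_iff by (rule list_computable_pair)

lemma tc_Suc [tc_intros]: "total_computable f \<Longrightarrow> total_computable (\<lambda>n. Suc (f n))"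
  unfolding total_computable_iff by (rule list_computable_Suc)

lemma tc_add [tc_intros]: "total_computable f \<Longrightarrow> total_computable g \<Longrightarrow> total_computable (\<lambda>n. f n + g n)"
  unfolding total_computable_iff by (rule list_computable_add)

lemma tc_mult [tc_intros]: "total_computable f \<Longrightarrow> total_computable g \<Longrightarrow> total_computable (\<lambda>n. f n * g n)"
  unfolding total_computable_iff by (rule list_computable_mult)

lemma tc_diff [tc_intros]: "total_computable f \<Longrightarrow> total_computable g \<Longrightarrow> total_computable (\<lambda>n. f n - g n)"
  unfolding total_computable_iff by (rule list_computable_diff)

lemma tc_rec:
  assumes "total_computable a" "total_computable (\<lambda>p. g (pfst p) (pfst (psnd p)) (psnd (psnd p)))" "total_computable k"
  shows "total_computable (\<lambda>n. rec_nat (a n) (\<lambda>i y. g i y n) (k n))"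
proof -
  let ?h = "\<lambda>p. g (pfst p) (pfst (psnd p)) (psnd (psnd p))"
  have "list_computable 3 (\<lambda>xs. ?h (pair (xs ! 0) (pair (xs ! 1) (xs ! 2))))"
    by (rule list_computable_comp1[of ?h])
       (use assms(2) in \<open>auto simp: total_computable_iff intro!: list_computable_pair list_computable_nth\<close>)
  then have "list_computable 3 (\<lambda>xs. g (xs ! 0) (xs ! 1) (xs ! 2))" by simp
  then show ?thesis
    using assms unfolding total_computable_iff
    by (intro list_computable_rec2[where f = a and g = g and h = "\<lambda>xs. k (xs ! 0)" and j = "\<lambda>xs. xs ! 0"]) (auto intro: list_computable_nth)
qed

definition decidable :: "(nat \<Rightarrow> bool) \<Rightarrow> bool" where
  "decidable P \<longleftrightarrow> total_computable (\<lambda>n. of_bool (P n))"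

lemma tc_of_bool [tc_intros]: "decidable P \<Longrightarrow> total_computable (\<lambda>n. of_bool (P n))"
  by (simp add: decidable_def)

lemma decidableI: "total_computable f \<Longrightarrow> (\<And>n. P n \<longleftrightarrow> f n = 0) \<Longrightarrow> decidable P"
proof -
  assume "total_computable f" "\<And>n. P n \<longleftrightarrow> f n = 0"
  then have "total_computable (\<lambda>n. 1 - f n)" by (intro tc_intros)
  moreover have "1 - f n = of_bool (P n)" for n using \<open>\<And>n. P n \<longleftrightarrow> f n = 0\<close> by (cases "f n = 0") auto
  ultimately show ?thesis unfolding decidable_def by simp
qed

lemma decidable_le [tc_intros]: "total_computable f \<Longrightarrow> total_computable g \<Longrightarrow> decidable (\<lambda>n. f n \<le> g n)"
  by (rule decidableI[of "\<lambda>n. f n - g n"]) (auto intro: tc_intros)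

lemma decidable_less [tc_intros]: "total_computable f \<Longrightarrow> total_computable g \<Longrightarrow> decidable (\<lambda>n. f n < g n)"
  by (rule decidableI[of "\<lambda>n. Suc (f n) - g n"]) (auto intro: tc_intros)

lemma decidable_eq [tc_intros]: "total_computable f \<Longrightarrow> total_computable g \<Longrightarrow> decidable (\<lambda>n. f n = g n)"
  by (rule decidableI[of "\<lambda>n. (f n - g n) + (g n - f n)"]) (auto intro: tc_intros)

lemma decidable_not [tc_intros]: "decidable P \<Longrightarrow> decidable (\<lambda>n. \<not> P n)"
  by (rule decidableI[of "\<lambda>n. of_bool (P n)"]) (auto intro: tc_intros)

lemma decidable_or [tc_intros]: "decidable P \<Longrightarrow> decidable Q \<Longrightarrow> decidable (\<lambda>n. P n \<or> Q n)"
  by (rule decidableI[of "\<lambda>n. of_bool (\<not> P n) * of_bool (\<not> Q n)"]) (auto intro!: tc_intros)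

lemma decidable_and [tc_intros]: "decidable P \<Longrightarrow> decidable Q \<Longrightarrow> decidable (\<lambda>n. P n \<and> Q n)"
  by (rule decidableI[of "\<lambda>n. of_bool (\<not> P n) + of_bool (\<not> Q n)"]) (auto intro!: tc_intros)

lemma decidable_imp [tc_intros]: "decidable P \<Longrightarrow> decidable Q \<Longrightarrow> decidable (\<lambda>n. P n \<longrightarrow> Q n)"
  by (rule decidableI[of "\<lambda>n. of_bool (P n) * of_bool (\<not> Q n)"]) (auto intro!: tc_intros)

lemma tc_if [tc_intros]:
  assumes "decidable P" "total_computable f" "total_computable g"
  shows "total_computable (\<lambda>n. if P n then f n else g n)"
proof -
  have "total_computable (\<lambda>n. of_bool (P n) * f n + of_bool (\<not> P n) * g n)" using assms by (intro tc_intros)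
  moreover have "of_bool (P n) * f n + of_bool (\<not> P n) * g n = (if P n then f n else g n)" for n by simp
  ultimately show ?thesis by simp
qed

text \<open>Bounded counting carries much of the rest: bounded quantifiers, division and
  \<open>flog\<close> are all obtained from it. The bound variable and the parameter travel as one
  pair.\<close>

lemma tc_card [tc_intros]:
  assumes "total_computable k" "decidable (\<lambda>p. P (pfst p) (psnd p))"
  shows "total_computable (\<lambda>n. card {i. i < k n \<and> P i n})"
proof -
  have "decidable (\<lambda>p. P (pfst p) (psnd (psnd p)))"
  proof -
    have "total_computable (\<lambda>p. of_bool (P (pfst (pair (pfst p) (psnd (psnd p)))) (psnd (pair (pfst p) (psnd (psnd p))))))"
      by (rule tc_comp[OF assms(2)[unfolded decidable_def]]) (intro tc_intros)
    then show ?thesis by (simp add: decidable_def)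
  qed
  then have "total_computable (\<lambda>n. rec_nat 0 (\<lambda>i y. y + of_bool (P i n)) (k n))"
    using assms(1) by (intro tc_rec tc_intros)
  moreover have "rec_nat 0 (\<lambda>i y. y + of_bool (P i n)) m = card {i. i < m \<and> P i n}" for m n
  proof (induction m)
    case (Suc m)
    have "{i. i < Suc m \<and> P i n} = (if P m n then insert m {i. i < m \<and> P i n} else {i. i < m \<and> P i n})"
      by (auto simp: less_Suc_eq)
    then show ?case using Suc by simp
  qed simp
  ultimately show ?thesis by simp
qed

lemma decidable_ball [tc_intros]:
  assumes "total_computable k" "decidable (\<lambda>p. P (pfst p) (psnd p))"
  shows "decidable (\<lambda>n. \<forall>i<k n. P i n)"
proof (rule decidableI)
  show "total_computable (\<lambda>n. card {i. i < k n \<and> \<not> P i n})" using assms by (intro tc_intros)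
qed auto

lemma decidable_bex [tc_intros]:
  assumes "total_computable k" "decidable (\<lambda>p. P (pfst p) (psnd p))"
  shows "decidable (\<lambda>n. \<exists>i<k n. P i n)"
proof -
  have "decidable (\<lambda>n. \<not> (\<forall>i<k n. \<not> P i n))" using assms by (intro tc_intros)
  then show ?thesis by (simp add: Bex_def)
qed

lemma tc_Least:
  assumes "decidable (\<lambda>p. P (pfst p) (psnd p))" "\<And>n. \<exists>i. P i n"
  shows "total_computable (\<lambda>n. LEAST i. P i n)"
proof -
  let ?h = "\<lambda>p. of_bool (\<not> P (pfst p) (psnd p)) :: nat"
  have h: "total_computable ?h" using assms(1) by (intro tc_intros)
  have "list_computable (Suc 1) (\<lambda>xs. ?h (pair (xs ! 0) (xs ! 1)))"
    by (rule list_computable_comp1[of ?h])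
       (use h in \<open>auto simp: total_computable_iff intro!: list_computable_pair list_computable_nth\<close>)
  then have "list_computable 1 (\<lambda>xs. LEAST n. (\<lambda>ys. ?h (pair (ys ! 0) (ys ! 1))) (n # xs) = 0)"
    by (rule list_computable_Least) (use assms(2) in auto)
  then show ?thesis unfolding total_computable_iff by simp
qed

lemma tc_power [tc_intros]:
  assumes "total_computable f" "total_computable g"
  shows "total_computable (\<lambda>n. f n ^ g n)"
proof -
  have "total_computable (\<lambda>n. rec_nat 1 (\<lambda>i y. y * f n) (g n))"
    by (rule tc_rec[where g = "\<lambda>i y n. y * f n"]) (intro tc_intros tc_comp[OF assms(1)] assms)+
  moreover have "rec_nat 1 (\<lambda>i y. y * a) b = a ^ b" for a b :: nat by (induction b) auto
  ultimately show ?thesis by simp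
qed

lemma tc_fact [tc_intros]:
  assumes "total_computable f"
  shows "total_computable (\<lambda>n. fact (f n))"
proof -
  have "total_computable (\<lambda>n. rec_nat 1 (\<lambda>i y. Suc i * y) (f n))"
    by (rule tc_rec[where g = "\<lambda>i y n. Suc i * y"]) (intro tc_intros assms)+
  moreover have "rec_nat 1 (\<lambda>i y. Suc i * y) b = fact b" for b :: nat by (induction b) auto
  ultimately show ?thesis by simp
qed

lemma tc_div [tc_intros]:
  assumes "total_computable f" "total_computable g"
  shows "total_computable (\<lambda>n. f n div g n)"
proof -
  have "total_computable (\<lambda>n. if g n = 0 then 0 else card {i. i < f n \<and> Suc i * g n \<le> f n})"
    by (intro tc_intros assms tc_comp[OF assms(1)] tc_comp[OF assms(2)])
  moreover have "(if b = 0 then 0 else card {i. i < a \<and> Suc i * b \<le> a}) = a div b" for a b :: nat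
  proof (cases "b = 0")
    case False
    have "{i. i < a \<and> Suc i * b \<le> a} = {..<a div b}"
    proof (rule set_eqI)
      fix i
      have "Suc i * b \<le> a \<longleftrightarrow> Suc i \<le> a div b" using False by (simp add: less_eq_div_iff_mult_less_eq)
      moreover have "Suc i \<le> a div b \<Longrightarrow> i < a" using div_le_dividend[of a b] by linarith
      ultimately show "i \<in> {i. i < a \<and> Suc i * b \<le> a} \<longleftrightarrow> i \<in> {..<a div b}" by auto
    qed
    then show ?thesis using False by simp
  qed simp
  ultimately show ?thesis by simp
qed

lemma tc_mod [tc_intros]:
  assumes "total_computable f" "total_computable g"
  shows "total_computable (\<lambda>n. f n mod g n)"
proof -
  have "total_computable (\<lambda>n. f n - f n div g n * g n)" using assms by (intro tc_intros)
  then show ?thesis by (simp add: minus_div_mult_eq_mod)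
qed

section \<open>Recursion through finite graphs\<close>

lemma pfst_le: "pfst n \<le> n" and psnd_le: "psnd n \<le> n"
  using le_prod_encode_1[of "pfst n" "psnd n"] le_prod_encode_2[of "psnd n" "pfst n"] pair_collapse[of n]
  by (simp_all add: pair_def)

lemma psnd_less: "pfst n \<noteq> 0 \<Longrightarrow> psnd n < n"
proof -
  assume p: "pfst n \<noteq> 0"
  have "n = triangle (pfst n + psnd n) + pfst n"
    using pair_collapse[of n] unfolding pair_def prod_encode_def by simp
  moreover have "m \<le> triangle m" for m by (induction m) auto
  then have "pfst n + psnd n \<le> triangle (pfst n + psnd n)" .
  ultimately show ?thesis using p by linarith
qed

lemma set_decode_less: "z \<in> set_decode L \<Longrightarrow> z < L"
proof -
  assume "z \<in> set_decode L"
  then have "L div 2 ^ z \<noteq> 0" by (auto simp: set_decode_def elim: oddE)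
  then have "2 ^ z \<le> L" by (simp add: div_eq_0_iff not_less)
  then show ?thesis using less_exp[of z] by linarith
qed

lemma decidable_set_decode [tc_intros]:
  assumes "total_computable f" "total_computable g"
  shows "decidable (\<lambda>n. f n \<in> set_decode (g n))"
proof -
  have "decidable (\<lambda>n. (g n div 2 ^ f n) mod 2 = 1)" using assms by (intro tc_intros)
  then show ?thesis by (simp add: set_decode_def odd_iff_mod_2_eq_one)
qed

lemma decidable_if [tc_intros]:
  "decidable P \<Longrightarrow> decidable Q \<Longrightarrow> decidable R \<Longrightarrow> decidable (\<lambda>n. if P n then Q n else R n)"
proof -
  assume "decidable P" "decidable Q" "decidable R"
  then have "decidable (\<lambda>n. (P n \<longrightarrow> Q n) \<and> (\<not> P n \<longrightarrow> R n))" by (intro tc_intros)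
  moreover have "(\<lambda>n. (P n \<longrightarrow> Q n) \<and> (\<not> P n \<longrightarrow> R n)) = (\<lambda>n. if P n then Q n else R n)" by auto
  ultimately show ?thesis by simp
qed

text \<open>The entry bounds its own witness: \<open>w \<le> pair (g n) w < L n\<close>.\<close>

lemma decidable_ex_entry [tc_intros]:
  assumes "total_computable g" "total_computable L" "decidable (\<lambda>p. P (pfst p) (psnd p))"
  shows "decidable (\<lambda>n. \<exists>w. pair (g n) w \<in> set_decode (L n) \<and> P w n)"
proof -
  have "decidable (\<lambda>n. \<exists>w<L n. pair (g n) w \<in> set_decode (L n) \<and> P w n)"
    by (intro tc_intros assms tc_comp[OF assms(1)] tc_comp[OF assms(2)])
  moreover have "w < L n" if "pair (g n) w \<in> set_decode (L n)" for w n
    using set_decode_less[OF that] psnd_le[of "pair (g n) w"] by simp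
  then have "(\<lambda>n. \<exists>w<L n. pair (g n) w \<in> set_decode (L n) \<and> P w n) = (\<lambda>n. \<exists>w. pair (g n) w \<in> set_decode (L n) \<and> P w n)"
    by blast
  ultimately show ?thesis by simp
qed

text \<open>Under tag 0 codes need not decrease, since \<open>pair 0 0\<close> is 0 itself; but tag
  0 marks variables and equations, where the interpreters below make no recursive call to
  themselves.\<close>

lemma child_less:
  assumes "pfst c \<noteq> 0"
  shows "psnd c < c" "pfst (psnd c) < c" "psnd (psnd c) < c"
  using psnd_less[OF assms] pfst_le[of "psnd c"] psnd_le[of "psnd c"] by auto

text \<open>Recursion along a well-founded measure, where the recursive calls depend on the argument in an
  arbitrary computable way: \<open>J D x v\<close> says that \<open>v\<close> is the right value at \<open>x\<close> if the finite graph
  \<open>D\<close> gives the right values at the recursive calls. The function is computed by searching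
  for a graph that contains the argument and justifies all its entries.\<close>

lemma tc_recursion:
  fixes f m :: "nat \<Rightarrow> nat" and J :: "nat set \<Rightarrow> nat \<Rightarrow> nat \<Rightarrow> bool"
  assumes J: "decidable (\<lambda>p. J (set_decode (pfst p)) (pfst (psnd p)) (psnd (psnd p)))"
    and mono: "\<And>D D' x v. D \<subseteq> D' \<Longrightarrow> J D x v \<Longrightarrow> J D' x v"
    and sound: "\<And>D x v. J D x v \<Longrightarrow> (\<And>y w. pair y w \<in> D \<Longrightarrow> m y < m x \<Longrightarrow> w = f y) \<Longrightarrow> v = f x"
    and complete: "\<And>x. \<exists>Y. finite Y \<and> (\<forall>y\<in>Y. m y < m x) \<and> J ((\<lambda>y. pair y (f y)) ` Y) x (f x)"
  shows "total_computable f"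
proof -
  \<comment> \<open>Every entry of the graph coded by \<open>L\<close> is justified by the graph
    itself. By induction along \<open>m\<close>, such a graph holds only correct values.\<close>
  define V where "V L \<longleftrightarrow> (\<forall>z<L. z \<in> set_decode L \<longrightarrow> J (set_decode L) (pfst z) (psnd z))" for L
  have Vcorrect: "v = f x" if "V L" "pair x v \<in> set_decode L" for L x v
    using that(2)
  proof (induction "m x" arbitrary: x v rule: less_induct)
    case less
    have "J (set_decode L) x v" using that(1) less.prems set_decode_less[OF less.prems] unfolding V_def by force
    then show ?case using less.hyps by (rule sound) auto
  qed
  have ex: "\<exists>L. V L \<and> pair x (f x) \<in> set_decode L" for x
  proof (induction "m x" arbitrary: x rule: less_induct)
    case less
    obtain Y where Y: "finite Y" "\<And>y. y \<in> Y \<Longrightarrow> m y < m x" "J ((\<lambda>y. pair y (f y)) ` Y) x (f x)"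
      using complete[of x] by blast
    have "\<forall>y\<in>Y. \<exists>L. V L \<and> pair y (f y) \<in> set_decode L" using less Y(2) by blast
    then obtain Lf where Lf: "\<And>y. y \<in> Y \<Longrightarrow> V (Lf y)" "\<And>y. y \<in> Y \<Longrightarrow> pair y (f y) \<in> set_decode (Lf y)" by metis
    \<comment> \<open>The graphs for the recursive calls are simply united; \<open>mono\<close>
      keeps their entries justified.\<close>
    define D where "D = insert (pair x (f x)) (\<Union>y\<in>Y. set_decode (Lf y))"
    have fD: "finite D" unfolding D_def using Y(1) by auto
    define L where "L = set_encode D"
    have LD: "set_decode L = D" unfolding L_def using fD by simp
    have "J D (pfst z) (psnd z)" if z: "z \<in> D" for z
    proof (cases "z = pair x (f x)")
      case True
      have "(\<lambda>y. pair y (f y)) ` Y \<subseteq> D" using Lf(2) by (auto simp: D_def)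
      then show ?thesis using Y(3) True by (auto intro: mono)
    next
      case False
      then obtain y where y: "y \<in> Y" "z \<in> set_decode (Lf y)" using z by (auto simp: D_def)
      then have "J (set_decode (Lf y)) (pfst z) (psnd z)" using Lf(1)[OF y(1)] set_decode_less[OF y(2)] unfolding V_def by blast
      moreover have "set_decode (Lf y) \<subseteq> D" using y by (auto simp: D_def)
      ultimately show ?thesis by (rule mono[rotated])
    qed
    then have "V L" unfolding V_def LD by blast
    moreover have "pair x (f x) \<in> set_decode L" unfolding LD by (simp add: D_def)
    ultimately show ?case by blast
  qed
  \<comment> \<open>The value is guessed along with the graph, so that a single minimisation yields
    both.\<close>
  define R where "R n x \<longleftrightarrow> V (pfst n) \<and> pair x (psnd n) \<in> set_decode (pfst n)" for n x
  have decV: "decidable V"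
  proof -
    have "decidable (\<lambda>p. J (set_decode (psnd p)) (pfst (pfst p)) (psnd (pfst p)))"
    proof -
      let ?h = "\<lambda>p. pair (psnd p) (pair (pfst (pfst p)) (psnd (pfst p)))"
      have "total_computable (\<lambda>p. of_bool (J (set_decode (pfst (?h p))) (pfst (psnd (?h p))) (psnd (psnd (?h p)))))"
        by (rule tc_comp[OF J[unfolded decidable_def], of ?h]) (intro tc_intros)
      then show ?thesis by (simp add: decidable_def)
    qed
    then show ?thesis unfolding V_def by (intro tc_intros)
  qed
  have decV': "decidable (\<lambda>n. V (g n))" if "total_computable g" for g
    using tc_comp[OF decV[unfolded decidable_def] that] by (simp add: decidable_def)
  have "total_computable (\<lambda>x. LEAST n. R n x)"
  proof (rule tc_Least)
    show "decidable (\<lambda>p. R (pfst p) (psnd p))" unfolding R_def by (intro tc_intros decV')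
    fix x
    obtain L where "V L" "pair x (f x) \<in> set_decode L" using ex by blast
    then show "\<exists>n. R n x" unfolding R_def by (intro exI[of _ "pair L (f x)"]) simp
  qed
  then have "total_computable (\<lambda>x. psnd (LEAST n. R n x))" by (intro tc_intros)
  moreover have "psnd (LEAST n. R n x) = f x" for x
  proof -
    obtain L where "V L" "pair x (f x) \<in> set_decode L" using ex by blast
    then have "R (pair L (f x)) x" by (simp add: R_def)
    then have "R (LEAST n. R n x) x" by (rule LeastI)
    then show ?thesis using Vcorrect unfolding R_def by blast
  qed
  ultimately show ?thesis by simp
qed

text \<open>An environment is coded as an endlessly nested pair, so that entering a quantifier is
  \<open>pair x e\<close> and 0 codes the environment that is 0 everywhere.\<close>

definition env_of :: "nat \<Rightarrow> nat \<Rightarrow> nat" where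
  "env_of e i = pfst (rec_nat e (\<lambda>_ y. psnd y) i)"

lemma env_of_pair: "env_of (pair x e) = case_nat x (env_of e)"
proof
  fix i
  have "rec_nat (pair x e) (\<lambda>_ y. psnd y) (Suc i) = rec_nat e (\<lambda>_ y. psnd y) i" for i
    by (induction i) auto
  then show "env_of (pair x e) i = case_nat x (env_of e) i"
    unfolding env_of_def by (cases i) auto
qed

lemma tc_env_of [tc_intros]:
  assumes "total_computable f" "total_computable g"
  shows "total_computable (\<lambda>n. env_of (f n) (g n))"
  unfolding env_of_def
  by (rule tc_pfst, rule tc_rec[where g = "\<lambda>_ y _. psnd y"]) (intro tc_intros assms)+

section \<open>Evaluation of coded formulas\<close>

text \<open>An interpreter on codes. Numbers with an unknown tag get the default 0, which keeps it
  total.\<close>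

function term_value :: "nat \<Rightarrow> nat \<Rightarrow> nat" where
  "term_value c e =
     (if pfst c = 0 then env_of e (psnd c)
      else if pfst c = 1 then 0
      else if pfst c = 2 then Suc (term_value (psnd c) e)
      else if pfst c = 3 then term_value (pfst (psnd c)) e + term_value (psnd (psnd c)) e
      else if pfst c = 4 then term_value (pfst (psnd c)) e * term_value (psnd (psnd c)) e
      else 0)"
  by auto
termination
  by (relation "Wellfounded.measure fst") (auto intro: child_less)

declare term_value.simps [simp del]

lemma term_value_code: "term_value (tm_code t) e = tm_val (env_of e) t"
  by (induction t) (simp_all add: term_value.simps[of "prod_encode _"] pfst_def psnd_def)

lemma tc_term_value [tc_intros]:
  assumes "total_computable f" "total_computable g"
  shows "total_computable (\<lambda>n. term_value (f n) (g n))"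
proof -
  define F where "F x = term_value (pfst x) (psnd x)" for x
  \<comment> \<open>The defining equation of \<open>term_value\<close>, with each recursive call
    replaced by an entry of the graph \<open>D\<close>.\<close>
  define J where "J D x v \<longleftrightarrow>
    (if pfst (pfst x) = 0 then v = env_of (psnd x) (psnd (pfst x))
     else if pfst (pfst x) = 1 then v = 0
     else if pfst (pfst x) = 2 then \<exists>w. pair (pair (psnd (pfst x)) (psnd x)) w \<in> D \<and> v = Suc w
     else if pfst (pfst x) = 3 then \<exists>w. pair (pair (pfst (psnd (pfst x))) (psnd x)) w \<in> D \<and>
       (\<exists>w'. pair (pair (psnd (psnd (pfst x))) (psnd x)) w' \<in> D \<and> v = w + w')
     else if pfst (pfst x) = 4 then \<exists>w. pair (pair (pfst (psnd (pfst x))) (psnd x)) w \<in> D \<and>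
       (\<exists>w'. pair (pair (psnd (psnd (pfst x))) (psnd x)) w' \<in> D \<and> v = w * w')
     else v = 0)" for D x v
  have "total_computable F"
  proof (rule tc_recursion[where m = pfst and J = J])
    show "decidable (\<lambda>p. J (set_decode (pfst p)) (pfst (psnd p)) (psnd (psnd p)))"
      unfolding J_def by (intro tc_intros)
    show "J D' x v" if "D \<subseteq> D'" "J D x v" for D D' x v
      using that unfolding J_def by (auto split: if_splits)
    show "v = F x" if j: "J D x v" and H: "\<And>y w. pair y w \<in> D \<Longrightarrow> pfst y < pfst x \<Longrightarrow> w = F y" for D x v
    proof -
      have H': "w = term_value c (psnd x)" if "pair (pair c (psnd x)) w \<in> D" "c < pfst x" for c w
        using H[OF that(1)] that(2) by (simp add: F_def)
      show ?thesis
        using j unfolding J_def F_def term_value.simps[of "pfst x"]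
        by (auto split: if_splits dest!: H' simp: child_less)
    qed
    show "\<exists>Y. finite Y \<and> (\<forall>y\<in>Y. pfst y < pfst x) \<and> J ((\<lambda>y. pair y (F y)) ` Y) x (F x)" for x
    proof (cases "pfst (pfst x) = 0")
      case True
      then show ?thesis by (intro exI[of _ "{}"]) (simp add: J_def F_def term_value.simps[of "pfst x"])
    next
      case False
      define Y where "Y = (\<lambda>c. pair c (psnd x)) ` {psnd (pfst x), pfst (psnd (pfst x)), psnd (psnd (pfst x))}"
      have "finite Y" "\<forall>y\<in>Y. pfst y < pfst x" using child_less[OF False] by (auto simp: Y_def)
      moreover have "J ((\<lambda>y. pair y (F y)) ` Y) x (F x)"
        using False unfolding J_def F_def term_value.simps[of "pfst x"] by (auto simp: Y_def image_iff)
      ultimately show ?thesis by blast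
    qed
  qed
  then have "total_computable (\<lambda>n. F (pair (f n) (g n)))" by (rule tc_comp) (intro tc_intros assms)
  then show ?thesis by (simp add: F_def)
qed

text \<open>The tags 7 and 8 of the unbounded quantifiers fall under the default
  \<open>False\<close>; correctness is claimed for bounded formulas.\<close>

function formula_value :: "nat \<Rightarrow> nat \<Rightarrow> bool" where
  "formula_value c e =
     (if pfst c = 0 then term_value (pfst (psnd c)) e = term_value (psnd (psnd c)) e
      else if pfst c = 1 then term_value (pfst (psnd c)) e < term_value (psnd (psnd c)) e
      else if pfst c = 2 then \<not> formula_value (psnd c) e
      else if pfst c = 3 then formula_value (pfst (psnd c)) e \<and> formula_value (psnd (psnd c)) e
      else if pfst c = 4 then formula_value (pfst (psnd c)) e \<or> formula_value (psnd (psnd c)) e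
      else if pfst c = 5 then \<forall>i<term_value (pfst (psnd c)) e. formula_value (psnd (psnd c)) (pair i e)
      else if pfst c = 6 then \<exists>i<term_value (pfst (psnd c)) e. formula_value (psnd (psnd c)) (pair i e)
      else False)"
  by auto
termination
  by (relation "Wellfounded.measure fst") (auto intro: child_less)

declare formula_value.simps [simp del]

lemma formula_value_code: "bounded_fm \<phi> \<Longrightarrow> formula_value (fm_code \<phi>) e \<longleftrightarrow> sat (env_of e) \<phi>"
proof (induction \<phi> arbitrary: e)
qed (subst formula_value.simps, simp add: pfst_def psnd_def term_value_code env_of_pair)+

lemma tag_cases:
  fixes n :: nat
  assumes "n = 0 \<Longrightarrow> P" "n = 1 \<Longrightarrow> P" "n = 2 \<Longrightarrow> P" "n = 3 \<Longrightarrow> P" "n = 4 \<Longrightarrow> P" "n = 5 \<Longrightarrow> P"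
    "n = 6 \<Longrightarrow> P" "6 < n \<Longrightarrow> P"
  shows P
  using assms by linarith

lemma decidable_formula_value [tc_intros]:
  assumes "total_computable f" "total_computable g"
  shows "decidable (\<lambda>n. formula_value (f n) (g n))"
proof -
  define F :: "nat \<Rightarrow> nat" where "F x = of_bool (formula_value (pfst x) (psnd x))" for x
  \<comment> \<open>For the bounded quantifiers, both truth values are read off entries that are
    present, never off missing ones, because \<open>J\<close> has to be monotone in
    \<open>D\<close>.\<close>
  define J where "J D x v \<longleftrightarrow>
    (if pfst (pfst x) = 0 then v = of_bool (term_value (pfst (psnd (pfst x))) (psnd x) = term_value (psnd (psnd (pfst x))) (psnd x))
     else if pfst (pfst x) = 1 then v = of_bool (term_value (pfst (psnd (pfst x))) (psnd x) < term_value (psnd (psnd (pfst x))) (psnd x))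
     else if pfst (pfst x) = 2 then \<exists>w. pair (pair (psnd (pfst x)) (psnd x)) w \<in> D \<and> v = 1 - w
     else if pfst (pfst x) = 3 then \<exists>w. pair (pair (pfst (psnd (pfst x))) (psnd x)) w \<in> D \<and>
       (\<exists>w'. pair (pair (psnd (psnd (pfst x))) (psnd x)) w' \<in> D \<and> v = w * w')
     else if pfst (pfst x) = 4 then \<exists>w. pair (pair (pfst (psnd (pfst x))) (psnd x)) w \<in> D \<and>
       (\<exists>w'. pair (pair (psnd (psnd (pfst x))) (psnd x)) w' \<in> D \<and> v = 1 - (1 - w) * (1 - w'))
     else if pfst (pfst x) = 5 then
       v = 1 \<and> (\<forall>i<term_value (pfst (psnd (pfst x))) (psnd x). pair (pair (psnd (psnd (pfst x))) (pair i (psnd x))) 1 \<in> D) \<or>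
       v = 0 \<and> (\<exists>i<term_value (pfst (psnd (pfst x))) (psnd x). pair (pair (psnd (psnd (pfst x))) (pair i (psnd x))) 0 \<in> D)
     else if pfst (pfst x) = 6 then
       v = 1 \<and> (\<exists>i<term_value (pfst (psnd (pfst x))) (psnd x). pair (pair (psnd (psnd (pfst x))) (pair i (psnd x))) 1 \<in> D) \<or>
       v = 0 \<and> (\<forall>i<term_value (pfst (psnd (pfst x))) (psnd x). pair (pair (psnd (psnd (pfst x))) (pair i (psnd x))) 0 \<in> D)
     else v = 0)" for D and x v :: nat
  have "total_computable F"
  \<comment> \<open>Under a bounded quantifier the environment is replaced by a larger number, so
    \<open>x\<close> itself need not decrease; the code in \<open>pfst\<close> does.\<close>
  proof (rule tc_recursion[where m = pfst and J = J])
    show "decidable (\<lambda>p. J (set_decode (pfst p)) (pfst (psnd p)) (psnd (psnd p)))"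
      unfolding J_def by (intro tc_intros)
    show "J D' x v" if "D \<subseteq> D'" "J D x v" for D D' x v
      using that unfolding J_def by (cases "pfst (pfst x)" rule: tag_cases) auto
    show "v = F x" if j: "J D x v" and H: "\<And>y w. pair y w \<in> D \<Longrightarrow> pfst y < pfst x \<Longrightarrow> w = F y" for D x v
    proof -
      have H': "w = of_bool (formula_value c e)" if "pair (pair c e) w \<in> D" "c < pfst x" for c e w
        using H[OF that(1)] that(2) by (simp add: F_def)
      show ?thesis
        using j unfolding J_def F_def formula_value.simps[of "pfst x"]
        by (cases "pfst (pfst x)" rule: tag_cases) (auto dest!: H' simp: child_less)
    qed
    show "\<exists>Y. finite Y \<and> (\<forall>y\<in>Y. pfst y < pfst x) \<and> J ((\<lambda>y. pair y (F y)) ` Y) x (F x)" for x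
    proof (cases "pfst (pfst x) = 0")
      case True
      then show ?thesis by (intro exI[of _ "{}"]) (simp add: J_def F_def formula_value.simps[of "pfst x"])
    next
      case False
      define Y where "Y = (\<lambda>c. pair c (psnd x)) ` {psnd (pfst x), pfst (psnd (pfst x)), psnd (psnd (pfst x))} \<union>
        (\<lambda>i. pair (psnd (psnd (pfst x))) (pair i (psnd x))) ` {..<term_value (pfst (psnd (pfst x))) (psnd x)}"
      have "finite Y" "\<forall>y\<in>Y. pfst y < pfst x" using child_less[OF False] by (auto simp: Y_def)
      moreover have "J ((\<lambda>y. pair y (F y)) ` Y) x (F x)"
      proof -
        define D where "D = (\<lambda>y. pair y (F y)) ` Y"
        have G: "pair (pair c e) v \<in> D \<longleftrightarrow> pair c e \<in> Y \<and> v = of_bool (formula_value c e)" for c e v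
          by (auto simp: D_def F_def image_iff)
        have Y1: "pair (psnd (pfst x)) (psnd x) \<in> Y" "pair (pfst (psnd (pfst x))) (psnd x) \<in> Y" "pair (psnd (psnd (pfst x))) (psnd x) \<in> Y"
          "i < term_value (pfst (psnd (pfst x))) (psnd x) \<Longrightarrow> pair (psnd (psnd (pfst x))) (pair i (psnd x)) \<in> Y" for i
          by (auto simp: Y_def)
        have "J D x (F x)"
          using False unfolding J_def F_def formula_value.simps[of "pfst x"]
          by (cases "pfst (pfst x)" rule: tag_cases) (auto simp: G Y1)
        then show ?thesis by (simp only: D_def)
      qed
      ultimately show ?thesis by blast
    qed
  qed
  then have "total_computable (\<lambda>n. F (pair (f n) (g n)))" by (rule tc_comp) (intro tc_intros assms)
  then show ?thesis by (simp add: F_def decidable_def)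
qed

lemma tm_val_cong: "(\<And>i. i \<in> tm_vars t \<Longrightarrow> e i = e' i) \<Longrightarrow> tm_val e t = tm_val e' t"
  by (induction t) auto

text \<open>Needed because \<open>defined_set\<close> puts \<open>n\<close> at every index, whereas
  the coded environment \<open>pair n 0\<close> is 0 beyond the first. The two agree on formulas
  whose only free variable is 0.\<close>

lemma sat_cong: "(\<And>i. i \<in> free_vars \<phi> \<Longrightarrow> e i = e' i) \<Longrightarrow> sat e \<phi> \<longleftrightarrow> sat e' \<phi>"
proof (induction \<phi> arbitrary: e e')
  case (Eq s t)
  then show ?case using tm_val_cong[of s e e'] tm_val_cong[of t e e'] by simp
next
  case (Less s t)
  then show ?case using tm_val_cong[of s e e'] tm_val_cong[of t e e'] by simp
next
  case (Neg \<phi>)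
  then show ?case by (metis free_vars.simps(3) sat.simps(3))
next
  case (And \<phi> \<psi>)
  then show ?case by (metis UnCI free_vars.simps(4) sat.simps(4))
next
  case (Or \<phi> \<psi>)
  then show ?case by (metis UnCI free_vars.simps(5) sat.simps(5))
next
  case (BForall t \<phi>)
  have "sat (case_nat x e) \<phi> = sat (case_nat x e') \<phi>" for x
    by (rule BForall.IH) (use BForall.prems in \<open>auto split: nat.split\<close>)
  moreover have "tm_val e t = tm_val e' t" using BForall.prems by (intro tm_val_cong) auto
  ultimately show ?case by simp
next
  case (BExists t \<phi>)
  have "sat (case_nat x e) \<phi> = sat (case_nat x e') \<phi>" for x
    by (rule BExists.IH) (use BExists.prems in \<open>auto split: nat.split\<close>)
  moreover have "tm_val e t = tm_val e' t" using BExists.prems by (intro tm_val_cong) auto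
  ultimately show ?case by simp
next
  case (Forall \<phi>)
  have "sat (case_nat x e) \<phi> = sat (case_nat x e') \<phi>" for x
    by (rule Forall.IH) (use Forall.prems in \<open>auto split: nat.split\<close>)
  then show ?case by simp
next
  case (Exists \<phi>)
  have "sat (case_nat x e) \<phi> = sat (case_nat x e') \<phi>" for x
    by (rule Exists.IH) (use Exists.prems in \<open>auto split: nat.split\<close>)
  then show ?case by simp
qed

text \<open>The three projections strip the unbounded quantifiers from the code.\<close>

definition matrix_value :: "nat \<Rightarrow> nat \<Rightarrow> nat \<Rightarrow> nat \<Rightarrow> nat \<Rightarrow> bool" where
  "matrix_value c n x y z \<longleftrightarrow> formula_value (psnd (psnd (psnd c))) (pair z (pair y (pair x (pair n 0))))"

lemma defined_set_matrix_value:
  assumes "pi3_formula \<phi>"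
  shows "n \<in> defined_set \<phi> \<longleftrightarrow> (\<forall>x. \<exists>y. \<forall>z. matrix_value (fm_code \<phi>) n x y z)"
proof -
  obtain \<theta> where \<theta>: "bounded_fm \<theta>" "\<phi> = Forall (Exists (Forall \<theta>))" and fv: "free_vars \<phi> \<subseteq> {0}"
    using assms by (auto simp: pi3_formula_def)
  have "n \<in> defined_set \<phi> \<longleftrightarrow> sat (env_of (pair n 0)) \<phi>"
    unfolding defined_set_def mem_Collect_eq by (rule sat_cong) (use fv in \<open>auto simp: env_of_pair\<close>)
  then show ?thesis
    by (simp add: \<theta> matrix_value_def psnd_def[of "prod_encode _"] formula_value_code env_of_pair)
qed

section \<open>The construction\<close>

definition refuted :: "nat \<Rightarrow> nat \<Rightarrow> nat \<Rightarrow> nat \<Rightarrow> nat \<Rightarrow> bool" where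
  "refuted c r x Y Z \<longleftrightarrow> (\<forall>y<Suc Y. \<exists>z<Suc Z. \<not> matrix_value c r x y z)"

text \<open>Minimality of \<open>Z\<close> leaves at most one active code per \<open>(r, x, Y)\<close>. So \<open>(r, x)\<close> is active infinitely often
  iff no \<open>y\<close> satisfies \<open>\<forall>z. \<theta>(r, x, y, z)\<close>.\<close>

definition acts :: "nat \<Rightarrow> nat \<Rightarrow> nat \<Rightarrow> nat \<Rightarrow> nat \<Rightarrow> bool" where
  "acts c r x Y Z \<longleftrightarrow> perfect_powerless r \<and> refuted c r x Y Z \<and> (\<forall>Z'<Z. \<not> refuted c r x Y Z')"

text \<open>The inequality between powers is \<open>log 2 Q < k! * (1 + 1/(x+1))\<close> in
  integers. The value 0 stands for the neutral mode and cannot be mistaken for a base.\<close>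

definition request :: "nat \<Rightarrow> nat \<Rightarrow> nat" where
  "request c Q =
     (if acts c (pfst (stage Q)) (pfst (psnd (stage Q))) (pfst (psnd (psnd (stage Q)))) (psnd (psnd (psnd (stage Q)))) \<and>
         Q ^ Suc (pfst (psnd (stage Q))) < 2 ^ (fact (stage Q) * Suc (Suc (pfst (psnd (stage Q)))))
      then pfst (stage Q) else 0)"

text \<open>The bounds make the search for a step finite, and \<open>extendable_iff\<close> shows
  that they exclude none when \<open>Q\<close> and \<open>t\<close> are positive.\<close>

definition extendable :: "nat \<Rightarrow> nat \<Rightarrow> nat \<Rightarrow> nat \<Rightarrow> bool" where
  "extendable r t C Q \<longleftrightarrow> (\<exists>Q'<Suc (Q ^ (t + 1)). \<exists>C'<Suc ((C + 1) * Q'). admissible r t C Q C' Q')"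

text \<open>A request is granted only if a step exists at some level of at least \<open>r\<close>.
  Therefore a low level can occur only in one of finitely many modes, which is what drives the
  levels to infinity.\<close>

definition mode :: "nat \<Rightarrow> nat \<Rightarrow> nat \<Rightarrow> nat" where
  "mode c C Q = (if request c Q \<noteq> 0 \<and> (\<exists>t<Suc Q. request c Q \<le> t \<and> extendable (request c Q) t C Q)
     then request c Q else 0)"

text \<open>The disjunct \<open>d = Q\<close> makes the search total.\<close>

definition level :: "nat \<Rightarrow> nat \<Rightarrow> nat \<Rightarrow> nat" where
  "level c C Q = Q - (LEAST d. d = Q \<or> extendable (mode c C Q) (Q - d) C Q)"

text \<open>On arguments that admit no step the first disjunct ends the search at 0. The function
  has to be total, although the run never meets such arguments.\<close>

definition extension :: "nat \<Rightarrow> nat \<Rightarrow> nat \<Rightarrow> nat" where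
  "extension c C Q = (LEAST n. \<not> extendable (mode c C Q) (level c C Q) C Q \<or>
     admissible (mode c C Q) (level c C Q) C Q (pfst n) (psnd n))"

text \<open>The run starts from \<open>[0, 1/2]\<close>. With \<open>Q = 1\<close> no step at a
  positive level could satisfy both \<open>2 * Q \<le> Q'\<close> and
  \<open>Q' ^ t \<le> Q ^ (t + 1)\<close>.\<close>

definition state :: "nat \<Rightarrow> nat \<Rightarrow> nat" where
  "state c n = rec_nat (pair 0 2) (\<lambda>_ y. extension c (pfst y) (psnd y)) n"

section \<open>A next step always exists\<close>

lemma extendable_iff:
  assumes "Q \<ge> 1" "t \<ge> 1"
  shows "extendable r t C Q \<longleftrightarrow> (\<exists>C' Q'. admissible r t C Q C' Q')"
proof
  assume "\<exists>C' Q'. admissible r t C Q C' Q'"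
  then obtain C' Q' where a: "admissible r t C Q C' Q'" by blast
  then have h: "(C' + 1) * Q \<le> (C + 1) * Q'" "Q' ^ t \<le> Q ^ (t + 1)" "2 * Q \<le> Q'"
    by (auto simp: admissible_def refines_def)
  have "Q' ^ 1 \<le> Q' ^ t" using assms h by (intro power_increasing) auto
  then have "Q' < Suc (Q ^ (t + 1))" using h(2) by (simp del: power_Suc)
  moreover have "C' * 1 \<le> (C' + 1) * Q" using assms by (intro mult_le_mono) auto
  then have "C' < Suc ((C + 1) * Q')" using h(1) by linarith
  ultimately show "extendable r t C Q" unfolding extendable_def using a by blast
qed (auto simp: extendable_def)

text \<open>At level 1 there is no base to test, so passing to the left half of the interval is
  always admissible. The construction can never get stuck.\<close>

lemma extendable_neutral:
  assumes "Q \<ge> 2"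
  shows "extendable 0 1 C Q"
proof -
  have "admissible 0 1 C Q (2 * C) (2 * Q)"
  proof -
    have "2 * Q \<le> Q * Q" using assms by (intro mult_right_mono) auto
    moreover have "refines C Q (2 * C) (2 * Q)" by (simp add: refines_def)
    moreover have "\<not> perfect_powerless s" if "s < Suc 1" for s using that by (simp add: perfect_powerless_def)
    ultimately show ?thesis unfolding admissible_def by (auto simp: power2_eq_square)
  qed
  then show ?thesis using assms by (subst extendable_iff) auto
qed

lemma mode_extendable:
  assumes Q: "Q \<ge> 2"
  shows "\<exists>t. 1 \<le> t \<and> t \<le> Q \<and> mode c C Q \<le> t \<and> extendable (mode c C Q) t C Q"
proof (cases "mode c C Q = 0")
  case True
  then show ?thesis using extendable_neutral[OF Q, of C] Q by (intro exI[of _ 1]) auto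
next
  case False
  then have "mode c C Q = request c Q" "\<exists>t<Suc Q. request c Q \<le> t \<and> extendable (request c Q) t C Q"
    unfolding mode_def by (auto split: if_splits)
  then obtain t where "t < Suc Q" "mode c C Q \<le> t" "extendable (mode c C Q) t C Q" by auto
  then show ?thesis using False by (intro exI[of _ t]) auto
qed

lemma level:
  assumes Q: "Q \<ge> 2"
  shows "extendable (mode c C Q) (level c C Q) C Q" "1 \<le> level c C Q" "mode c C Q \<le> level c C Q"
    and "\<And>t. t \<le> Q \<Longrightarrow> extendable (mode c C Q) t C Q \<Longrightarrow> t \<le> level c C Q"
proof -
  let ?P = "\<lambda>d. d = Q \<or> extendable (mode c C Q) (Q - d) C Q"
  have max: "t \<le> level c C Q" if "t \<le> Q" "extendable (mode c C Q) t C Q" for t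
  proof -
    have "(LEAST d. ?P d) \<le> Q - t" by (rule Least_le) (use that in simp)
    then show ?thesis using that(1) unfolding level_def by linarith
  qed
  obtain t where t: "1 \<le> t" "t \<le> Q" "mode c C Q \<le> t" "extendable (mode c C Q) t C Q"
    using mode_extendable[OF Q] by blast
  then have "t \<le> level c C Q" by (intro max)
  then show "1 \<le> level c C Q" "mode c C Q \<le> level c C Q" using t by auto
  have "?P (LEAST d. ?P d)" by (rule LeastI[of ?P Q]) simp
  then show "extendable (mode c C Q) (level c C Q) C Q"
    using \<open>1 \<le> level c C Q\<close> unfolding level_def by fastforce
  show "\<And>t. t \<le> Q \<Longrightarrow> extendable (mode c C Q) t C Q \<Longrightarrow> t \<le> level c C Q" by (rule max)
qed

lemma extension_admissible:
  assumes Q: "Q \<ge> 2"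
  shows "admissible (mode c C Q) (level c C Q) C Q (pfst (extension c C Q)) (psnd (extension c C Q))"
proof -
  obtain C' Q' where "admissible (mode c C Q) (level c C Q) C Q C' Q'"
    using level(1)[OF Q] unfolding extendable_def by blast
  then have "\<exists>n. \<not> extendable (mode c C Q) (level c C Q) C Q \<or> admissible (mode c C Q) (level c C Q) C Q (pfst n) (psnd n)"
    by (intro exI[of _ "pair C' Q'"]) simp
  then have "\<not> extendable (mode c C Q) (level c C Q) C Q \<or>
     admissible (mode c C Q) (level c C Q) C Q (pfst (extension c C Q)) (psnd (extension c C Q))"
    unfolding extension_def by (rule LeastI_ex)
  then show ?thesis using level(1)[OF Q] by blast
qed

lemma request_minimal: "request c Q \<noteq> 0 \<Longrightarrow> request c Q \<in> minimal_bases"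
  unfolding request_def acts_def by (auto simp: perfect_powerless_iff split: if_splits)

lemma mode_minimal: "mode c C Q = 0 \<or> mode c C Q \<in> minimal_bases"
  unfolding mode_def using request_minimal by auto

lemma power_less_iff_log2:
  fixes Q a b :: nat
  assumes "Q \<ge> 1"
  shows "Q ^ a < 2 ^ b \<longleftrightarrow> real a * log 2 Q < real b"
proof -
  have "Q ^ a < 2 ^ b \<longleftrightarrow> real (Q ^ a) < real (2 ^ b)" by (simp only: of_nat_less_iff)
  also have "\<dots> \<longleftrightarrow> real Q ^ a < 2 powr b" by (simp add: powr_realpow)
  also have "\<dots> \<longleftrightarrow> log 2 (real Q ^ a) < b" using assms by (subst log_less_iff) auto
  also have "log 2 (real Q ^ a) = real a * log 2 Q" using assms by (intro log_nat_power) simp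
  finally show ?thesis .
qed

section \<open>The run for one formula code\<close>

context
  fixes c :: nat
begin

abbreviation "stC n \<equiv> pfst (state c n)"
abbreviation "stQ n \<equiv> psnd (state c n)"

lemma state_ge: "stQ n \<ge> 2 \<and> stC n + 1 \<le> stQ n"
proof (induction n)
  case 0
  show ?case by (simp add: state_def)
next
  case (Suc n)
  have e: "state c (Suc n) = extension c (stC n) (stQ n)" by (simp add: state_def)
  have Q: "stQ n \<ge> 2" using Suc by simp
  have "refines (stC n) (stQ n) (stC (Suc n)) (stQ (Suc n))" "2 * stQ n \<le> stQ (Suc n)"
    using extension_admissible[OF Q, of c "stC n"] unfolding e[symmetric] by (auto simp: admissible_def)
  then have "(stC (Suc n) + 1) * stQ n \<le> (stC n + 1) * stQ (Suc n)" "stQ (Suc n) \<ge> 2" using Q by (auto simp: refines_def)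
  moreover have "(stC n + 1) * stQ (Suc n) \<le> stQ n * stQ (Suc n)" using Suc by (intro mult_right_mono) auto
  ultimately have "(stC (Suc n) + 1) * stQ n \<le> stQ (Suc n) * stQ n" by (simp add: mult.commute)
  then show ?case using Q \<open>stQ (Suc n) \<ge> 2\<close> by (simp only: mult_le_cancel2)
qed

lemma state_admissible:
  "admissible (mode c (stC n) (stQ n)) (level c (stC n) (stQ n)) (stC n) (stQ n) (stC (Suc n)) (stQ (Suc n))"
proof -
  have "state c (Suc n) = extension c (stC n) (stQ n)" by (simp add: state_def)
  then show ?thesis using extension_admissible[of "stQ n" c "stC n"] state_ge[of n] by simp
qed

lemma state_mono: "stQ n \<ge> n"
proof (induction n)
  case (Suc n)
  have "2 * stQ n \<le> stQ (Suc n)" using state_admissible[of n] by (simp add: admissible_def)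
  then show ?case using Suc state_ge[of n] by linarith
qed simp

text \<open>A mode above \<open>T'\<close> already forces a level above \<open>T'\<close>. For the
  finitely many modes \<open>r \<le> T'\<close>, it is enough that \<open>Q\<close> has passed the
  thresholds of \<open>feasible\<close>, which need not be known to the construction.\<close>

lemma level_unbounded: "\<exists>n0. \<forall>n\<ge>n0. T \<le> level c (stC n) (stQ n)"
proof -
  define T' where "T' = max 1 T"
  have T': "T' \<ge> 1" by (simp add: T'_def)
  have "\<forall>r. \<exists>Q0. r = 0 \<or> r \<in> minimal_bases \<longrightarrow> (\<forall>Q\<ge>Q0. \<forall>C. \<exists>C' Q'. admissible r T' C Q C' Q')"
  proof
    fix r
    show "\<exists>Q0. r = 0 \<or> r \<in> minimal_bases \<longrightarrow> (\<forall>Q\<ge>Q0. \<forall>C. \<exists>C' Q'. admissible r T' C Q C' Q')"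
    proof (cases "r = 0 \<or> r \<in> minimal_bases")
      case True
      from feasible[OF this T'] obtain Q0 where "\<forall>Q\<ge>Q0. \<forall>C. \<exists>C' Q'. admissible r T' C Q C' Q'" ..
      then show ?thesis by (intro exI[of _ Q0] impI)
    qed simp
  qed
  from choice[OF this] obtain Q0 where Q0':
    "\<forall>r. r = 0 \<or> r \<in> minimal_bases \<longrightarrow> (\<forall>Q\<ge>Q0 r. \<forall>C. \<exists>C' Q'. admissible r T' C Q C' Q')" ..
  have Q0: "\<exists>C' Q'. admissible r T' C Q C' Q'" if "r = 0 \<or> r \<in> minimal_bases" "Q \<ge> Q0 r" for r Q C
    using Q0'[rule_format, OF that] .
  define n0 where "n0 = T' + (\<Sum>r\<le>T'. Q0 r)"
  have "T \<le> level c (stC n) (stQ n)" if n: "n \<ge> n0" for n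
  proof (cases "mode c (stC n) (stQ n) \<le> T'")
    case True
    let ?r = "mode c (stC n) (stQ n)"
    have "Q0 ?r \<le> (\<Sum>r\<le>T'. Q0 r)" using True by (intro member_le_sum) auto
    then have "Q0 ?r \<le> stQ n" "T' \<le> stQ n" using state_mono[of n] n by (auto simp: n0_def)
    then have "\<exists>C' Q'. admissible ?r T' (stC n) (stQ n) C' Q'" using mode_minimal by (intro Q0)
    then have "extendable ?r T' (stC n) (stQ n)" using T' state_ge[of n] by (subst extendable_iff) auto
    then have "T' \<le> level c (stC n) (stQ n)" using \<open>T' \<le> stQ n\<close> state_ge[of n] by (intro level(4)) auto
    then show ?thesis by (simp add: T'_def)
  next
    case False
    then show ?thesis using level(3)[of "stQ n" c "stC n"] state_ge[of n] by (simp add: T'_def)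
  qed
  then show ?thesis by blast
qed

lemma limit_exists: "\<exists>\<xi>. \<forall>n. real (stC n) / stQ n \<le> \<xi> \<and> \<xi> \<le> (real (stC n) + 1) / stQ n"
proof -
  have pos: "real (stQ n) > 0" for n using state_ge[of n] by simp
  have step: "real (stC n) / stQ n \<le> real (stC (Suc n)) / stQ (Suc n)"
    "(real (stC (Suc n)) + 1) / stQ (Suc n) \<le> (real (stC n) + 1) / stQ n" for n
  proof -
    have "stC n * stQ (Suc n) \<le> stC (Suc n) * stQ n" "(stC (Suc n) + 1) * stQ n \<le> (stC n + 1) * stQ (Suc n)"
      using state_admissible[of n] by (auto simp: admissible_def refines_def)
    then have "real (stC n * stQ (Suc n)) \<le> real (stC (Suc n) * stQ n)"
      "real ((stC (Suc n) + 1) * stQ n) \<le> real ((stC n + 1) * stQ (Suc n))" by (simp_all only: of_nat_le_iff)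
    then show "real (stC n) / stQ n \<le> real (stC (Suc n)) / stQ (Suc n)"
      "(real (stC (Suc n)) + 1) / stQ (Suc n) \<le> (real (stC n) + 1) / stQ n"
      using pos[of n] pos[of "Suc n"] by (simp_all add: field_simps)
  qed
  have inc: "real (stC m) / stQ m \<le> real (stC n) / stQ n" if "m \<le> n" for m n
    by (rule lift_Suc_mono_le[OF _ that, of "\<lambda>n. real (stC n) / stQ n"]) (rule step(1))
  have dec: "(real (stC n) + 1) / stQ n \<le> (real (stC m) + 1) / stQ m" if "m \<le> n" for m n
    by (rule lift_Suc_antimono_le[OF _ that, of "\<lambda>n. (real (stC n) + 1) / stQ n"]) (rule step(2))
  have ub: "real (stC n) / stQ n \<le> (real (stC m) + 1) / stQ m" for m n
  proof -
    have "real (stC n) / stQ n \<le> real (stC (max m n)) / stQ (max m n)" by (rule inc) simp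
    also have "\<dots> \<le> (real (stC (max m n)) + 1) / stQ (max m n)" using pos by (intro divide_right_mono) auto
    also have "\<dots> \<le> (real (stC m) + 1) / stQ m" by (rule dec) simp
    finally show ?thesis .
  qed
  define \<xi> where "\<xi> = (SUP n. real (stC n) / stQ n)"
  have bdd: "bdd_above (range (\<lambda>n. real (stC n) / stQ n))" by (rule bdd_aboveI2[of _ _ "(real (stC 0) + 1) / stQ 0"]) (rule ub)
  have "real (stC n) / stQ n \<le> \<xi>" for n unfolding \<xi>_def by (rule cSUP_upper[OF _ bdd]) simp
  moreover have "\<xi> \<le> (real (stC n) + 1) / stQ n" for n unfolding \<xi>_def by (rule cSUP_least) (auto intro: ub)
  ultimately show ?thesis by blast
qed

definition limit :: real where
  "limit = (SOME \<xi>. \<forall>n. real (stC n) / stQ n \<le> \<xi> \<and> \<xi> \<le> (real (stC n) + 1) / stQ n)"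

lemma limit: "real (stC n) / stQ n \<le> limit" "limit \<le> (real (stC n) + 1) / stQ n"
  using someI_ex[OF limit_exists] unfolding limit_def by blast+

interpretation refinement "\<lambda>n. stC n" "\<lambda>n. stQ n" "\<lambda>n. mode c (stC n) (stQ n)" "\<lambda>n. level c (stC n) (stQ n)" limit
proof
  show "2 \<le> stQ 0" by (simp add: state_def)
qed (rule state_admissible level_unbounded limit)+

lemma request_Lam:
  "request c (stQ n) =
     (if acts c (pfst (stage (stQ n))) (pfst (psnd (stage (stQ n)))) (pfst (psnd (psnd (stage (stQ n))))) (psnd (psnd (psnd (stage (stQ n))))) \<and>
         \<Lambda> n < fact (stage (stQ n)) * (1 + 1 / (real (pfst (psnd (stage (stQ n)))) + 1))
      then pfst (stage (stQ n)) else 0)"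
proof -
  have "stQ n ^ Suc x < 2 ^ (fact k * Suc (Suc x)) \<longleftrightarrow> \<Lambda> n < fact k * (1 + 1 / (real x + 1))" for k x
  proof -
    have "stQ n ^ Suc x < 2 ^ (fact k * Suc (Suc x)) \<longleftrightarrow> real (Suc x) * \<Lambda> n < real (fact k * Suc (Suc x))"
      unfolding \<Lambda>_def using state_ge[of n] by (intro power_less_iff_log2) simp
    also have "real (fact k * Suc (Suc x)) = (real x + 1) * (fact k * (1 + 1 / (real x + 1)))"
      by (simp add: field_simps)
    also have "real (Suc x) * \<Lambda> n < (real x + 1) * (fact k * (1 + 1 / (real x + 1))) \<longleftrightarrow> \<Lambda> n < fact k * (1 + 1 / (real x + 1))"
      by (subst mult_less_cancel_left_pos[symmetric, of "real x + 1" "\<Lambda> n"]) (auto simp: add.commute)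
    finally show ?thesis .
  qed
  then show ?thesis unfolding request_def by simp
qed

lemma normal_if_in_set:
  assumes s: "s \<in> minimal_bases" and in_set: "\<forall>x. \<exists>y. \<forall>z. matrix_value c s x y z"
  shows "normal_to_base limit s"
proof (rule normal_if_zones_shrink)
  show "perfect_powerless s" using s by (simp add: perfect_powerless_iff)
  fix X :: nat
  obtain y0 where y0: "\<And>x z. matrix_value c s x (y0 x) z" using in_set by metis
  define B where "B = {k. pfst k = s \<and> pfst (psnd k) < X \<and> acts c s (pfst (psnd k)) (pfst (psnd (psnd k))) (psnd (psnd (psnd k)))}"
  \<comment> \<open>The witness \<open>y0 x\<close> is never refuted, so \<open>Y < y0 x\<close>,
    and minimality determines \<open>Z\<close> from the rest.\<close>
  have "B \<subseteq> (\<Union>x<X. \<Union>Y<y0 x. {pair s (pair x (pair Y (LEAST Z. refuted c s x Y Z)))})"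
  proof
    fix k assume k: "k \<in> B"
    define x where "x = pfst (psnd k)"
    define Y where "Y = pfst (psnd (psnd k))"
    define Z where "Z = psnd (psnd (psnd k))"
    have "k = pair (pfst k) (pair x (pair Y Z))" unfolding x_def Y_def Z_def by simp
    moreover have "pfst k = s" using k by (simp add: B_def)
    ultimately have kk: "k = pair s (pair x (pair Y Z))" by simp
    have xa: "x < X" "acts c s x Y Z" using k by (auto simp: B_def x_def Y_def Z_def)
    have "Z = (LEAST Z. refuted c s x Y Z)"
    proof (rule Least_equality[symmetric])
      show "refuted c s x Y Z" using xa by (simp add: acts_def)
      show "Z \<le> Z'" if "refuted c s x Y Z'" for Z' using xa that unfolding acts_def by (meson not_less)
    qed
    moreover have "Y < y0 x"
    proof (rule ccontr)
      assume "\<not> Y < y0 x"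
      then have "\<exists>z<Suc Z. \<not> matrix_value c s x (y0 x) z" using xa unfolding acts_def refuted_def by auto
      then show False using y0 by blast
    qed
    ultimately show "k \<in> (\<Union>x<X. \<Union>Y<y0 x. {pair s (pair x (pair Y (LEAST Z. refuted c s x Y Z)))})"
      using kk xa(1) by blast
  qed
  then have "finite B" by (rule finite_subset) auto
  then obtain k0 where k0: "\<And>k. k \<in> B \<Longrightarrow> k < k0" by (meson finite_nat_set_iff_bounded)
  have "\<Lambda> n \<le> fact (stage (stQ n)) * (1 + 1 / (real X + 1))"
    if n: "mode c (stC n) (stQ n) = s" "k0 \<le> stage (stQ n)" for n
  proof -
    define k where "k = stage (stQ n)"
    define x where "x = pfst (psnd k)"
    have "s \<noteq> 0" using s by (auto simp: minimal_bases_def base_def)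
    then have "request c (stQ n) = s" "request c (stQ n) \<noteq> 0" using n(1) unfolding mode_def by (auto split: if_splits)
    then have a: "pfst k = s" "acts c s x (pfst (psnd (psnd k))) (psnd (psnd (psnd k)))" "\<Lambda> n < fact k * (1 + 1 / (real x + 1))"
      unfolding request_Lam k_def x_def by (auto split: if_splits)
    have "k \<notin> B" using k0[of k] n(2) by (auto simp: k_def)
    then have "X \<le> x" using a by (auto simp: B_def x_def)
    then have "fact k * (1 + 1 / (real x + 1)) \<le> fact k * (1 + 1 / (real X + 1))"
      by (intro mult_left_mono add_left_mono divide_left_mono) auto
    then show ?thesis using a(3) unfolding k_def by linarith
  qed
  then show "\<exists>k0. \<forall>n. mode c (stC n) (stQ n) = s \<longrightarrow> k0 \<le> stage (stQ n) \<longrightarrow>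
      \<Lambda> n \<le> fact (stage (stQ n)) * (1 + 1 / (real X + 1))" by blast
qed

lemma not_normal_if_not_in_set:
  assumes r: "r \<in> minimal_bases" and out: "\<forall>y. \<exists>z. \<not> matrix_value c r x y z"
  shows "\<not> normal_to_base limit r"
proof (rule not_normal_if_zones_recur)
  show r2: "r \<ge> 2" using r by (simp add: minimal_bases_def base_def)
  have "r \<ge> 1" using r2 by simp
  from feasible[OF disjI2[OF r] this] obtain Q1 where "\<forall>Q\<ge>Q1. \<forall>C. \<exists>C' Q'. admissible r r C Q C' Q'" ..
  then have Q1: "\<exists>C' Q'. admissible r r C Q C' Q'" if "Q \<ge> Q1" for Q C using that by simp
  fix k0 :: nat
  \<comment> \<open>At stage \<open>k\<close> one has \<open>Y \<le> k \<le> stQ i\<close>. So this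
    \<open>Y\<close> puts the code beyond \<open>k0\<close> and makes \<open>stQ i\<close> large
    enough for the request to be granted at level \<open>r\<close>.\<close>
  define Y where "Y = max k0 (max r Q1)"
  have "\<exists>Z. refuted c r x Y Z"
  proof -
    obtain g where g: "\<And>y. \<not> matrix_value c r x y (g y)" using out by metis
    have "g y < Suc (\<Sum>y\<le>Y. g y)" if "y < Suc Y" for y
      using member_le_sum[of y "{..Y}" g] that by (simp add: less_Suc_eq_le)
    then show ?thesis unfolding refuted_def using g by blast
  qed
  then have "refuted c r x Y (LEAST Z. refuted c r x Y Z)" by (rule LeastI_ex)
  then have act: "acts c r x Y (LEAST Z. refuted c r x Y Z)"
    unfolding acts_def using r not_less_Least by (auto simp: perfect_powerless_iff)
  define k where "k = pair r (pair x (pair Y (LEAST Z. refuted c r x Y Z)))"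
  have "Y \<le> k" unfolding k_def pair_def by (meson le_prod_encode_1 le_prod_encode_2 order_trans)
  have "mode c (stC i) (stQ i) = r" if i: "stage (stQ i) = k" "\<Lambda> i < fact k * (1 + 1 / (real x + 1))" for i
  proof -
    have req: "request c (stQ i) = r" unfolding request_Lam i(1) using act i(2) by (simp add: k_def)
    have "k < 2 ^ k" by (rule less_exp)
    also have "(2::nat) ^ k \<le> 2 ^ fact k" by (intro power_increasing fact_ge_self) auto
    also have "\<dots> \<le> stQ i" using stage_ge(1)[of "stQ i"] state_ge[of i] i(1) by simp
    finally have "Y \<le> stQ i" using \<open>Y \<le> k\<close> by simp
    then have Q: "Q1 \<le> stQ i" "r \<le> stQ i" by (auto simp: Y_def)
    then have "extendable r r (stC i) (stQ i)" using Q1 r2 by (subst extendable_iff) auto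
    then have "\<exists>t<Suc (stQ i). r \<le> t \<and> extendable r t (stC i) (stQ i)" using Q by (intro exI[of _ r]) auto
    then show ?thesis unfolding mode_def req using r2 by simp
  qed
  then show "\<exists>k\<ge>k0. \<forall>i. stage (stQ i) = k \<longrightarrow> \<Lambda> i < fact k * (1 + 1 / (real x + 1)) \<longrightarrow> mode c (stC i) (stQ i) = r"
    using \<open>Y \<le> k\<close> by (intro exI[of _ k]) (auto simp: Y_def)
qed

lemma normal_limit_iff:
  "r \<in> minimal_bases \<Longrightarrow> normal_to_base limit r \<longleftrightarrow> (\<forall>x. \<exists>y. \<forall>z. matrix_value c r x y z)"
  using normal_if_in_set not_normal_if_not_in_set by blast

lemma limit_approx: "\<bar>limit - real (stC n) / stQ n\<bar> \<le> 1 / 2 ^ n"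
proof -
  have "(2::nat) ^ n \<le> 2 ^ Suc n" by simp
  also have "\<dots> \<le> stQ n" by (rule Q_lower)
  finally have "2 ^ n \<le> stQ n" .
  then have "real (2 ^ n) \<le> real (stQ n)" by (simp only: of_nat_le_iff)
  then have "1 / real (stQ n) \<le> 1 / 2 ^ n" using state_ge[of n] by (intro divide_left_mono) auto
  then show ?thesis using limit[of n] by (simp add: add_divide_distrib)
qed

end

section \<open>Computability of the construction\<close>

lemma tc_flog [tc_intros]:
  "total_computable f \<Longrightarrow> total_computable g \<Longrightarrow> total_computable (\<lambda>n. flog (f n) (g n))"
proof -
  assume a: "total_computable f" "total_computable g"
  show ?thesis unfolding flog_def by (intro tc_intros a(1,2)[THEN tc_comp])
qed

lemma decidable_meets_cell [tc_intros]:
  assumes "total_computable s" "total_computable t" "total_computable C" "total_computable Q"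
    "total_computable m" "total_computable j"
  shows "decidable (\<lambda>n. meets_cell (s n) (t n) (C n) (Q n) (m n) (j n))"
  unfolding meets_cell_def by (intro tc_intros assms[THEN tc_comp])

lemma decidable_good [tc_intros]:
  assumes "total_computable s" "total_computable t" "total_computable Q" "total_computable C'" "total_computable Q'"
  shows "decidable (\<lambda>n. good (s n) (t n) (Q n) (C' n) (Q' n))"
  unfolding good_def by (intro tc_intros assms[THEN tc_comp])

lemma decidable_biased [tc_intros]:
  assumes "total_computable r" "total_computable Q" "total_computable C'" "total_computable Q'"
  shows "decidable (\<lambda>n. biased (r n) (Q n) (C' n) (Q' n))"
  unfolding biased_def by (intro tc_intros assms[THEN tc_comp])

lemma decidable_perfect_powerless [tc_intros]:
  assumes "total_computable s"
  shows "decidable (\<lambda>n. perfect_powerless (s n))"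
  unfolding perfect_powerless_def by (intro tc_intros assms[THEN tc_comp])

lemma decidable_admissible [tc_intros]:
  assumes "total_computable r" "total_computable t" "total_computable C" "total_computable Q"
    "total_computable C'" "total_computable Q'"
  shows "decidable (\<lambda>n. admissible (r n) (t n) (C n) (Q n) (C' n) (Q' n))"
  unfolding admissible_def refines_def by (intro tc_intros assms[THEN tc_comp])

lemma tc_stage [tc_intros]:
  assumes "total_computable Q"
  shows "total_computable (\<lambda>n. stage (Q n))"
  unfolding stage_def
proof (rule tc_Least)
  show "decidable (\<lambda>p. Q (psnd p) < 2 ^ fact (Suc (pfst p)))" by (intro tc_intros assms[THEN tc_comp])
  show "\<exists>k. Q n < 2 ^ fact (Suc k)" for n using stage_less by blast
qed

lemma decidable_matrix_value [tc_intros]: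
  assumes "total_computable c" "total_computable r" "total_computable x" "total_computable y" "total_computable z"
  shows "decidable (\<lambda>n. matrix_value (c n) (r n) (x n) (y n) (z n))"
  unfolding matrix_value_def by (intro tc_intros assms)

lemma decidable_refuted [tc_intros]:
  assumes "total_computable c" "total_computable r" "total_computable x" "total_computable Y" "total_computable Z"
  shows "decidable (\<lambda>n. refuted (c n) (r n) (x n) (Y n) (Z n))"
  unfolding refuted_def by (intro tc_intros assms[THEN tc_comp])

lemma tc_request [tc_intros]:
  assumes "total_computable c" "total_computable Q"
  shows "total_computable (\<lambda>n. request (c n) (Q n))"
  unfolding request_def acts_def by (intro tc_intros assms[THEN tc_comp])

lemma decidable_extendable [tc_intros]:
  assumes "total_computable r" "total_computable t" "total_computable C" "total_computable Q"
  shows "decidable (\<lambda>n. extendable (r n) (t n) (C n) (Q n))"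
  unfolding extendable_def by (intro tc_intros assms[THEN tc_comp])

lemma tc_mode [tc_intros]:
  assumes "total_computable c" "total_computable C" "total_computable Q"
  shows "total_computable (\<lambda>n. mode (c n) (C n) (Q n))"
  unfolding mode_def by (intro tc_intros assms[THEN tc_comp])

lemma tc_level [tc_intros]:
  assumes "total_computable c" "total_computable C" "total_computable Q"
  shows "total_computable (\<lambda>n. level (c n) (C n) (Q n))"
  unfolding level_def
  by (intro tc_intros tc_Least assms[THEN tc_comp]) blast

lemma tc_extension [tc_intros]:
  assumes "total_computable c" "total_computable C" "total_computable Q"
  shows "total_computable (\<lambda>n. extension (c n) (C n) (Q n))"
  unfolding extension_def
proof (rule tc_Least)
  show "decidable (\<lambda>p. \<not> extendable (mode (c (psnd p)) (C (psnd p)) (Q (psnd p))) (level (c (psnd p)) (C (psnd p)) (Q (psnd p))) (C (psnd p)) (Q (psnd p)) \<or>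
      admissible (mode (c (psnd p)) (C (psnd p)) (Q (psnd p))) (level (c (psnd p)) (C (psnd p)) (Q (psnd p))) (C (psnd p)) (Q (psnd p)) (pfst (pfst p)) (psnd (pfst p)))"
    by (intro tc_intros assms[THEN tc_comp])
  show "\<exists>i. \<not> extendable (mode (c n) (C n) (Q n)) (level (c n) (C n) (Q n)) (C n) (Q n) \<or>
      admissible (mode (c n) (C n) (Q n)) (level (c n) (C n) (Q n)) (C n) (Q n) (pfst i) (psnd i)" for n
  proof (cases "extendable (mode (c n) (C n) (Q n)) (level (c n) (C n) (Q n)) (C n) (Q n)")
    case True
    then obtain C' Q' where "admissible (mode (c n) (C n) (Q n)) (level (c n) (C n) (Q n)) (C n) (Q n) C' Q'"
      unfolding extendable_def by blast
    then show ?thesis by (intro exI[of _ "pair C' Q'"]) simp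
  qed simp
qed

lemma tc_state [tc_intros]:
  assumes "total_computable c" "total_computable k"
  shows "total_computable (\<lambda>n. state (c n) (k n))"
  unfolding state_def
  by (rule tc_rec[where g = "\<lambda>i y n. extension (c n) (pfst y) (psnd y)"]) (intro tc_intros assms assms[THEN tc_comp])+

section \<open>Programs depending computably on a parameter\<close>

primrec const_program :: "nat \<Rightarrow> recf" where
  "const_program 0 = Zero"
| "const_program (Suc c) = Comp Succ [const_program c]"

lemma evals_const_program: "evals (const_program c) xs c"
proof (induction c)
  case (Suc c)
  show ?case unfolding const_program.simps
    by (rule evals.Comp[where ys = "[c]"]) (auto intro: Suc evals.Succ)
qed (simp add: evals.Zero)

text \<open>The s-m-n theorem for one parameter: the parameter is compiled into the program as a
  constant, and the code of that constant is primitive recursive in it.\<close>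

lemma parameter_program:
  assumes f: "total_computable f"
  shows "\<exists>S. (\<forall>c n. evals (S c) [n] (f (pair c n))) \<and> total_computable (\<lambda>c. recf_code (S c))"
proof -
  have "list_computable 2 (\<lambda>xs. pair (xs ! 0) (xs ! 1))" by (intro list_computable_pair list_computable_nth) auto
  then obtain q where q: "\<And>xs. length xs = 2 \<Longrightarrow> evals q xs (pair (xs ! 0) (xs ! 1))"
    unfolding list_computable_def by blast
  obtain p where p: "\<And>n. evals p [n] (f n)" using f unfolding total_computable_def by blast
  define S where "S c = Comp p [Comp q [const_program c, Proj 0]]" for c
  have "evals (S c) [n] (f (pair c n))" for c n
  proof -
    have "evals (Comp q [const_program c, Proj 0]) [n] (pair c n)"
    proof (rule evals.Comp[where ys = "[c, n]"])
      show "evals ([const_program c, Proj 0] ! i) [n] ([c, n] ! i)" if "i < length [const_program c, Proj 0]" for i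
        using that evals.Proj[of 0 "[n]"] evals_const_program by (auto simp: less_Suc_eq)
      show "evals q [c, n] (pair c n)" using q[of "[c, n]"] by simp
    qed simp
    then show ?thesis unfolding S_def by (intro evals.Comp[where ys = "[pair c n]"]) (auto intro: p)
  qed
  moreover have "total_computable (\<lambda>c. recf_code (S c))"
  proof -
    \<comment> \<open>\<open>list_encode [a]\<close> is \<open>Suc (pair a 0)\<close>, which
      accounts for the \<open>Suc\<close> in the codes of argument lists.\<close>
    have "recf_code (const_program c) =
        rec_nat (pair 0 0) (\<lambda>i y. pair 3 (pair (pair 1 0) (Suc (pair y 0)))) c" for c
      by (induction c) (simp_all add: pair_def)
    moreover have "total_computable (\<lambda>c. rec_nat (pair 0 0) (\<lambda>i y. pair 3 (pair (pair 1 0) (Suc (pair y 0)))) c)"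
      by (rule tc_rec[where g = "\<lambda>i y n. pair 3 (pair (pair 1 0) (Suc (pair y 0)))"]) (intro tc_intros)+
    ultimately have const: "total_computable (\<lambda>c. recf_code (const_program c))" by simp
    have "recf_code (S c) = pair 3 (pair (recf_code p) (Suc (pair (pair 3 (pair (recf_code q)
        (Suc (pair (recf_code (const_program c)) (Suc (pair (pair 2 0) 0)))))) 0)))" for c
      by (simp add: S_def pair_def)
    then show ?thesis by (simp only:) (intro tc_intros const)
  qed
  ultimately show ?thesis by blast
qed

text \<open>Even codes decode to the nonnegative integers, and \<open>rat_decode\<close> adds 1 to
  the coded denominator.\<close>

lemma rat_decode_pair: "d \<ge> 1 \<Longrightarrow> real_of_rat (rat_decode (pair (2 * a) (d - 1))) = real a / real d"
  by (simp add: rat_decode_def pair_def int_decode_def sum_decode_def of_rat_divide)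

theorem theorem2:
  shows "(\<forall>R. R \<subseteq> minimal_bases \<and> pi3_set R \<longrightarrow>
            (\<exists>\<xi>. computable_real \<xi> \<and>
                 (\<forall>r\<in>minimal_bases. r \<in> R \<longleftrightarrow> normal_to_base \<xi> r)))
       \<and> (\<exists>F. total_computable F \<and>
            (\<forall>\<phi>. pi3_formula \<phi> \<and> defined_set \<phi> \<subseteq> minimal_bases \<longrightarrow>
               (\<exists>\<xi>. index_computes_real (F (fm_code \<phi>)) \<xi> \<and>
                    (\<forall>r\<in>minimal_bases. r \<in> defined_set \<phi> \<longleftrightarrow> normal_to_base \<xi> r))))"
proof -
  define A where "A x = pair (2 * pfst (state (pfst x) (psnd x))) (psnd (state (pfst x) (psnd x)) - 1)" for x
  have "total_computable A" unfolding A_def by (intro tc_intros)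
  from parameter_program[OF this] obtain S where S: "\<forall>c n. evals (S c) [n] (A (pair c n))"
    and F: "total_computable (\<lambda>c. recf_code (S c))" by blast
  \<comment> \<open>\<open>limit c\<close> exists for every number \<open>c\<close>, whether or not
    it codes a formula, so the index function needs no case distinction.\<close>
  have computes: "program_computes_real (S c) (limit c)" for c
    unfolding program_computes_real_def
  proof
    fix n
    have "real_of_rat (rat_decode (A (pair c n))) = real (pfst (state c n)) / real (psnd (state c n))"
      unfolding A_def using state_ge[of c n] by (simp only: pfst_pair psnd_pair) (rule rat_decode_pair, simp)
    then show "\<exists>m. evals (S c) [n] m \<and> \<bar>limit c - real_of_rat (rat_decode m)\<bar> \<le> 1 / 2 ^ n"
      using S limit_approx[of c n] by (intro exI[of _ "A (pair c n)"]) simp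
  qed
  have normal: "r \<in> defined_set \<phi> \<longleftrightarrow> normal_to_base (limit (fm_code \<phi>)) r"
    if "pi3_formula \<phi>" "r \<in> minimal_bases" for \<phi> r
    using defined_set_matrix_value[OF that(1)] normal_limit_iff[OF that(2)] by simp
  show ?thesis
  proof (intro conjI allI impI exI[of _ "\<lambda>c. recf_code (S c)"])
    fix R assume R: "R \<subseteq> minimal_bases \<and> pi3_set R"
    then obtain \<phi> where "pi3_formula \<phi>" "R = defined_set \<phi>" by (auto simp: pi3_set_def)
    then show "\<exists>\<xi>. computable_real \<xi> \<and> (\<forall>r\<in>minimal_bases. r \<in> R \<longleftrightarrow> normal_to_base \<xi> r)"
      using computes normal by (intro exI[of _ "limit (fm_code \<phi>)"]) (auto simp: computable_real_def)
  next
    fix \<phi> assume "pi3_formula \<phi> \<and> defined_set \<phi> \<subseteq> minimal_bases"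
    then show "\<exists>\<xi>. index_computes_real (recf_code (S (fm_code \<phi>))) \<xi> \<and>
        (\<forall>r\<in>minimal_bases. r \<in> defined_set \<phi> \<longleftrightarrow> normal_to_base \<xi> r)"
      using computes normal by (intro exI[of _ "limit (fm_code \<phi>)"]) (auto simp: index_computes_real_def)
  qed (rule F)
qed

end
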